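(* (i) There is a polynomial-time algorithm that, given a graph $G$, decides whether $G$ has a vertex-labeling by degree from $\mathbb{N}_2=\{1,2\}$. (ii) For every fixed integer $k\geq 3$, the following decision problem is $\mathbf{NP}$-complete: given a graph $G$ with chromatic number $\chi(G)=k+1$, decide whether $G$ has a vertex-labeling by degree from $\mathbb{N}_k$.
   Context: All graphs are finite and simple; $d(v)$ denotes the degree of $v$. For a positive integer $k$, $\mathbb{N}_k=\{1,\ldots,k\}$. A vertex-labeling by degree from $\mathbb{N}_k$ of a graph $G$ is a map $f:V(G)\to\mathbb{N}_k$ such that the vertex coloring $c(v)=f(v)\,d(v)$ is a proper vertex coloring, i.e. $c(u)\neq c(v)$ for every edge $uv$. *)

theory Defs
  imports Main "HOL-Computational_Algebra.Polynomial"
begin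

section \<open>Graphs and labelings\<close>

type_synonym 'a graph = "'a set \<times> 'a set set"

definition simple_graph :: "'a graph \<Rightarrow> bool" where
  "simple_graph G \<longleftrightarrow> finite (fst G) \<and> (\<forall>e\<in>snd G. e \<subseteq> fst G \<and> card e = 2)"

definition vertex_degree :: "'a graph \<Rightarrow> 'a \<Rightarrow> nat" where
  "vertex_degree G v = card {e \<in> snd G. v \<in> e}"

definition proper_coloring :: "'a graph \<Rightarrow> ('a \<Rightarrow> 'c) \<Rightarrow> bool" where
  "proper_coloring G c \<longleftrightarrow> (\<forall>u v. {u, v} \<in> snd G \<longrightarrow> c u \<noteq> c v)"

definition chromatic_number :: "'a graph \<Rightarrow> nat" where
  "chromatic_number G =
     (LEAST k. \<exists>c :: 'a \<Rightarrow> nat. proper_coloring G c \<and> c ` fst G \<subseteq> {..<k})"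

definition labeling_by_degree :: "nat \<Rightarrow> 'a graph \<Rightarrow> ('a \<Rightarrow> nat) \<Rightarrow> bool" where
  "labeling_by_degree k G f \<longleftrightarrow>
     f ` fst G \<subseteq> {1..k} \<and> proper_coloring G (\<lambda>v. f v * vertex_degree G v)"

definition has_labeling_by_degree :: "nat \<Rightarrow> 'a graph \<Rightarrow> bool" where
  "has_labeling_by_degree k G \<longleftrightarrow> (\<exists>f. labeling_by_degree k G f)"

section \<open>Deterministic multi-tape Turing machines\<close>

text \<open>
  States are the numbers below \<open>states M\<close>, tape symbols the numbers below \<open>symbols M\<close>.
  Symbol 0 is the blank; 1 and 2 represent the input bits. Tapes are infinite in both directions.
\<close>

datatype move = Left | Stay | Right

record tm =
  tapes :: nat
  states :: nat
  symbols :: nat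
  start :: nat
  accept :: nat
  reject :: nat
  delta :: "nat \<Rightarrow> nat list \<Rightarrow> nat \<times> (nat \<times> move) list"

definition wf_tm :: "tm \<Rightarrow> bool" where
  "wf_tm M \<longleftrightarrow> 2 \<le> tapes M \<and> 3 \<le> symbols M \<and>
     start M < states M \<and> accept M < states M \<and> reject M < states M \<and> accept M \<noteq> reject M \<and>
     (\<forall>q < states M. \<forall>ss. length ss = tapes M \<and> set ss \<subseteq> {..<symbols M} \<longrightarrow>
        fst (delta M q ss) < states M \<and>
        length (snd (delta M q ss)) = tapes M \<and>
        fst ` set (snd (delta M q ss)) \<subseteq> {..<symbols M})"

text \<open>A tape is its content together with the head position.\<close>

type_synonym tape = "(int \<Rightarrow> nat) \<times> int"
type_synonym config = "nat \<times> tape list"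

fun offset :: "move \<Rightarrow> int" where
  "offset Left = -1"
| "offset Stay = 0"
| "offset Right = 1"

definition act :: "nat \<times> move \<Rightarrow> tape \<Rightarrow> tape" where
  "act a t = ((fst t)(snd t := fst a), snd t + offset (snd a))"

definition step :: "tm \<Rightarrow> config \<Rightarrow> config" where
  "step M c =
     (if fst c \<in> {accept M, reject M} then c
      else let r = delta M (fst c) (map (\<lambda>t. fst t (snd t)) (snd c))
           in (fst r, map2 act (snd r) (snd c)))"

definition tape_content :: "bool list \<Rightarrow> int \<Rightarrow> nat" where
  "tape_content w i =
     (if 0 \<le> i \<and> i < int (length w) then (if w ! nat i then 2 else 1) else 0)"

text \<open>The \<open>i\<close>-th input string is written on the \<open>i\<close>-th tape; the other tapes are blank.\<close>

definition init :: "tm \<Rightarrow> bool list list \<Rightarrow> config" where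
  "init M ws =
     (start M, map (\<lambda>i. (tape_content (if i < length ws then ws ! i else []), 0)) [0..<tapes M])"

definition run :: "tm \<Rightarrow> bool list list \<Rightarrow> nat \<Rightarrow> config" where
  "run M ws t = (step M ^^ t) (init M ws)"

text \<open>Halting configurations are fixed by \<open>step\<close>, so these mean ``within \<open>t\<close> steps''.\<close>

definition accepts_within :: "tm \<Rightarrow> bool list list \<Rightarrow> nat \<Rightarrow> bool" where
  "accepts_within M ws t \<longleftrightarrow> fst (run M ws t) = accept M"

definition rejects_within :: "tm \<Rightarrow> bool list list \<Rightarrow> nat \<Rightarrow> bool" where
  "rejects_within M ws t \<longleftrightarrow> fst (run M ws t) = reject M"

text \<open>The output is the content of tape number 1.\<close>

definition outputs_within :: "tm \<Rightarrow> bool list \<Rightarrow> nat \<Rightarrow> bool list \<Rightarrow> bool" where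
  "outputs_within M x t y \<longleftrightarrow>
     accepts_within M [x] t \<and> fst (snd (run M [x] t) ! 1) = tape_content y"

section \<open>Polynomial time and NP\<close>

text \<open>
  A promise problem is the pair of its sets of yes-instances and no-instances. A language \<open>L\<close>
  is the promise problem \<open>(L, - L)\<close>.
\<close>

type_synonym problem = "bool list set \<times> bool list set"

definition poly_time_decidable :: "problem \<Rightarrow> bool" where
  "poly_time_decidable A \<longleftrightarrow> (\<exists>M (p :: nat poly). wf_tm M \<and>
     (\<forall>x \<in> fst A. accepts_within M [x] (poly p (length x))) \<and>
     (\<forall>x \<in> snd A. rejects_within M [x] (poly p (length x))))"

definition poly_time_computable :: "(bool list \<Rightarrow> bool list) \<Rightarrow> bool" where
  "poly_time_computable f \<longleftrightarrow> (\<exists>M (p :: nat poly). wf_tm M \<and>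
     (\<forall>x. outputs_within M x (poly p (length x)) (f x)))"

text \<open>Polynomial-time verification of certificates of polynomial length.\<close>

definition in_NP :: "problem \<Rightarrow> bool" where
  "in_NP A \<longleftrightarrow> (\<exists>M (p :: nat poly) (q :: nat poly). wf_tm M \<and>
     (\<forall>x \<in> fst A \<union> snd A. \<forall>y. length y \<le> poly q (length x) \<longrightarrow>
        accepts_within M [x, y] (poly p (length x)) \<or>
        rejects_within M [x, y] (poly p (length x))) \<and>
     (\<forall>x \<in> fst A. \<exists>y. length y \<le> poly q (length x) \<and>
        accepts_within M [x, y] (poly p (length x))) \<and>
     (\<forall>x \<in> snd A. \<forall>y. length y \<le> poly q (length x) \<longrightarrow>
        rejects_within M [x, y] (poly p (length x))))"

definition poly_time_reduces :: "problem \<Rightarrow> problem \<Rightarrow> bool" where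
  "poly_time_reduces A B \<longleftrightarrow>
     (\<exists>f. poly_time_computable f \<and> f ` fst A \<subseteq> fst B \<and> f ` snd A \<subseteq> snd B)"

definition NP_hard :: "problem \<Rightarrow> bool" where
  "NP_hard A \<longleftrightarrow> (\<forall>L. in_NP (L, - L) \<longrightarrow> poly_time_reduces (L, - L) A)"

definition NP_complete :: "problem \<Rightarrow> bool" where
  "NP_complete A \<longleftrightarrow> in_NP A \<and> NP_hard A"

section \<open>Decision problems on graphs\<close>

text \<open>
  Input graphs have vertex set \<open>{..<n}\<close> for some \<open>n\<close> and are given by \<open>n\<close> in unary
  followed by the adjacency matrix.
\<close>

definition encode :: "nat graph \<Rightarrow> bool list" where
  "encode G = (let n = card (fst G) in
     replicate n True @ [False] @
     concat (map (\<lambda>i. map (\<lambda>j. {i, j} \<in> snd G) [0..<n]) [0..<n]))"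

definition input_graph :: "nat graph \<Rightarrow> bool" where
  "input_graph G \<longleftrightarrow> simple_graph G \<and> (\<exists>n. fst G = {..<n})"

lemma encode_inj:
  assumes "input_graph G" "input_graph H" "encode G = encode H"
  shows "G = H"
proof -
  obtain n m where n: "fst G = {..<n}" and m: "fst H = {..<m}"
    using assms by (auto simp: input_graph_def)
  have tw: "length (takeWhile id (encode K)) = card (fst K)" for K
    by (simp add: encode_def Let_def takeWhile_append)
  have nm: "n = m"
    using tw[of G] tw[of H] assms(3) n m by simp
  let ?r = "\<lambda>K i. map (\<lambda>j. {i, j} \<in> snd (K :: nat graph)) [0..<n]"
  have "concat (map (?r G) [0..<n]) = concat (map (?r H) [0..<n])"
    using assms(3) n m nm by (simp add: encode_def Let_def)
  moreover have "\<forall>(x, y) \<in> set (zip (map (?r G) [0..<n]) (map (?r H) [0..<n])). length x = length y"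
    by (auto simp: set_zip)
  ultimately have "map (?r G) [0..<n] = map (?r H) [0..<n]"
    using concat_injective[of "map (?r G) [0..<n]" "map (?r H) [0..<n]"] by simp
  then have eq: "{i, j} \<in> snd G \<longleftrightarrow> {i, j} \<in> snd H" if "i < n" "j < n" for i j
    using that by (simp add: list_eq_iff_nth_eq)
  have sub: "\<exists>i j. e = {i, j} \<and> i < n \<and> j < n" if "e \<in> snd G \<or> e \<in> snd H" for e
  proof -
    have "card e = 2" "e \<subseteq> {..<n}"
      using that assms n m nm by (auto simp: input_graph_def simple_graph_def)
    then show ?thesis by (auto simp: card_2_iff)
  qed
  have "snd G = snd H"
    using eq sub by blast
  then show ?thesis
    using n m nm by (simp add: prod_eq_iff)
qed

text \<open>Given a graph with property \<open>P\<close> (the promise), decide whether it has property \<open>Q\<close>.\<close>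

definition graph_problem :: "(nat graph \<Rightarrow> bool) \<Rightarrow> (nat graph \<Rightarrow> bool) \<Rightarrow> problem" where
  "graph_problem P Q =
     (encode ` {G. input_graph G \<and> P G \<and> Q G}, encode ` {G. input_graph G \<and> P G \<and> \<not> Q G})"

end

theory Submission imports Defs "HOL-Library.Nat_Bijection" begin

text \<open>
  Polynomial time is obtained once and for all from a small language of arithmetic expressions with bounded
  sums over the input: all values are polynomially bounded, so a multi-tape machine evaluates them in unary,
  with head positions as counters. A program fills a table whose entries are given by such an expression,
  which may read the entries written before.

  With labels 1 and 2 the condition on each edge is a conjunction of 2-clauses, and the table computes
  reachability in the implication graph.

  For the hardness, a machine verifying certificates is turned into a system of rules \<open>a \<and> b \<longrightarrow> c\<close> on facts
  about its run. Only the certificate is guessed, by pairs of facts exactly one of which holds; everything else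
  is propagated, and the final state must not be the rejecting one. The system is expressed by
  \<open>k\<close>-colorability of a graph containing a palette of \<open>k\<close> mutually adjacent vertices. Pendant vertices raise all
  degrees to one large number \<open>N\<close>, so that labelings are the same as \<open>k\<close>-colorings. A single vertex joined to
  the palette is exempted: its degree \<open>k\<close> makes its product differ from those of its neighbours, while it raises
  the chromatic number to \<open>k + 1\<close>, and with \<open>k + 1\<close> colours the rest of the graph is always colorable.
\<close>

section \<open>Structured tape programs\<close>

text \<open>The chromatic number has to be exactly \<open>k + 1\<close> whether or not the input is
  accepted, so even an unsatisfiable system must yield a \<open>(k + 1)\<close>-colorable graph.
  This shapes the encoding: facts can escape to the additional colour \<open>k\<close>, and a pair
  takes 0 and \<open>k\<close>, which works because the pairs form a bipartite graph and no initial
  fact lies on the side coloured 0. The lower bound is the clique formed by the palette and the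
  apex. A solution of the rules may contain facts that are false of the run. This is harmless: rules
  only add facts, so a solution contains all true facts of the run on the certificate that it
  guesses, and its only prohibition excludes rejection; as the machine decides in time, it then
  accepts. Rules have two premises, while a transition depends on all tapes; hence the scanned
  symbols are collected one tape at a time.\<close>

type_synonym store = "nat \<Rightarrow> tape"

abbreviation scan :: "tape \<Rightarrow> nat" where
  "scan t \<equiv> fst t (snd t)"

datatype com =
    Mv nat move
  | Wt nat nat
  | Sq com com (infixr ";;" 60)
  | Ite nat nat com com
  | Whl nat nat com

text \<open>\<open>Whl j a c\<close> iterates \<open>c\<close> while tape \<open>j\<close> does \<^emph>\<open>not\<close> scan the symbol \<open>a\<close>.\<close>

inductive big :: "com \<Rightarrow> store \<Rightarrow> nat \<Rightarrow> store \<Rightarrow> bool" where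
  Mv: "big (Mv j d) s 1 (s(j := (fst (s j), snd (s j) + offset d)))"
| Wt: "big (Wt j a) s 1 (s(j := ((fst (s j))(snd (s j) := a), snd (s j))))"
| Sq: "big c1 s t1 s1 \<Longrightarrow> big c2 s1 t2 s2 \<Longrightarrow> big (c1 ;; c2) s (t1 + t2) s2"
| IteT: "scan (s j) = a \<Longrightarrow> big c1 s t s1 \<Longrightarrow> big (Ite j a c1 c2) s (1 + t) s1"
| IteF: "scan (s j) \<noteq> a \<Longrightarrow> big c2 s t s1 \<Longrightarrow> big (Ite j a c1 c2) s (1 + t) s1"
| WhlF: "scan (s j) = a \<Longrightarrow> big (Whl j a c) s 1 s"
| WhlT: "scan (s j) \<noteq> a \<Longrightarrow> big c s t1 s1 \<Longrightarrow> big (Whl j a c) s1 t2 s2 \<Longrightarrow>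
    big (Whl j a c) s (1 + (t1 + t2)) s2"

fun max_tape :: "com \<Rightarrow> nat" where
  "max_tape (Mv j d) = j"
| "max_tape (Wt j a) = j"
| "max_tape (c1 ;; c2) = max (max_tape c1) (max_tape c2)"
| "max_tape (Ite j a c1 c2) = max j (max (max_tape c1) (max_tape c2))"
| "max_tape (Whl j a c) = max j (max_tape c)"

fun ternary :: "com \<Rightarrow> bool" where
  "ternary (Mv j d) = True"
| "ternary (Wt j a) = (a < 3)"
| "ternary (c1 ;; c2) = (ternary c1 \<and> ternary c2)"
| "ternary (Ite j a c1 c2) = (ternary c1 \<and> ternary c2)"
| "ternary (Whl j a c) = ternary c"

datatype instr = IMv nat move nat | IWt nat nat nat | ITst nat nat nat nat

fun clen :: "com \<Rightarrow> nat" where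
  "clen (Mv j d) = 1"
| "clen (Wt j a) = 1"
| "clen (c1 ;; c2) = clen c1 + clen c2"
| "clen (Ite j a c1 c2) = 1 + (clen c1 + clen c2)"
| "clen (Whl j a c) = 1 + clen c"

text \<open>In \<open>code c p e\<close> the instructions are located from address \<open>p\<close> on, and control leaves to \<open>e\<close>.\<close>

fun code :: "com \<Rightarrow> nat \<Rightarrow> nat \<Rightarrow> instr list" where
  "code (Mv j d) p e = [IMv j d e]"
| "code (Wt j a) p e = [IWt j a e]"
| "code (c1 ;; c2) p e = code c1 p (p + clen c1) @ code c2 (p + clen c1) e"
| "code (Ite j a c1 c2) p e =
     ITst j a (p + 1) (p + 1 + clen c1) # code c1 (p + 1) e @ code c2 (p + 1 + clen c1) e"
| "code (Whl j a c) p e = ITst j a e (p + 1) # code c (p + 1) p"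

lemma length_code [simp]: "length (code c p e) = clen c"
  by (induction c arbitrary: p e) auto

lemma clen_pos [simp]: "0 < clen c"
  by (induction c) auto

fun targets :: "instr \<Rightarrow> nat set" where
  "targets (IMv j d n) = {n}"
| "targets (IWt j a n) = {n}"
| "targets (ITst j a n1 n2) = {n1, n2}"

fun written :: "instr \<Rightarrow> nat set" where
  "written (IWt j a n) = {a}"
| "written _ = {}"

lemma targets_code: "i \<in> set (code c p e) \<Longrightarrow> targets i \<subseteq> {p..<p + clen c} \<union> {e}"
  by (induction c arbitrary: p e) (fastforce simp: add.assoc)+

lemma written_code: "ternary c \<Longrightarrow> i \<in> set (code c p e) \<Longrightarrow> written i \<subseteq> {..<3}"
  by (induction c arbitrary: p e) fastforce+

fun exec_instr :: "nat \<Rightarrow> instr \<Rightarrow> nat list \<Rightarrow> nat \<times> (nat \<times> move) list" where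
  "exec_instr m (IMv j d n) ss = (n, map (\<lambda>i. (ss ! i, if i = j then d else Stay)) [0..<m])"
| "exec_instr m (IWt j a n) ss = (n, map (\<lambda>i. (if i = j then a else ss ! i, Stay)) [0..<m])"
| "exec_instr m (ITst j a n1 n2) ss =
     (if ss ! j = a then n1 else n2, map (\<lambda>i. (ss ! i, Stay)) [0..<m])"

text \<open>Address \<open>clen c\<close>, the exit of the program, holds a last test whose targets
  are the two halting states.\<close>

definition instrs :: "com \<Rightarrow> nat \<Rightarrow> instr list" where
  "instrs c r = code c 0 (clen c) @ [ITst r 1 (clen c + 2) (clen c + 1)]"

text \<open>The machine runs \<open>c\<close> and rejects if and only if tape \<open>r\<close> scans 1 afterwards.\<close>

definition machine :: "nat \<Rightarrow> com \<Rightarrow> nat \<Rightarrow> tm" where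
  "machine m c r =
     \<lparr>tapes = m, states = clen c + 3, symbols = 3, start = 0,
      accept = clen c + 1, reject = clen c + 2,
      delta = (\<lambda>q ss. if q \<le> clen c then exec_instr m (instrs c r ! q) ss
                      else (q, map (\<lambda>i. (ss ! i, Stay)) [0..<m]))\<rparr>"

lemma wf_machine:
  assumes "2 \<le> m" "ternary c"
  shows "wf_tm (machine m c r)"
proof -
  have *: "fst (exec_instr m i ss) \<in> targets i \<and> length (snd (exec_instr m i ss)) = m \<and>
      fst ` set (snd (exec_instr m i ss)) \<subseteq> written i \<union> set ss" if "length ss = m" for i ss
    using that by (cases i) auto
  have **: "targets (instrs c r ! q) \<subseteq> {..<clen c + 3} \<and> written (instrs c r ! q) \<subseteq> {..<3}"
    if "q \<le> clen c" for q
  proof (cases "q < clen c")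
    case True
    then have "instrs c r ! q \<in> set (code c 0 (clen c))"
      by (auto simp: instrs_def nth_append)
    from targets_code[OF this] written_code[OF assms(2) this] show ?thesis by fastforce
  next
    case False
    with that have "instrs c r ! q = ITst r 1 (clen c + 2) (clen c + 1)"
      by (auto simp: instrs_def nth_append)
    then show ?thesis by auto
  qed
  have "fst (delta (machine m c r) q ss) < clen c + 3 \<and>
        length (snd (delta (machine m c r) q ss)) = m \<and>
        fst ` set (snd (delta (machine m c r) q ss)) \<subseteq> {..<3}"
    if "q < clen c + 3" "length ss = m" "set ss \<subseteq> {..<3}" for q ss
  proof (cases "q \<le> clen c")
    case True
    have "delta (machine m c r) q ss = exec_instr m (instrs c r ! q) ss"
      using True by (simp add: machine_def)
    with *[OF that(2), of "instrs c r ! q"] **[OF True] that(3) show ?thesis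
      by (metis Un_subset_iff lessThan_iff subset_iff subset_trans)
  next
    case False
    moreover have "ss ! i < 3" if "i < m" for i
      using \<open>set ss \<subseteq> {..<3}\<close> \<open>length ss = m\<close> that by (metis lessThan_iff nth_mem subset_iff)
    ultimately show ?thesis using that by (auto simp: machine_def)
  qed
  then show ?thesis using assms by (simp add: wf_tm_def machine_def)
qed

definition code_at :: "instr list \<Rightarrow> nat \<Rightarrow> instr list \<Rightarrow> bool" where
  "code_at P p xs \<longleftrightarrow> (\<forall>i < length xs. P ! (p + i) = xs ! i)"

lemma code_at_Cons: "code_at P p (x # xs) \<longleftrightarrow> P ! p = x \<and> code_at P (Suc p) xs"
  by (auto simp: code_at_def less_Suc_eq_0_disj nth_Cons')

lemma code_at_append: "code_at P p (xs @ ys) \<longleftrightarrow> code_at P p xs \<and> code_at P (p + length xs) ys"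
  unfolding code_at_def
  by (auto simp: nth_append add.assoc)
    (metis add_diff_inverse_nat nat_add_left_cancel_less)

lemma step_machine:
  assumes "q \<le> clen c"
  shows "step (machine m c r) (q, ts) =
    (let d = exec_instr m (instrs c r ! q) (map scan ts) in (fst d, map2 act (snd d) ts))"
  using assms by (auto simp: step_def machine_def)

lemma map2_act_map:
  "map2 act (map f [0..<m]) (map s [0..<m]) = map (\<lambda>i. act (f i) (s i)) [0..<m]"
  by (simp add: zip_map_map zip_same_conv_map)

text \<open>The time is exact: \<open>big\<close> charges one unit for each move, write and test,
  and each of them is one machine step. The exit \<open>e\<close> is arbitrary, so that the body of
  a loop can be treated with exit \<open>p\<close>, the address of its test. As \<open>m\<close>
  exceeds all tape numbers, cutting the store down to \<open>m\<close> tapes loses nothing.\<close>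

lemma machine_simulates:
  assumes "big c s t s'" "max_tape c < m" "code_at (instrs b r) p (code c p e)" "p + clen c \<le> clen b"
  shows "(step (machine m b r) ^^ t) (p, map s [0..<m]) = (e, map s' [0..<m])"
  using assms
proof (induction arbitrary: p e rule: big.induct)
  case (Mv j d s)
  then show ?case
    by (auto simp: step_machine code_at_Cons map2_act_map act_def intro!: nth_equalityI)
next
  case (Wt j a s)
  then show ?case
    by (auto simp: step_machine code_at_Cons map2_act_map act_def intro!: nth_equalityI)
next
  case (Sq c1 s t1 s1 c2 t2 s2)
  show ?case
    using Sq.IH(1)[of p "p + clen c1"] Sq.IH(2)[of "p + clen c1" e] Sq.prems
    by (simp add: code_at_append add.commute[of t1] funpow_add)
next
  case (IteT s j a c1 t s1 c2)
  then have 1: "step (machine m b r) (p, map s [0..<m]) = (p + 1, map s [0..<m])"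
    by (auto simp: step_machine code_at_Cons map2_act_map act_def intro!: nth_equalityI)
  show ?case
    using IteT.IH[of "p + 1" e] IteT.prems 1
    by (simp add: code_at_Cons code_at_append funpow_swap1)
next
  case (IteF s j a c2 t s1 c1)
  then have 1: "step (machine m b r) (p, map s [0..<m]) = (p + 1 + clen c1, map s [0..<m])"
    by (auto simp: step_machine code_at_Cons map2_act_map act_def intro!: nth_equalityI)
  show ?case
    using IteF.IH[of "p + 1 + clen c1" e] IteF.prems 1
    by (simp add: code_at_Cons code_at_append funpow_swap1)
next
  case (WhlF s j a c)
  then show ?case
    by (auto simp: step_machine code_at_Cons map2_act_map act_def intro!: nth_equalityI)
next
  case (WhlT s j a c t1 s1 t2 s2)
  then have 1: "step (machine m b r) (p, map s [0..<m]) = (p + 1, map s [0..<m])"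
    by (auto simp: step_machine code_at_Cons map2_act_map act_def intro!: nth_equalityI)
  show ?case
    using WhlT.IH(1)[of "p + 1" p] WhlT.IH(2)[of p e] WhlT.prems 1
    by (simp add: code_at_Cons add.commute[of t1] funpow_add funpow_swap1)
qed

lemma step_halt: "q = accept M \<or> q = reject M \<Longrightarrow> (step M ^^ t) (q, ts) = (q, ts)"
  by (induction t) (auto simp: step_def)

lemma machine_run:
  assumes "big c s t s'" "max_tape c < m" "r < m"
    and init: "init (machine m c r) ws = (0, map s [0..<m])" and "t < T"
  shows "run (machine m c r) ws T =
    (if scan (s' r) = 1 then reject (machine m c r) else accept (machine m c r), map s' [0..<m])"
proof -
  let ?M = "machine m c r"
  \<comment> \<open>\<open>t\<close> steps for the program, one for the final test, and
    \<open>u\<close> idle steps in a halting state.\<close>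
  obtain u where T: "T = u + (1 + t)"
    using \<open>t < T\<close> by (metis add.commute less_iff_Suc_add plus_1_eq_Suc add.assoc add_Suc_right)
  have at: "code_at (instrs c r) 0 (code c 0 (clen c))" and
    last: "instrs c r ! clen c = ITst r 1 (clen c + 2) (clen c + 1)"
    by (auto simp: code_at_def instrs_def nth_append)
  have "(step ?M ^^ t) (0, map s [0..<m]) = (clen c, map s' [0..<m])"
    using machine_simulates[OF assms(1,2) at] by simp
  moreover have "step ?M (clen c, map s' [0..<m]) =
      (if scan (s' r) = 1 then reject ?M else accept ?M, map s' [0..<m])"
    using \<open>r < m\<close>
    by (subst step_machine)
      (auto simp: last machine_def map2_act_map act_def intro!: nth_equalityI)
  ultimately show ?thesis
    unfolding run_def init T funpow_add by (auto simp: step_halt)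
qed

section \<open>Unary counters\<close>

definition runs :: "com \<Rightarrow> store \<Rightarrow> nat \<Rightarrow> store \<Rightarrow> bool" where
  "runs c s T s' \<longleftrightarrow> (\<exists>t \<le> T. big c s t s')"

lemma runs_mono: "runs c s T s' \<Longrightarrow> T \<le> T' \<Longrightarrow> runs c s T' s'"
  unfolding runs_def by (meson order_trans)

lemma runs_Sq: "runs c1 s T1 s1 \<Longrightarrow> runs c2 s1 T2 s2 \<Longrightarrow> runs (c1 ;; c2) s (T1 + T2) s2"
  unfolding runs_def by (meson add_mono big.Sq)

lemma runs_Ite:
  assumes "scan (s j) = a \<Longrightarrow> runs c1 s T s'" "scan (s j) \<noteq> a \<Longrightarrow> runs c2 s T s'"
  shows "runs (Ite j a c1 c2) s (1 + T) s'"
  using assms unfolding runs_def by (cases "scan (s j) = a") (meson add_left_mono big.IteT big.IteF)+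

text \<open>An explicit sequence of stores replaces a loop invariant. Each round costs one test more
  than its body; the final 1 is the test that leaves the loop.\<close>

lemma runs_Whl:
  assumes "\<And>i. i < n \<Longrightarrow> scan (\<sigma> i j) \<noteq> a" "scan (\<sigma> n j) = a"
    and "\<And>i. i < n \<Longrightarrow> runs c (\<sigma> i) T (\<sigma> (Suc i))"
  shows "runs (Whl j a c) (\<sigma> 0) (n * (T + 1) + 1) (\<sigma> n)"
  using assms
proof (induction n arbitrary: \<sigma>)
  case 0
  then show ?case unfolding runs_def by (intro exI[of _ 1]) (simp add: big.WhlF del: One_nat_def)
next
  case (Suc n)
  have "runs (Whl j a c) (\<sigma> (Suc 0)) (n * (T + 1) + 1) (\<sigma> (Suc n))"
    using Suc.IH[of "\<lambda>i. \<sigma> (Suc i)"] Suc.prems by auto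
  then obtain t2 where t2: "t2 \<le> n * (T + 1) + 1" "big (Whl j a c) (\<sigma> (Suc 0)) t2 (\<sigma> (Suc n))"
    by (auto simp: runs_def)
  obtain t1 where t1: "t1 \<le> T" "big c (\<sigma> 0) t1 (\<sigma> (Suc 0))"
    using Suc.prems(3)[of 0] by (auto simp: runs_def)
  have "big (Whl j a c) (\<sigma> 0) (1 + (t1 + t2)) (\<sigma> (Suc n))"
    using Suc.prems(1)[of 0] t1 t2 by (intro big.WhlT) auto
  then show ?case
    using t1(1) t2(1) unfolding runs_def by (intro exI[of _ "1 + (t1 + t2)"]) simp
qed

text \<open>The single mark at the origin provides the zero test of a counter.\<close>

definition counter_tape :: "int \<Rightarrow> nat" where
  "counter_tape i = (if i = 0 then 1 else 0)"

text \<open>Tapes 0 and 1 hold data; on every other tape \<open>j\<close> the head position is the value of a counter,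
  and \<open>g j\<close> is the head position on tape \<open>j\<close>.\<close>

definition store :: "(int \<Rightarrow> nat) \<Rightarrow> (int \<Rightarrow> nat) \<Rightarrow> (nat \<Rightarrow> nat) \<Rightarrow> store" where
  "store X Y g j = (if j = 0 then X else if j = 1 then Y else counter_tape, int (g j))"

lemma scan_counter: "2 \<le> j \<Longrightarrow> scan (store X Y g j) = 1 \<longleftrightarrow> g j = 0"
  by (auto simp: store_def counter_tape_def)

lemma scan_data: "scan (store X Y g 0) = X (int (g 0))" "scan (store X Y g (Suc 0)) = Y (int (g 1))"
  by (auto simp: store_def)

fun shift :: "move \<Rightarrow> nat \<Rightarrow> nat \<Rightarrow> nat" where
  "shift Left v n = v - n"
| "shift Stay v n = v"
| "shift Right v n = v + n"

lemma runs_Mv: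
  assumes "d = Left \<Longrightarrow> 0 < g j"
  shows "runs (Mv j d) (store X Y g) 1 (store X Y (g(j := shift d (g j) 1)))"
proof -
  have "store X Y (g(j := shift d (g j) 1)) =
      (store X Y g)(j := (fst (store X Y g j), snd (store X Y g j) + offset d))"
    using assms by (cases d) (auto simp: store_def fun_eq_iff)
  then show ?thesis unfolding runs_def by (metis big.Mv order_refl)
qed

abbreviation skip :: com where
  "skip \<equiv> Mv 0 Stay"

lemma runs_skip: "runs skip (store X Y g) 1 (store X Y g)"
  using runs_Mv[of Stay g 0] by simp

text \<open>The counter is decremented before the body runs, hence \<open>n - Suc i\<close> in the
  premise. \<open>Z\<close> lets the content of tape 1 change from round to round, as happens when a
  table is written.\<close>

lemma runs_count_down:
  assumes "2 \<le> r" and "\<And>i. i \<le> n \<Longrightarrow> G i r = n - i"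
    and "\<And>i. i < n \<Longrightarrow> runs c (store X (Z i) ((G i)(r := n - Suc i))) T (store X (Z (Suc i)) (G (Suc i)))"
  shows "runs (Whl r 1 (Mv r Left ;; c)) (store X (Z 0) (G 0)) (n * (T + 2) + 1) (store X (Z n) (G n))"
proof -
  have "runs (Mv r Left ;; c) (store X (Z i) (G i)) (1 + T) (store X (Z (Suc i)) (G (Suc i)))"
    if "i < n" for i
  proof (rule runs_Sq)
    show "runs (Mv r Left) (store X (Z i) (G i)) 1 (store X (Z i) ((G i)(r := n - Suc i)))"
      using runs_Mv[of Left "G i" r X "Z i"] assms(2)[of i] that by simp
  qed (use assms(3) that in blast)
  moreover have "scan (store X (Z i) (G i) r) \<noteq> 1" if "i < n" for i
    using scan_counter[OF assms(1)] assms(2)[of i] that by (simp del: One_nat_def)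
  moreover have "scan (store X (Z n) (G n) r) = 1"
    using scan_counter[OF assms(1)] assms(2)[of n] by (simp del: One_nat_def)
  ultimately show ?thesis
    using runs_Whl[of n "\<lambda>i. store X (Z i) (G i)" r 1 "Mv r Left ;; c" "1 + T"] by simp
qed

text \<open>Reading a counter destroys it, so a copy needs two targets moved in lockstep. A target
  with \<open>Stay\<close> is a dummy, two of them clear the counter, and the targets 0 and 1 place
  a data head on a computed cell or bring it back.\<close>

definition Transfer :: "nat \<Rightarrow> nat \<Rightarrow> move \<Rightarrow> nat \<Rightarrow> move \<Rightarrow> com" where
  "Transfer r j d j' d' = Whl r 1 (Mv r Left ;; Mv j d ;; Mv j' d')"

lemma runs_Transfer:
  assumes "2 \<le> r" "r \<noteq> j" "r \<noteq> j'" "j \<noteq> j'"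
    and "d = Left \<Longrightarrow> g r \<le> g j" "d' = Left \<Longrightarrow> g r \<le> g j'"
    and "g' = g(r := 0, j := shift d (g j) (g r), j' := shift d' (g j') (g r))" "T = 4 * g r + 1"
  shows "runs (Transfer r j d j' d') (store X Y g) T (store X Y g')"
proof -
  define G where "G i = g(r := g r - i, j := shift d (g j) i, j' := shift d' (g j') i)" for i
  have "runs (Mv j d ;; Mv j' d') (store X Y ((G i)(r := g r - Suc i))) (1 + 1)
      (store X Y (G (Suc i)))" if "i < g r" for i
  proof -
    let ?h = "(G i)(r := g r - Suc i)"
    let ?h1 = "?h(j := shift d (?h j) 1)"
    have 1: "runs (Mv j d) (store X Y ?h) 1 (store X Y ?h1)"
      using assms that by (intro runs_Mv) (auto simp: G_def)
    have 2: "runs (Mv j' d') (store X Y ?h1) 1 (store X Y (?h1(j' := shift d' (?h1 j') 1)))"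
      using assms that by (intro runs_Mv) (auto simp: G_def)
    have "?h1(j' := shift d' (?h1 j') 1) = G (Suc i)"
      using assms(2-4) by (cases d; cases d') (auto simp: G_def fun_eq_iff)
    with runs_Sq[OF 1 2] show ?thesis by simp
  qed
  moreover have "G i r = g r - i" for i
    using assms by (simp add: G_def)
  moreover have "G 0 = g"
    by (cases d; cases d') (auto simp: G_def fun_eq_iff)
  moreover have "G (g r) = g'"
    using assms by (simp add: G_def)
  moreover have "g r * (1 + 1 + 2) + 1 = T"
    using assms by simp
  ultimately show ?thesis
    using runs_count_down[OF assms(1), of "g r" G "Mv j d ;; Mv j' d'" X "\<lambda>_. Y" "1 + 1"]
    by (metis Transfer_def)
qed

section \<open>Counting arithmetic\<close>

datatype expr =
    Var nat
  | Const nat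
  | Len
  | Rd bool expr
  | Add expr expr
  | Sub expr expr
  | Sum expr expr

text \<open>Variables are de Bruijn indices into the environment; \<open>Sum\<close> binds one variable.\<close>

fun eval :: "bool list \<times> (int \<Rightarrow> nat) \<Rightarrow> nat list \<Rightarrow> expr \<Rightarrow> nat" where
  "eval w \<rho> (Var i) = (if i < length \<rho> then \<rho> ! i else 0)"
| "eval w \<rho> (Const n) = n"
| "eval w \<rho> Len = length (fst w)"
| "eval w \<rho> (Rd b e) = (if b then snd w else tape_content (fst w)) (int (eval w \<rho> e))"
| "eval w \<rho> (Add e1 e2) = eval w \<rho> e1 + eval w \<rho> e2"
| "eval w \<rho> (Sub e1 e2) = eval w \<rho> e1 - eval w \<rho> e2"
| "eval w \<rho> (Sum e1 e2) = (\<Sum>i<eval w \<rho> e1. eval w (i # \<rho>) e2)"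

text \<open>The argument bounds the input length and all variables at once. Under \<open>Sum\<close>
  the new variable is below the value of the range, so the body is bounded at
  \<open>N + value_bound e1\<close>, which the composition of polynomials expresses.
  \<open>Rd\<close> yields tape symbols, at most 2.\<close>

fun value_bound :: "expr \<Rightarrow> nat poly" where
  "value_bound (Var i) = [:0, 1:]"
| "value_bound (Const n) = [:n:]"
| "value_bound Len = [:0, 1:]"
| "value_bound (Rd b e) = [:2:]"
| "value_bound (Add e1 e2) = value_bound e1 + value_bound e2"
| "value_bound (Sub e1 e2) = value_bound e1"
| "value_bound (Sum e1 e2) = value_bound e1 * (value_bound e2 \<circ>\<^sub>p ([:0, 1:] + value_bound e1))"

text \<open>The figures come from the code of \<open>compile\<close>: a round of
  \<open>Transfer\<close> is a test and three moves, so emptying a counter of value v costs 4v + 1.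
  In \<open>Sum\<close> the 4 per round consists of the 1 of the inner \<open>Transfer\<close>, the
  last \<open>Mv\<close>, and the test and decrement of the loop.\<close>

fun time_bound :: "expr \<Rightarrow> nat poly" where
  "time_bound (Var i) = [:2, 8:]"
| "time_bound (Const n) = [:Suc n:]"
| "time_bound Len = [:2, 8:]"
| "time_bound (Rd b e) = time_bound e + 8 * value_bound e + 6"
| "time_bound (Add e1 e2) = time_bound e1 + time_bound e2 + 4 * value_bound e2 + 1"
| "time_bound (Sub e1 e2) = time_bound e1 + time_bound e2 + 4 * value_bound e2 + 1"
| "time_bound (Sum e1 e2) = time_bound e1 + 4 * value_bound e1 + 2 + value_bound e1 *
     ((time_bound e2 + 4 * value_bound e2 + 4) \<circ>\<^sub>p ([:0, 1:] + value_bound e1))"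

definition bounded_env :: "bool list \<times> (int \<Rightarrow> nat) \<Rightarrow> nat list \<Rightarrow> nat \<Rightarrow> bool" where
  "bounded_env w \<rho> N \<longleftrightarrow> (\<forall>i. snd w i \<le> 2) \<and> length (fst w) \<le> N \<and> (\<forall>a \<in> set \<rho>. a \<le> N)"

lemma bounded_env_Cons:
  "bounded_env w \<rho> N \<Longrightarrow> i \<le> V \<Longrightarrow> bounded_env w (i # \<rho>) (N + V)"
  by (auto simp: bounded_env_def trans_le_add1)

lemma eval_le: "bounded_env w \<rho> N \<Longrightarrow> eval w \<rho> e \<le> poly (value_bound e) N"
proof (induction e arbitrary: \<rho> N)
  case (Sum e1 e2)
  let ?V = "poly (value_bound e1) N"
  have 1: "eval w \<rho> e1 \<le> ?V" using Sum by blast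
  have "(\<Sum>i<eval w \<rho> e1. eval w (i # \<rho>) e2) \<le> (\<Sum>i<eval w \<rho> e1. poly (value_bound e2) (N + ?V))"
    using 1 by (intro sum_mono Sum.IH bounded_env_Cons Sum.prems) auto
  also have "\<dots> \<le> ?V * poly (value_bound e2) (N + ?V)"
    using 1 by simp
  finally show ?case by (simp add: poly_pcompose)
qed (auto simp: bounded_env_def tape_content_def add_mono intro: order_trans[OF diff_le_self])

primrec incs :: "nat \<Rightarrow> nat \<Rightarrow> com" where
  "incs d 0 = skip"
| "incs d (Suc n) = Mv d Right ;; incs d n"

text \<open>\<open>compile rs d e\<close> puts the value of \<open>e\<close> into counter \<open>d\<close>, using the counters above \<open>d\<close> as work
  space; the list \<open>rs\<close> holds the counters of the variables.\<close>

fun compile :: "nat list \<Rightarrow> nat \<Rightarrow> expr \<Rightarrow> com" where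
  "compile rs d (Var i) = (if i < length rs
     then Transfer (rs ! i) d Right (d + 1) Right ;; Transfer (d + 1) (rs ! i) Right 0 Stay else skip)"
| "compile rs d (Const n) = incs d n"
| "compile rs d Len =
     Whl 0 0 (Mv 0 Right ;; Mv d Right ;; Mv (d + 1) Right) ;; Transfer (d + 1) 0 Left 1 Stay"
| "compile rs d (Rd b e) = (let j = of_bool b in
     compile rs (d + 1) e ;; Transfer (d + 1) (d + 2) Right j Right ;;
     Ite j 1 (Mv d Right) (Ite j 2 (Mv d Right ;; Mv d Right) skip) ;;
     Transfer (d + 2) j Left (of_bool (\<not> b)) Stay)"
| "compile rs d (Add e1 e2) =
     compile rs d e1 ;; compile rs (d + 1) e2 ;; Transfer (d + 1) d Right 0 Stay"
| "compile rs d (Sub e1 e2) = compile rs d e1 ;; compile rs (d + 1) e2 ;;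
     Whl (d + 1) 1 (Mv (d + 1) Left ;; Ite d 1 skip (Mv d Left))"
| "compile rs d (Sum e1 e2) = compile rs (d + 1) e1 ;;
     Whl (d + 1) 1 (Mv (d + 1) Left ;; compile ((d + 2) # rs) (d + 3) e2 ;;
       Transfer (d + 3) d Right 0 Stay ;; Mv (d + 2) Right) ;;
     Transfer (d + 2) 0 Stay 1 Stay"

lemma runs_incs: "runs (incs d n) (store X Y g) (Suc n) (store X Y (g(d := g d + n)))"
proof (induction n arbitrary: g)
  case 0
  then show ?case using runs_skip[of X Y g] by simp
next
  case (Suc n)
  from runs_Sq[OF runs_Mv[of Right g d X Y] Suc] show ?case
    by (simp add: fun_upd_same del: fun_upd_apply)
qed

definition ready :: "nat list \<Rightarrow> nat \<Rightarrow> nat list \<Rightarrow> (nat \<Rightarrow> nat) \<Rightarrow> bool" where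
  "ready rs d \<rho> g \<longleftrightarrow> 2 \<le> d \<and> length rs = length \<rho> \<and>
     (\<forall>i < length rs. 2 \<le> rs ! i \<and> rs ! i < d \<and> g (rs ! i) = \<rho> ! i) \<and>
     (\<forall>r \<ge> d. g r = 0) \<and> g 0 = 0 \<and> g 1 = 0"

lemma ready_upd: "ready rs d \<rho> g \<Longrightarrow> ready rs (d + 1) \<rho> (g(d := v))"
  by (fastforce simp: ready_def)

lemma ready_Suc: "ready rs d \<rho> g \<Longrightarrow> ready rs (d + 1) \<rho> g"
  by (fastforce simp: ready_def)

lemma ready_Cons:
  "ready rs d \<rho> g \<Longrightarrow> ready ((d + 2) # rs) (d + 3) (i # \<rho>) (g(d := a, d + 1 := b, d + 2 := i))"
  by (auto simp: ready_def nth_Cons split: nat.split)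

lemma runs_cong: "runs c s T s' \<Longrightarrow> T \<le> T' \<Longrightarrow> s' = s'' \<Longrightarrow> runs c s T' s''"
  using runs_mono by blast

text \<open>The induction rests on tidiness: in the final store only counter \<open>d\<close> has
  changed. Variables are copied and restored, work counters return to 0 and the data heads to the
  origin, so \<open>ready\<close> is available for the next subexpression.\<close>

lemma runs_compile:
  assumes "ready rs d \<rho> g" "bounded_env w \<rho> N"
  shows "runs (compile rs d e) (store (tape_content (fst w)) (snd w) g) (poly (time_bound e) N)
    (store (tape_content (fst w)) (snd w) (g(d := eval w \<rho> e)))"
  using assms
proof (induction e arbitrary: rs d \<rho> g N)
  case (Var i)
  let ?s = "store (tape_content (fst w)) (snd w)"
  have len: "length rs = length \<rho>" and d: "2 \<le> d" "g d = 0" "g (Suc d) = 0"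
    using Var by (auto simp: ready_def)
  show ?case
  proof (cases "i < length rs")
    case True
    let ?v = "rs ! i"
    have v: "2 \<le> ?v" "?v < d" "g ?v = \<rho> ! i" and N: "\<rho> ! i \<le> N"
      using Var True len by (auto simp: ready_def bounded_env_def)
    let ?g = "g(?v := 0, d := g ?v, d + 1 := g ?v)"
    have 1: "runs (Transfer ?v d Right (d + 1) Right) (?s g) (4 * \<rho> ! i + 1) (?s ?g)"
      using v d by (intro runs_Transfer) auto
    have 2: "runs (Transfer (d + 1) ?v Right 0 Stay) (?s ?g) (4 * \<rho> ! i + 1)
        (?s (g(d := \<rho> ! i)))"
      using v d by (intro runs_Transfer) (auto simp: fun_eq_iff)
    from runs_mono[OF runs_Sq[OF 1 2]] show ?thesis
      using True v N len by (simp del: fun_upd_apply)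
  next
    case False
    then show ?thesis using runs_cong[OF runs_skip] len d by (auto simp: fun_upd_idem)
  qed
next
  case (Const n)
  then show ?case
    using runs_incs[of d n _ _ g] by (simp add: ready_def del: fun_upd_apply)
next
  case Len
  let ?X = "tape_content (fst w)" and ?n = "length (fst w)"
  let ?s = "store ?X (snd w)"
  have d: "2 \<le> d" "g d = 0" "g (Suc d) = 0" "g 0 = 0" and N: "?n \<le> N"
    using Len by (auto simp: ready_def bounded_env_def)
  define G where "G i = g(0 := i, d := i, d + 1 := i)" for i
  have "runs (Mv 0 Right ;; Mv d Right ;; Mv (d + 1) Right) (?s (G i)) (1 + (1 + 1)) (?s (G (Suc i)))" for i
  proof -
    have 1: "runs (Mv 0 Right) (?s (G i)) 1 (?s ((G i)(0 := Suc i)))"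
      using runs_Mv[of Right "G i" 0] d by (simp add: G_def)
    have 2: "runs (Mv d Right) (?s ((G i)(0 := Suc i))) 1 (?s ((G i)(0 := Suc i, d := Suc i)))"
      using runs_Mv[of Right "(G i)(0 := Suc i)" d] d by (simp add: G_def)
    have 3: "runs (Mv (d + 1) Right) (?s ((G i)(0 := Suc i, d := Suc i))) 1 (?s (G (Suc i)))"
      using runs_cong[OF runs_Mv[of Right "(G i)(0 := Suc i, d := Suc i)" "d + 1"]] d
      by (simp add: G_def fun_upd_twist)
    from runs_Sq[OF 1 runs_Sq[OF 2 3]] show ?thesis .
  qed
  then have "runs (Whl 0 0 (Mv 0 Right ;; Mv d Right ;; Mv (d + 1) Right)) (?s (G 0))
      (?n * (1 + (1 + 1) + 1) + 1) (?s (G ?n))"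
  proof (rule runs_Whl[rotated 2])
    show "scan (?s (G i) 0) \<noteq> 0" if "i < ?n" for i
      using d that by (simp add: scan_data G_def tape_content_def)
    show "scan (?s (G ?n) 0) = 0"
      using d by (simp add: scan_data G_def tape_content_def)
  qed
  moreover have "G 0 = g" using d by (auto simp: G_def)
  ultimately have 1: "runs (Whl 0 0 (Mv 0 Right ;; Mv d Right ;; Mv (d + 1) Right)) (?s g)
      (?n * (1 + (1 + 1) + 1) + 1) (?s (G ?n))"
    by simp
  have 2: "runs (Transfer (d + 1) 0 Left 1 Stay) (?s (G ?n)) (4 * ?n + 1) (?s (g(d := ?n)))"
    using d by (intro runs_Transfer) (auto simp: G_def fun_eq_iff)
  from runs_mono[OF runs_Sq[OF 1 2]] show ?case
    using N by (simp del: fun_upd_apply)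
next
  case (Rd b e)
  let ?s = "store (tape_content (fst w)) (snd w)"
  \<comment> \<open>\<open>j\<close> is the data tape that is read; \<open>j'\<close> is the other
    one, a dummy partner in the \<open>Transfer\<close> back, whose two targets must differ.\<close>
  define j j' :: nat where "j = of_bool b" and "j' = of_bool (\<not> b)"
  have d: "2 \<le> d" "g d = 0" "g (Suc d) = 0" "g (d + 2) = 0" "g j = 0" "g j' = 0"
    using Rd.prems by (auto simp: ready_def j_def j'_def)
  let ?v = "eval w \<rho> e"
  have v: "?v \<le> poly (value_bound e) N" using eval_le Rd.prems by blast
  have 1: "runs (compile rs (d + 1) e) (?s g) (poly (time_bound e) N) (?s (g(d + 1 := ?v)))"
    using Rd.IH[OF ready_Suc] Rd.prems by blast
  have 2: "runs (Transfer (d + 1) (d + 2) Right j Right) (?s (g(d + 1 := ?v)))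
      (4 * ?v + 1) (?s (g(d + 2 := ?v, j := ?v)))"
    using d by (intro runs_Transfer; cases b) (simp_all add: fun_eq_iff j_def j'_def)
  let ?a = "eval w \<rho> (Rd b e)"
  let ?g = "g(d + 2 := ?v, j := ?v)"
  have sc: "scan (?s ?g j) = ?a" and a: "?a \<le> 2" and gd: "?g d = 0"
    using d Rd.prems by (auto simp: j_def scan_data store_def bounded_env_def tape_content_def)
  have m: "runs (Mv d Right) (?s ?g) 1 (?s (?g(d := 1)))"
    using runs_Mv[of Right ?g d] gd by simp
  have mm: "runs (Mv d Right ;; Mv d Right) (?s ?g) 2 (?s (?g(d := 2)))"
    using runs_Sq[OF m runs_Mv[of Right "?g(d := 1)" d]] by (simp add: numeral_2_eq_2)
  have "runs (Ite j 1 (Mv d Right) (Ite j 2 (Mv d Right ;; Mv d Right) skip)) (?s ?g) (1 + (1 + 2))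
      (?s (?g(d := ?a)))"
  proof (rule runs_Ite)
    assume "scan (?s ?g j) = 1"
    then show "runs (Mv d Right) (?s ?g) (1 + 2) (?s (?g(d := ?a)))"
      using runs_mono[OF m] sc by simp
  next
    assume n1: "scan (?s ?g j) \<noteq> 1"
    show "runs (Ite j 2 (Mv d Right ;; Mv d Right) skip) (?s ?g) (1 + 2) (?s (?g(d := ?a)))"
    proof (rule runs_Ite)
      assume "scan (?s ?g j) = 2"
      then have "?a = 2" using sc by simp
      then show "runs (Mv d Right ;; Mv d Right) (?s ?g) 2 (?s (?g(d := ?a)))"
        using mm by (simp del: eval.simps)
    next
      assume "scan (?s ?g j) \<noteq> 2"
      with n1 a sc have "?a = 0" by linarith
      with gd have "?g(d := ?a) = ?g" by (metis fun_upd_triv)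
      then show "runs skip (?s ?g) 2 (?s (?g(d := ?a)))"
        using runs_mono[OF runs_skip] by simp
    qed
  qed
  note 3 = this
  have 4: "runs (Transfer (d + 2) j Left j' Stay) (?s (?g(d := ?a)))
      (4 * ?v + 1) (?s (g(d := ?a)))"
    using d by (intro runs_Transfer; cases b) (simp_all add: fun_eq_iff j_def j'_def)
  from runs_mono[OF runs_Sq[OF 1 runs_Sq[OF 2 runs_Sq[OF 3 4]]]] show ?case
    using v by (simp add: j_def[symmetric] j'_def[symmetric] Let_def del: fun_upd_apply eval.simps)
next
  case (Add e1 e2)
  let ?s = "store (tape_content (fst w)) (snd w)"
  have d: "2 \<le> d" "g d = 0" "g (Suc d) = 0"
    using Add.prems by (auto simp: ready_def)
  let ?v1 = "eval w \<rho> e1" and ?v2 = "eval w \<rho> e2"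
  have v: "?v2 \<le> poly (value_bound e2) N" using eval_le Add.prems by blast
  have 1: "runs (compile rs d e1) (?s g) (poly (time_bound e1) N) (?s (g(d := ?v1)))"
    using Add by blast
  have 2: "runs (compile rs (d + 1) e2) (?s (g(d := ?v1))) (poly (time_bound e2) N)
      (?s (g(d := ?v1, d + 1 := ?v2)))"
    using Add.IH(2)[OF ready_upd] Add.prems by blast
  have 3: "runs (Transfer (d + 1) d Right 0 Stay) (?s (g(d := ?v1, d + 1 := ?v2)))
      (4 * ?v2 + 1) (?s (g(d := ?v1 + ?v2)))"
    using d by (intro runs_Transfer) (auto simp: fun_eq_iff)
  from runs_mono[OF runs_Sq[OF 1 runs_Sq[OF 2 3]]] show ?case
    using v by (simp del: fun_upd_apply)
next
  case (Sub e1 e2)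
  let ?s = "store (tape_content (fst w)) (snd w)"
  have d: "2 \<le> d" "g d = 0" "g (Suc d) = 0"
    using Sub.prems by (auto simp: ready_def)
  let ?v1 = "eval w \<rho> e1" and ?v2 = "eval w \<rho> e2"
  have v: "?v2 \<le> poly (value_bound e2) N" using eval_le Sub.prems by blast
  have 1: "runs (compile rs d e1) (?s g) (poly (time_bound e1) N) (?s (g(d := ?v1)))"
    using Sub by blast
  have 2: "runs (compile rs (d + 1) e2) (?s (g(d := ?v1))) (poly (time_bound e2) N)
      (?s (g(d := ?v1, d + 1 := ?v2)))"
    using Sub.IH(2)[OF ready_upd] Sub.prems by blast
  define G where "G i = g(d := ?v1 - i, d + 1 := ?v2 - i)" for i
  have sc: "scan (?s ((G i)(d + 1 := ?v2 - Suc i)) d) = 1 \<longleftrightarrow> ?v1 - i = 0" for i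
    unfolding scan_counter[OF d(1)] by (simp add: G_def)
  \<comment> \<open>The test keeps the head of \<open>d\<close> from passing to the left of the
    mark; this realises truncated subtraction.\<close>
  have "runs (Ite d 1 skip (Mv d Left)) (?s ((G i)(d + 1 := ?v2 - Suc i))) (1 + 1) (?s (G (Suc i)))" for i
  proof (rule runs_Ite)
    assume "scan (?s ((G i)(d + 1 := ?v2 - Suc i)) d) = 1"
    then have "?v1 - i = 0"
      unfolding sc .
    then have "(G i)(d + 1 := ?v2 - Suc i) = G (Suc i)"
      by (auto simp: G_def fun_eq_iff)
    then show "runs skip (?s ((G i)(d + 1 := ?v2 - Suc i))) 1 (?s (G (Suc i)))"
      using runs_skip by simp
  next
    assume "scan (?s ((G i)(d + 1 := ?v2 - Suc i)) d) \<noteq> 1"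
    then have "?v1 - i \<noteq> 0"
      unfolding sc .
    then show "runs (Mv d Left) (?s ((G i)(d + 1 := ?v2 - Suc i))) 1 (?s (G (Suc i)))"
      by (intro runs_cong[OF runs_Mv] arg_cong[of _ _ ?s]) (auto simp: G_def fun_eq_iff)
  qed
  then have "runs (Whl (d + 1) 1 (Mv (d + 1) Left ;; Ite d 1 skip (Mv d Left))) (?s (G 0))
      (?v2 * (1 + 1 + 2) + 1) (?s (G ?v2))"
    using d by (intro runs_count_down[of "d + 1" ?v2 G _ _ "\<lambda>_. snd w"]) (auto simp: G_def)
  moreover have "G 0 = g(d := ?v1, d + 1 := ?v2)" "G ?v2 = g(d := ?v1 - ?v2)"
    using d by (auto simp: G_def fun_eq_iff)
  ultimately have 3: "runs (Whl (d + 1) 1 (Mv (d + 1) Left ;; Ite d 1 skip (Mv d Left)))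
      (?s (g(d := ?v1, d + 1 := ?v2))) (?v2 * (1 + 1 + 2) + 1) (?s (g(d := ?v1 - ?v2)))"
    by simp
  from runs_mono[OF runs_Sq[OF 1 runs_Sq[OF 2 3]]] show ?case
    using v by (simp del: fun_upd_apply)
next
  case (Sum e1 e2)
  let ?s = "store (tape_content (fst w)) (snd w)"
  have d: "2 \<le> d" "\<And>r. d \<le> r \<Longrightarrow> g r = 0" "g 0 = 0" "g 1 = 0"
    using Sum.prems by (auto simp: ready_def)
  let ?n = "eval w \<rho> e1" and ?V = "poly (value_bound e1) N"
  let ?M = "N + ?V"
  have n: "?n \<le> ?V" using eval_le Sum.prems by blast
  define S where "S i = (\<Sum>i<i. eval w (i # \<rho>) e2)" for i
  have 1: "runs (compile rs (d + 1) e1) (?s g) (poly (time_bound e1) N) (?s (g(d + 1 := ?n)))"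
    using Sum.IH(1)[OF ready_Suc] Sum.prems by blast
  \<comment> \<open>Counter \<open>d\<close> accumulates the partial sum, \<open>d + 1\<close> holds
    the rounds left and \<open>d + 2\<close> the bound variable, so the body works from
    \<open>d + 3\<close> on.\<close>
  define G where "G i = g(d := S i, d + 1 := ?n - i, d + 2 := i)" for i
  let ?T = "poly (time_bound e2) ?M + ((4 * poly (value_bound e2) ?M + 1) + 1)"
  let ?b = "compile ((d + 2) # rs) (d + 3) e2 ;; Transfer (d + 3) d Right 0 Stay ;; Mv (d + 2) Right"
  have body: "runs ?b (?s ((G i)(d + 1 := ?n - Suc i))) ?T (?s (G (Suc i)))" if "i < ?n" for i
  proof -
    let ?h = "(G i)(d + 1 := ?n - Suc i)"
    let ?u = "eval w (i # \<rho>) e2"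
    have b: "bounded_env w (i # \<rho>) ?M"
      using bounded_env_Cons[OF Sum.prems(2)] that n by simp
    have h: "?h = g(d := S i, d + 1 := ?n - Suc i, d + 2 := i)"
      by (auto simp: G_def)
    have "ready ((d + 2) # rs) (d + 3) (i # \<rho>) ?h"
      unfolding h using ready_Cons[OF Sum.prems(1)] .
    then have 1: "runs (compile ((d + 2) # rs) (d + 3) e2) (?s ?h) (poly (time_bound e2) ?M) (?s (?h(d + 3 := ?u)))"
      using Sum.IH(2) b by blast
    have 2: "runs (Transfer (d + 3) d Right 0 Stay) (?s (?h(d + 3 := ?u)))
        (4 * ?u + 1) (?s (?h(d := S (Suc i))))"
      using d by (intro runs_Transfer) (auto simp: G_def S_def fun_eq_iff)
    have 3: "runs (Mv (d + 2) Right) (?s (?h(d := S (Suc i)))) 1 (?s (G (Suc i)))"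
      by (intro runs_cong[OF runs_Mv] arg_cong[of _ _ ?s]) (auto simp: G_def fun_eq_iff)
    from runs_mono[OF runs_Sq[OF 1 runs_Sq[OF 2 3]]] show ?thesis
      using eval_le[OF b, of e2] by (simp del: fun_upd_apply)
  qed
  have "runs (Whl (d + 1) 1 (Mv (d + 1) Left ;; ?b)) (?s (G 0)) (?n * (?T + 2) + 1) (?s (G ?n))"
    using d body by (intro runs_count_down[of "d + 1" ?n G _ _ "\<lambda>_. snd w"]) (auto simp: G_def)
  moreover have "G 0 = g(d + 1 := ?n)"
    using d by (auto simp: G_def S_def fun_eq_iff)
  ultimately have 2: "runs (Whl (d + 1) 1 (Mv (d + 1) Left ;; ?b)) (?s (g(d + 1 := ?n)))
      (?n * (?T + 2) + 1) (?s (G ?n))"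
    by simp
  have 3: "runs (Transfer (d + 2) 0 Stay 1 Stay) (?s (G ?n)) (4 * ?n + 1)
      (?s (g(d := eval w \<rho> (Sum e1 e2))))"
    using d by (intro runs_Transfer) (auto simp: G_def S_def fun_eq_iff)
  define K where "K = ?T + 2"
  have K: "K =
      poly (time_bound e2 + 4 * value_bound e2 + 4) (poly ([:0, 1:] + value_bound e1) N)"
    by (simp add: K_def)
  have "poly (time_bound (Sum e1 e2)) N = poly (time_bound e1) N + 4 * ?V + 2 + ?V * K"
    unfolding K time_bound.simps poly_add poly_mult poly_pcompose poly_numeral ..
  moreover have "?n * K \<le> ?V * K"
    using n by (rule mult_le_mono1)
  ultimately have "poly (time_bound e1) N + (?n * K + 1 + (4 * ?n + 1)) \<le>
      poly (time_bound (Sum e1 e2)) N"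
    using n by linarith
  with runs_Sq[OF 1 runs_Sq[OF 2 3]] show ?case
    unfolding compile.simps K_def by (rule runs_mono)
qed

section \<open>Programs filling a table\<close>

text \<open>\<open>min 2\<close> keeps the entries within the tape alphabet. The initial content
  \<open>Y\<close> of tape 1 is the second input, so a table of length 0 leaves a certificate
  intact.\<close>

fun table :: "bool list \<Rightarrow> expr \<Rightarrow> (int \<Rightarrow> nat) \<Rightarrow> nat \<Rightarrow> int \<Rightarrow> nat" where
  "table x e Y 0 = Y"
| "table x e Y (Suc i) = (table x e Y i)(int i := min 2 (eval (x, table x e Y i) [i] e))"

definition result :: "expr \<Rightarrow> expr \<Rightarrow> bool list \<Rightarrow> bool list \<Rightarrow> int \<Rightarrow> nat" where
  "result e0 e1 x y = table x e1 (tape_content y) (eval (x, tape_content y) [] e0)"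

text \<open>Counter 2 holds the number of cells left, 3 the index of the current cell, 4 the value
  to be written and finally the verdict, 5 the index while head 1 stands on the cell.\<close>

definition program :: "expr \<Rightarrow> expr \<Rightarrow> expr \<Rightarrow> com" where
  "program e0 e1 e2 =
     compile [] 2 e0 ;;
     Whl 2 1 (Mv 2 Left ;; (compile [3] 4 e1 ;; Transfer 3 5 Right 1 Right ;;
       Ite 4 1 (Wt 1 0) (Mv 4 Left ;; Ite 4 1 (Wt 1 1) (Wt 1 2)) ;;
       Transfer 4 0 Stay 1 Stay ;; Transfer 5 3 Right 1 Left ;; Mv 3 Right)) ;;
     compile [] 4 e2"

lemma table_le: "(\<And>i. Y i \<le> 2) \<Longrightarrow> table x e Y n i \<le> 2"
  by (induction n arbitrary: i) auto

lemma tape_content_le: "tape_content y i \<le> 2"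
  by (simp add: tape_content_def)

lemma runs_Wt:
  "runs (Wt 1 a) (store X Y g) 1 (store X (Y(int (g 1) := a)) g)"
proof -
  have "store X (Y(int (g 1) := a)) g =
      (store X Y g)(1 := ((fst (store X Y g 1))(snd (store X Y g 1) := a), snd (store X Y g 1)))"
    by (auto simp: store_def fun_eq_iff)
  then show ?thesis unfolding runs_def by (metis big.Wt order_refl)
qed

text \<open>One decrement is enough to tell 0, 1 and larger values apart; whatever remains in
  counter 4 is then cleared.\<close>

lemma runs_write:
  assumes "g 4 = v"
  shows "runs (Ite 4 1 (Wt 1 0) (Mv 4 Left ;; Ite 4 1 (Wt 1 1) (Wt 1 2)) ;; Transfer 4 0 Stay 1 Stay)
    (store X Y g) (4 * v + 5) (store X (Y(int (g 1) := min 2 v)) (g(4 := 0)))"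
proof -
  let ?Y = "Y(int (g 1) := min 2 v)"
  have 1: "runs (Ite 4 1 (Wt 1 0) (Mv 4 Left ;; Ite 4 1 (Wt 1 1) (Wt 1 2)))
      (store X Y g) (1 + (1 + (1 + 1))) (store X ?Y (g(4 := v - 1)))"
  proof (rule runs_Ite)
    assume "scan (store X Y g 4) = 1"
    then have "v = 0" using scan_counter[of 4] assms by simp
    then have "?Y = Y(int (g 1) := 0)" "g(4 := v - 1) = g" using assms by auto
    then show "runs (Wt 1 0) (store X Y g) (1 + (1 + 1)) (store X ?Y (g(4 := v - 1)))"
      using runs_mono[OF runs_Wt] by simp
  next
    assume "scan (store X Y g 4) \<noteq> 1"
    then have v: "v \<noteq> 0" using scan_counter[of 4] assms by simp
    have 1: "runs (Mv 4 Left) (store X Y g) 1 (store X Y (g(4 := v - 1)))"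
      using runs_Mv[of Left g 4] assms v by simp
    have "runs (Ite 4 1 (Wt 1 1) (Wt 1 2)) (store X Y (g(4 := v - 1))) (1 + 1) (store X ?Y (g(4 := v - 1)))"
    proof (rule runs_Ite)
      assume "scan (store X Y (g(4 := v - 1)) 4) = 1"
      then have "v = 1" using scan_counter[of 4 X Y "g(4 := v - 1)"] v by simp
      then show "runs (Wt 1 1) (store X Y (g(4 := v - 1))) 1 (store X ?Y (g(4 := v - 1)))"
        using runs_Wt[of 1 X Y "g(4 := 0)"] by simp
    next
      assume "scan (store X Y (g(4 := v - 1)) 4) \<noteq> 1"
      then have "2 \<le> v" using scan_counter[of 4 X Y "g(4 := v - 1)"] v by simp
      then show "runs (Wt 1 2) (store X Y (g(4 := v - 1))) 1 (store X ?Y (g(4 := v - 1)))"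
        using runs_Wt[of 2 X Y "g(4 := v - 1)"] by (simp add: min_def del: fun_upd_apply) simp
    qed
    from runs_Sq[OF 1 this] show "runs (Mv 4 Left ;; Ite 4 1 (Wt 1 1) (Wt 1 2)) (store X Y g)
        (1 + (1 + 1)) (store X ?Y (g(4 := v - 1)))" .
  qed
  have 2: "runs (Transfer 4 0 Stay 1 Stay) (store X ?Y (g(4 := v - 1))) (4 * (v - 1) + 1)
      (store X ?Y (g(4 := 0)))"
    by (intro runs_Transfer) (auto simp: fun_eq_iff)
  from runs_mono[OF runs_Sq[OF 1 2]] show ?thesis by (simp del: fun_upd_apply)
qed

lemma Sq_assoc: "runs ((a ;; b) ;; c) s T s' \<Longrightarrow> runs (a ;; b ;; c) s T s'"
  unfolding runs_def
proof (elim exE conjE)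
  fix t assume t: "t \<le> T" "big ((a ;; b) ;; c) s t s'"
  from t(2) show "\<exists>t\<le>T. big (a ;; b ;; c) s t s'"
  proof cases
    case (Sq t1 s1 t2)
    from Sq(2) show ?thesis
    proof cases
      case (Sq t1' s1' t2')
      with \<open>big c s1 t2 s'\<close> have "big (a ;; b ;; c) s (t1' + (t2' + t2)) s'"
        by (intro big.Sq)
      with Sq \<open>t = t1 + t2\<close> t(1) show ?thesis by (metis add.assoc)
    qed
  qed
qed

text \<open>\<open>[:10, 8:]\<close> collects, per round, two index transfers of cost 4i + 1, the
  constant 5 of \<open>runs_write\<close>, one move, and the test and decrement of the loop.\<close>

definition program_time :: "expr \<Rightarrow> expr \<Rightarrow> expr \<Rightarrow> nat poly" where
  "program_time e0 e1 e2 = time_bound e0 + time_bound e2 + 1 + value_bound e0 *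
     ((time_bound e1 + 4 * value_bound e1 + [:10, 8:]) \<circ>\<^sub>p ([:0, 1:] + value_bound e0))"

lemma runs_program:
  fixes x y :: "bool list" and e0 e1 e2 :: expr
  defines "X \<equiv> tape_content x" and "Z \<equiv> result e0 e1 x y"
  shows "\<exists>g. runs (program e0 e1 e2) (store X (tape_content y) (\<lambda>_. 0))
    (poly (program_time e0 e1 e2) (length x)) (store X Z g) \<and> g 4 = eval (x, Z) [] e2"
proof -
  let ?N = "length x" and ?w = "(x, tape_content y)"
  let ?n = "eval ?w [] e0" and ?V = "poly (value_bound e0) (length x)"
  let ?M = "?N + ?V"
  define Y where "Y i = table x e1 (tape_content y) i" for i
  have Y2: "Y i j \<le> 2" for i j
    unfolding Y_def by (intro table_le tape_content_le)
  have n: "?n \<le> ?V"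
    by (rule eval_le) (simp add: bounded_env_def tape_content_le)
  have 1: "runs (compile [] 2 e0) (store X (tape_content y) (\<lambda>_. 0)) (poly (time_bound e0) ?N)
      (store X (tape_content y) ((\<lambda>_. 0)(2 := ?n)))"
  proof -
    have "ready [] 2 [] (\<lambda>_. 0)" "bounded_env ?w [] ?N"
      by (auto simp: ready_def bounded_env_def tape_content_le)
    from runs_compile[OF this, of e0] show ?thesis unfolding X_def fst_conv snd_conv .
  qed
  define G :: "nat \<Rightarrow> nat \<Rightarrow> nat" where "G i = (\<lambda>_. 0)(2 := ?n - i, 3 := i)" for i
  let ?T = "poly (time_bound e1) ?M + ((4 * ?M + 1) + ((4 * poly (value_bound e1) ?M + 5) +
    ((4 * ?M + 1) + 1)))"
  let ?b1 = "Ite 4 1 (Wt 1 0) (Mv 4 Left ;; Ite 4 1 (Wt 1 1) (Wt 1 2))"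
  let ?b = "compile [3] 4 e1 ;; Transfer 3 5 Right 1 Right ;; ?b1 ;;
       Transfer 4 0 Stay 1 Stay ;; Transfer 5 3 Right 1 Left ;; Mv 3 Right"
  have body: "runs ?b (store X (Y i) ((G i)(2 := ?n - Suc i))) ?T (store X (Y (Suc i)) (G (Suc i)))"
    if "i < ?n" for i
  proof -
    let ?w = "(x, Y i)"
    let ?h = "(G i)(2 := ?n - Suc i)"
    let ?u = "eval ?w [i] e1"
    have i: "i \<le> ?M" using that n by simp
    have b: "bounded_env ?w [i] ?M"
      using Y2 i by (simp add: bounded_env_def)
    have u: "?u \<le> poly (value_bound e1) ?M" by (rule eval_le[OF b])
    have 1: "runs (compile [3] 4 e1) (store X (Y i) ?h) (poly (time_bound e1) ?M) (store X (Y i) (?h(4 := ?u)))"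
    proof -
      have "ready [3] 4 [i] ?h" by (auto simp: ready_def G_def)
      from runs_compile[OF this b, of e1] show ?thesis unfolding X_def fst_conv snd_conv .
    qed
    let ?h2 = "?h(4 := ?u, 3 := 0, 5 := i, 1 := i)"
    have 2: "runs (Transfer 3 5 Right 1 Right) (store X (Y i) (?h(4 := ?u))) (4 * i + 1) (store X (Y i) ?h2)"
      by (intro runs_Transfer) (simp_all add: fun_eq_iff G_def)
    have h2: "?h2 4 = ?u" "?h2 1 = i" by auto
    have Y': "Y (Suc i) = (Y i)(int i := min 2 ?u)" by (simp add: Y_def)
    have 3: "runs (?b1 ;; Transfer 4 0 Stay 1 Stay) (store X (Y i) ?h2)
        (4 * ?u + 5) (store X (Y (Suc i)) (?h2(4 := 0)))"
      using runs_write[of ?h2 ?u X "Y i", OF h2(1)] unfolding h2(2) Y' .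
    have 4: "runs (Transfer 5 3 Right 1 Left) (store X (Y (Suc i)) (?h2(4 := 0))) (4 * i + 1)
        (store X (Y (Suc i)) ?h)"
      by (intro runs_Transfer) (simp_all add: fun_eq_iff G_def)
    have 5: "runs (Mv 3 Right) (store X (Y (Suc i)) ?h) 1 (store X (Y (Suc i)) (G (Suc i)))"
      by (intro runs_cong[OF runs_Mv] arg_cong[of _ _ "store _ _"]) (simp_all add: fun_eq_iff G_def)
    from runs_Sq[OF 3 runs_Sq[OF 4 5]]
    have "runs (?b1 ;; Transfer 4 0 Stay 1 Stay ;; Transfer 5 3 Right 1 Left ;; Mv 3 Right)
      (store X (Y i) ?h2) (4 * ?u + 5 + (4 * i + 1 + 1)) (store X (Y (Suc i)) (G (Suc i)))"
      by (rule Sq_assoc)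
    from runs_mono[OF runs_Sq[OF 1 runs_Sq[OF 2 this]]] show ?thesis
      using u i by (simp del: fun_upd_apply)
  qed
  have "runs (Whl 2 1 (Mv 2 Left ;; ?b)) (store X (Y 0) (G 0)) (?n * (?T + 2) + 1) (store X (Y ?n) (G ?n))"
    by (intro runs_count_down body) (auto simp: G_def)
  moreover have "G 0 = (\<lambda>_. 0)(2 := ?n)" by (auto simp: G_def)
  moreover have "Y 0 = tape_content y" "Y ?n = Z" by (simp_all add: Y_def Z_def result_def)
  ultimately have 2: "runs (Whl 2 1 (Mv 2 Left ;; ?b)) (store X (tape_content y) ((\<lambda>_. 0)(2 := ?n)))
      (?n * (?T + 2) + 1) (store X Z (G ?n))"
    by simp
  have 3: "runs (compile [] 4 e2) (store X Z (G ?n)) (poly (time_bound e2) ?N)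
      (store X Z ((G ?n)(4 := eval (x, Z) [] e2)))"
  proof -
    have "ready [] 4 [] (G ?n)" by (auto simp: ready_def G_def)
    moreover have "bounded_env (x, Z) [] ?N"
      using Y2[of ?n] \<open>Y ?n = Z\<close> by (simp add: bounded_env_def)
    ultimately show ?thesis
      using runs_compile[of "[]" 4 "[]" "G ?n" "(x, Z)" ?N e2] unfolding X_def fst_conv snd_conv by blast
  qed
  define K where "K = ?T + 2"
  have K: "K =
      poly (time_bound e1 + 4 * value_bound e1 + [:10, 8:]) (poly ([:0, 1:] + value_bound e0) ?N)"
    by (simp add: K_def)
  have "poly (program_time e0 e1 e2) ?N =
      poly (time_bound e0) ?N + poly (time_bound e2) ?N + 1 + ?V * K"
    unfolding K program_time_def poly_add poly_mult poly_pcompose poly_1 ..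
  moreover have "?n * K \<le> ?V * K"
    using n by (rule mult_le_mono1)
  ultimately have "poly (time_bound e0) ?N + (?n * K + 1 + poly (time_bound e2) ?N) \<le>
      poly (program_time e0 e1 e2) ?N"
    by linarith
  with runs_Sq[OF 1 runs_Sq[OF 2 3]] have "runs (program e0 e1 e2) (store X (tape_content y) (\<lambda>_. 0))
    (poly (program_time e0 e1 e2) (length x)) (store X Z ((G ?n)(4 := eval (x, Z) [] e2)))"
    unfolding program_def K_def by (rule runs_mono)
  then show ?thesis by (metis fun_upd_same)
qed

section \<open>Marking the origins of the counter tapes\<close>

primrec marks :: "nat \<Rightarrow> com" where
  "marks 0 = skip"
| "marks (Suc n) = Wt (n + 2) 1 ;; marks n"

text \<open>Fresh tapes are blank, so the marks of the counters have to be written first. The time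
  \<open>T\<close> is uniform in both data tapes and thus a constant of the machine.\<close>

lemma runs_marks:
  "\<exists>T. \<forall>X Y. runs (marks n)
    (\<lambda>j. if 2 \<le> j \<and> j < n + 2 then (tape_content [], 0) else store X Y (\<lambda>_. 0) j) T (store X Y (\<lambda>_. 0))"
proof (induction n)
  case 0
  have "(\<lambda>j. if 2 \<le> j \<and> j < 0 + 2 then (tape_content [], 0) else store X Y (\<lambda>_. 0) j) =
      store X Y (\<lambda>_. 0)" for X Y
    by (auto simp: fun_eq_iff)
  then show ?case by (intro exI[of _ 1] allI) (simp only: runs_skip marks.simps)
next
  case (Suc n)
  then obtain T where T: "\<forall>X Y. runs (marks n)
    (\<lambda>j. if 2 \<le> j \<and> j < n + 2 then (tape_content [], 0) else store X Y (\<lambda>_. 0) j) T (store X Y (\<lambda>_. 0))" ..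
  let ?s = "\<lambda>X Y n j. if 2 \<le> j \<and> j < n + 2 then (tape_content [], 0) else store X Y (\<lambda>_. 0) j"
  have "runs (Wt (n + 2) 1) (?s X Y (Suc n)) 1 (?s X Y n)" for X Y
  proof -
    have eq: "?s X Y n = (?s X Y (Suc n))(n + 2 := ((fst (?s X Y (Suc n) (n + 2)))
        (snd (?s X Y (Suc n) (n + 2)) := 1), snd (?s X Y (Suc n) (n + 2))))"
      by (auto simp: fun_eq_iff store_def counter_tape_def tape_content_def)
    show ?thesis unfolding runs_def eq by (intro exI[of _ 1] conjI order_refl big.Wt)
  qed
  then have "runs (marks (Suc n)) (?s X Y (Suc n)) (1 + T) (store X Y (\<lambda>_. 0))" for X Y
    unfolding marks.simps using T by (intro runs_Sq) blast+
  then show ?case by blast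
qed

lemma ternary_incs: "ternary (incs d n)"
  by (induction n) auto

lemma ternary_compile: "ternary (compile rs d e)"
  by (induction e arbitrary: rs d) (auto simp: Transfer_def ternary_incs Let_def)

lemma ternary_marks: "ternary (marks n)"
  by (induction n) auto

lemma max_tape_marks: "max_tape (marks n) < n + 2"
  by (induction n) auto

text \<open>All algorithms below are instances of this machine. A missing second input is a blank
  tape, hence \<open>init M [x] = init M [x, []]\<close>, and one construction serves decision,
  output and verification. The time depends on \<open>x\<close> alone, since tape 1 is only looked
  up at computed cells, whatever the length of its content.\<close>

theorem program_machine:
  "\<exists>M p. wf_tm M \<and> (\<forall>x. init M [x] = init M [x, []]) \<and> (\<forall>x y.
     let Z = result e0 e1 x y; c = run M [x, y] (poly p (length x))
     in fst c = (if eval (x, Z) [] e2 = 0 then reject M else accept M) \<and> fst (snd c ! 1) = Z)"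
proof -
  let ?P = "program e0 e1 e2"
  define n where "n = max_tape ?P + 5"
  define c where "c = marks n ;; ?P"
  let ?M = "machine (n + 2) c 4"
  obtain T where T: "\<And>X Y. runs (marks n) (\<lambda>j. if 2 \<le> j \<and> j < n + 2 then (tape_content [], 0)
      else store X Y (\<lambda>_. 0) j) T (store X Y (\<lambda>_. 0))"
    using runs_marks by blast
  \<comment> \<open>The constant pays for the marks and for the final test, for which
    \<open>t\<close> must be strictly below the bound.\<close>
  let ?p = "[:T + 1:] + program_time e0 e1 e2"
  have "ternary c"
    by (simp add: c_def program_def ternary_marks ternary_compile Transfer_def)
  then have wf: "wf_tm ?M" by (intro wf_machine) auto
  have "fst (run ?M [x, y] (poly ?p (length x))) =
      (if eval (x, result e0 e1 x y) [] e2 = 0 then reject ?M else accept ?M) \<and>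
      fst (snd (run ?M [x, y] (poly ?p (length x))) ! 1) = result e0 e1 x y" for x y
  proof -
    let ?Z = "result e0 e1 x y"
    define s where "s j = (if 2 \<le> j \<and> j < n + 2 then (tape_content [], 0)
      else store (tape_content x) (tape_content y) (\<lambda>_. 0) j)" for j
    have s: "runs (marks n) s T (store (tape_content x) (tape_content y) (\<lambda>_. 0))"
      using T unfolding s_def .
    obtain g where g: "runs ?P (store (tape_content x) (tape_content y) (\<lambda>_. 0))
        (poly (program_time e0 e1 e2) (length x)) (store (tape_content x) ?Z g)"
      "g 4 = eval (x, ?Z) [] e2"
      using runs_program by blast
    from runs_Sq[OF s g(1)] obtain t where t: "t < poly ?p (length x)"
      "big c s t (store (tape_content x) ?Z g)"
      by (auto simp: runs_def c_def less_Suc_eq_le)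
    have "(tape_content (if i < length [x, y] then [x, y] ! i else []), 0) = s i" if "i < n + 2" for i
    proof -
      consider "i = 0" | "i = 1" | "2 \<le> i" by linarith
      then show ?thesis by cases (use that in \<open>auto simp: s_def store_def\<close>)
    qed
    then have "map (\<lambda>i. (tape_content (if i < length [x, y] then [x, y] ! i else []), 0)) [0..<n + 2] =
        map s [0..<n + 2]"
      by (intro map_cong refl) (simp only: set_upt atLeastLessThan_iff)
    moreover have "tapes ?M = n + 2" "start ?M = 0" by (simp_all add: machine_def)
    ultimately have "init ?M [x, y] = (0, map s [0..<n + 2])"
      by (simp only: init_def)
    from machine_run[OF t(2) _ _ this t(1)] max_tape_marks[of n]
    have "run ?M [x, y] (poly ?p (length x)) =
      (if scan (store (tape_content x) ?Z g 4) = 1 then reject ?M else accept ?M,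
       map (store (tape_content x) ?Z g) [0..<n + 2])"
      by (simp add: c_def n_def)
    then show ?thesis
      using g(2) scan_counter[of 4 "tape_content x" ?Z g] by (simp add: store_def del: upt_Suc)
  qed
  moreover have "init M [x] = init M [x, []]" for M x
    unfolding init_def by (simp add: less_Suc_eq)
  ultimately show ?thesis using wf unfolding Let_def by blast
qed

section \<open>Definable functions\<close>

type_synonym world = "bool list \<times> (int \<Rightarrow> nat)"

definition get :: "nat list \<Rightarrow> nat \<Rightarrow> nat" where
  "get \<rho> i = (if i < length \<rho> then \<rho> ! i else 0)"

lemma get_tl: "get (tl \<rho>) n = get \<rho> (Suc n)"
  by (cases \<rho>) (auto simp: get_def nth_tl)

lemma get_Cons [simp]: "get (a # \<rho>) 0 = a" "get (a # \<rho>) (Suc n) = get \<rho> n"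
  by (auto simp: get_def)

fun lift :: "nat \<Rightarrow> expr \<Rightarrow> expr" where
  "lift c (Var i) = Var (if i < c then i else Suc i)"
| "lift c (Const n) = Const n"
| "lift c Len = Len"
| "lift c (Rd b e) = Rd b (lift c e)"
| "lift c (Add e1 e2) = Add (lift c e1) (lift c e2)"
| "lift c (Sub e1 e2) = Sub (lift c e1) (lift c e2)"
| "lift c (Sum e1 e2) = Sum (lift c e1) (lift (Suc c) e2)"

text \<open>With the default value 0 of \<open>get\<close> the hypothesis also covers variables
  beyond the end of the environment, so no lengths have to be compared and the tail of an empty
  environment is included.\<close>

lemma eval_lift:
  assumes "\<And>i. get \<rho>' (if i < c then i else Suc i) = get \<rho> i"
  shows "eval w \<rho>' (lift c e) = eval w \<rho> e"
  using assms
proof (induction e arbitrary: \<rho> \<rho>' c)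
  case (Sum e1 e2)
  have "eval w (i # \<rho>') (lift (Suc c) e2) = eval w (i # \<rho>) e2" for i
  proof (rule Sum.IH)
    fix j show "get (i # \<rho>') (if j < Suc c then j else Suc j) = get (i # \<rho>) j"
      using Sum.prems[of "j - 1"] by (cases j) auto
  qed
  moreover have "eval w \<rho>' (lift c e1) = eval w \<rho> e1"
    using Sum by blast
  ultimately show ?case by simp
qed (auto simp: get_def[symmetric])

text \<open>Semantic counterpart of \<open>expr\<close>: closure rules for this notion spare writing
  out the larger expressions with their de Bruijn indices.\<close>

definition def_fun :: "(world \<Rightarrow> nat list \<Rightarrow> nat) \<Rightarrow> bool" where
  "def_fun F \<longleftrightarrow> (\<exists>e. \<forall>w \<rho>. eval w \<rho> e = F w \<rho>)"

definition def_pred :: "(world \<Rightarrow> nat list \<Rightarrow> bool) \<Rightarrow> bool" where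
  "def_pred P \<longleftrightarrow> def_fun (\<lambda>w \<rho>. of_bool (P w \<rho>))"

lemma def_fun_tl: "def_fun F \<Longrightarrow> def_fun (\<lambda>w \<rho>. F w (tl \<rho>))"
proof -
  assume "def_fun F"
  then obtain e where e: "\<And>w \<rho>. eval w \<rho> e = F w \<rho>" by (auto simp: def_fun_def)
  have "eval w \<rho> (lift 0 e) = F w (tl \<rho>)" for w \<rho>
    unfolding e[symmetric] by (rule eval_lift) (simp add: get_tl)
  then show ?thesis by (auto simp: def_fun_def)
qed

lemma def_fun_get: "def_fun (\<lambda>w \<rho>. get \<rho> n)"
  unfolding def_fun_def by (rule exI[of _ "Var n"]) (simp add: get_def)

lemma def_fun_get_tl:
  "def_fun (\<lambda>w \<rho>. get (tl \<rho>) n)" "def_fun (\<lambda>w \<rho>. get (tl (tl \<rho>)) n)"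
  "def_fun (\<lambda>w \<rho>. get (tl (tl (tl \<rho>))) n)"
  by (simp_all add: get_tl def_fun_get)

lemma def_fun_const: "def_fun (\<lambda>w \<rho>. n)"
  unfolding def_fun_def by (rule exI[of _ "Const n"]) simp

lemma def_fun_length: "def_fun (\<lambda>w \<rho>. length (fst w))"
  unfolding def_fun_def by (rule exI[of _ "Len"]) simp

lemma def_fun_read:
  assumes "def_fun F"
  shows "def_fun (\<lambda>w \<rho>. tape_content (fst w) (int (F w \<rho>)))" "def_fun (\<lambda>w \<rho>. snd w (int (F w \<rho>)))"
proof -
  obtain e where e: "\<And>w \<rho>. eval w \<rho> e = F w \<rho>" using assms by (auto simp: def_fun_def)
  show "def_fun (\<lambda>w \<rho>. tape_content (fst w) (int (F w \<rho>)))"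
    unfolding def_fun_def by (rule exI[of _ "Rd False e"]) (simp add: e)
  show "def_fun (\<lambda>w \<rho>. snd w (int (F w \<rho>)))"
    unfolding def_fun_def by (rule exI[of _ "Rd True e"]) (simp add: e)
qed

lemma def_fun_arith:
  assumes "def_fun F" "def_fun G"
  shows "def_fun (\<lambda>w \<rho>. F w \<rho> + G w \<rho>)" "def_fun (\<lambda>w \<rho>. F w \<rho> - G w \<rho>)"
proof -
  obtain e e' where e: "\<And>w \<rho>. eval w \<rho> e = F w \<rho>" "\<And>w \<rho>. eval w \<rho> e' = G w \<rho>"
    using assms unfolding def_fun_def by blast
  show "def_fun (\<lambda>w \<rho>. F w \<rho> + G w \<rho>)"
    unfolding def_fun_def by (rule exI[of _ "Add e e'"]) (simp add: e)
  show "def_fun (\<lambda>w \<rho>. F w \<rho> - G w \<rho>)"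
    unfolding def_fun_def by (rule exI[of _ "Sub e e'"]) (simp add: e)
qed

text \<open>Inside the body the bound variable is the head of the extended environment, so it
  appears as \<open>get \<rho> 0\<close> and the outer environment as
  \<open>tl \<rho>\<close>.\<close>

lemma def_fun_sum:
  assumes "def_fun F" "def_fun (\<lambda>w \<rho>. G w (get \<rho> 0) (tl \<rho>))"
  shows "def_fun (\<lambda>w \<rho>. \<Sum>i<F w \<rho>. G w i \<rho>)"
proof -
  obtain e e' where e: "\<And>w \<rho>. eval w \<rho> e = F w \<rho>" "\<And>w \<rho>. eval w \<rho> e' = G w (get \<rho> 0) (tl \<rho>)"
    using assms unfolding def_fun_def by blast
  show ?thesis
    unfolding def_fun_def by (rule exI[of _ "Sum e e'"]) (simp add: e)
qed

lemma def_fun_Suc: "def_fun F \<Longrightarrow> def_fun (\<lambda>w \<rho>. Suc (F w \<rho>))"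
  using def_fun_arith(1)[OF _ def_fun_const[of 1]] by simp

lemma def_fun_mult:
  assumes "def_fun F" "def_fun G"
  shows "def_fun (\<lambda>w \<rho>. F w \<rho> * G w \<rho>)"
  using def_fun_sum[OF assms(1) def_fun_tl[OF assms(2)]] by simp

lemma def_fun_power: "def_fun F \<Longrightarrow> def_fun (\<lambda>w \<rho>. F w \<rho> ^ n)"
  by (induction n) (simp_all add: def_fun_const def_fun_mult)

lemma def_fun_poly: "def_fun F \<Longrightarrow> def_fun (\<lambda>w \<rho>. poly p (F w \<rho>))"
  by (induction p) (simp_all add: def_fun_const def_fun_mult def_fun_arith)

section \<open>Definable predicates, as 0-1 valued functions\<close>

lemma def_pred_not: "def_pred P \<Longrightarrow> def_pred (\<lambda>w \<rho>. \<not> P w \<rho>)"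
proof -
  assume "def_pred P"
  moreover have eq: "of_bool (\<not> b) = 1 - (of_bool b :: nat)" for b by simp
  ultimately show ?thesis
    unfolding def_pred_def eq by (intro def_fun_arith def_fun_const)
qed

lemma def_pred_conj: "def_pred P \<Longrightarrow> def_pred Q \<Longrightarrow> def_pred (\<lambda>w \<rho>. P w \<rho> \<and> Q w \<rho>)"
  unfolding def_pred_def of_bool_conj by (rule def_fun_mult)

lemma def_pred_disj: "def_pred P \<Longrightarrow> def_pred Q \<Longrightarrow> def_pred (\<lambda>w \<rho>. P w \<rho> \<or> Q w \<rho>)"
  using def_pred_not[OF def_pred_conj[OF def_pred_not def_pred_not], of P Q] by simp

lemma def_pred_imp: "def_pred P \<Longrightarrow> def_pred Q \<Longrightarrow> def_pred (\<lambda>w \<rho>. P w \<rho> \<longrightarrow> Q w \<rho>)"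
  using def_pred_disj[OF def_pred_not, of P Q] by simp

lemma def_pred_pos: "def_fun F \<Longrightarrow> def_pred (\<lambda>w \<rho>. 0 < F w \<rho>)"
proof -
  assume "def_fun F"
  \<comment> \<open>Truncated subtraction from 1, applied twice, gives the sign of
    \<open>n\<close>.\<close>
  moreover have eq: "of_bool (0 < n) = 1 - (1 - n)" for n :: nat by simp
  ultimately show ?thesis unfolding def_pred_def eq by (intro def_fun_arith def_fun_const)
qed

lemma def_pred_less: "def_fun F \<Longrightarrow> def_fun G \<Longrightarrow> def_pred (\<lambda>w \<rho>. F w \<rho> < G w \<rho>)"
  using def_pred_pos[OF def_fun_arith(2), of G F] by simp

lemma def_pred_le: "def_fun F \<Longrightarrow> def_fun G \<Longrightarrow> def_pred (\<lambda>w \<rho>. F w \<rho> \<le> G w \<rho>)"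
  using def_pred_not[OF def_pred_less, of G F] by (simp add: not_less)

lemma def_pred_eq: "def_fun F \<Longrightarrow> def_fun G \<Longrightarrow> def_pred (\<lambda>w \<rho>. F w \<rho> = G w \<rho>)"
  using def_pred_conj[OF def_pred_le def_pred_le, of F G G F] unfolding order_eq_iff[symmetric] .

lemma def_pred_ex:
  assumes "def_fun F" "def_pred (\<lambda>w \<rho>. P w (get \<rho> 0) (tl \<rho>))"
  shows "def_pred (\<lambda>w \<rho>. \<exists>i<F w \<rho>. P w i \<rho>)"
proof -
  have "def_fun (\<lambda>w \<rho>. \<Sum>i<F w \<rho>. of_bool (P w i \<rho>))"
    using assms unfolding def_pred_def by (rule def_fun_sum)
  from def_pred_pos[OF this] show ?thesis
    by (simp add: zero_less_iff_neq_zero Bex_def del: sum_of_bool_eq)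
qed

lemma def_pred_all:
  assumes "def_fun F" "def_pred (\<lambda>w \<rho>. P w (get \<rho> 0) (tl \<rho>))"
  shows "def_pred (\<lambda>w \<rho>. \<forall>i<F w \<rho>. P w i \<rho>)"
  using def_pred_not[OF def_pred_ex[OF assms(1) def_pred_not[OF assms(2)]]] by simp

lemma def_pred_const: "def_pred (\<lambda>w \<rho>. b)"
  unfolding def_pred_def by (rule def_fun_const)

lemma def_fun_if:
  assumes "def_pred P" "def_fun F" "def_fun G"
  shows "def_fun (\<lambda>w \<rho>. if P w \<rho> then F w \<rho> else G w \<rho>)"
proof -
  have eq: "(if b then m else n) = of_bool b * m + of_bool (\<not> b) * n" for b and m n :: nat
    by simp
  show ?thesis
    using assms def_pred_not[OF assms(1)] unfolding def_pred_def eq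
    by (intro def_fun_arith def_fun_mult)
qed

lemma def_fun_of_bool: "def_pred P \<Longrightarrow> def_fun (\<lambda>w \<rho>. of_bool (P w \<rho>))"
  by (simp add: def_pred_def)

text \<open>The sum counts the positive multiples of \<open>n\<close> up to \<open>m\<close>. For
  \<open>n = 0\<close> every index passes, which gives \<open>m\<close> instead of the value 0 of
  \<open>m div 0\<close>; hence the case distinction.\<close>

lemma div_eq_sum: "(\<Sum>i<m. of_bool (Suc i * n \<le> m)) = (if n = 0 then m else m div n)" for m n :: nat
proof (cases "n = 0")
  case False
  have "{..<m} \<inter> {i. Suc i * n \<le> m} = {..<m div n}"
  proof (intro set_eqI iffI)
    fix i assume "i \<in> {..<m} \<inter> {i. Suc i * n \<le> m}"
    then show "i \<in> {..<m div n}"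
      using False by (simp add: less_eq_div_iff_mult_less_eq Suc_le_eq[symmetric] del: mult_Suc)
  next
    fix i assume "i \<in> {..<m div n}"
    then have "Suc i * n \<le> m"
      using False by (simp add: less_eq_div_iff_mult_less_eq Suc_le_eq[symmetric] del: mult_Suc)
    moreover have "Suc i * 1 \<le> Suc i * n" using False by (intro mult_le_mono2) simp
    ultimately have "Suc i \<le> m" by (metis le_trans mult_1_right)
    with \<open>Suc i * n \<le> m\<close> show "i \<in> {..<m} \<inter> {i. Suc i * n \<le> m}" by (simp del: mult_Suc)
  qed
  then show ?thesis using False by simp
qed simp

lemma def_fun_div:
  assumes "def_fun F" "def_fun G"
  shows "def_fun (\<lambda>w \<rho>. F w \<rho> div G w \<rho>)"
proof -
  have "def_fun (\<lambda>w \<rho>. if G w \<rho> = 0 then 0 else \<Sum>i<F w \<rho>. of_bool (Suc i * G w \<rho> \<le> F w \<rho>))"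
    using assms assms[THEN def_fun_tl]
    by (intro def_fun_if def_fun_sum def_pred_eq def_fun_of_bool def_pred_le def_fun_mult
        def_fun_Suc def_fun_get def_fun_const) 
  then show ?thesis
    unfolding div_eq_sum by (rule back_subst[of def_fun]) (auto simp: fun_eq_iff)
qed

lemma def_fun_mod:
  assumes "def_fun F" "def_fun G"
  shows "def_fun (\<lambda>w \<rho>. F w \<rho> mod G w \<rho>)"
  unfolding modulo_nat_def using assms by (intro def_fun_arith def_fun_mult def_fun_div)

lemmas def_intros = def_fun_get def_fun_get_tl def_fun_const def_fun_length def_fun_read def_fun_arith
  def_fun_sum def_fun_Suc def_fun_mult def_fun_power def_fun_poly def_fun_if def_fun_of_bool
  def_fun_div def_fun_mod
  def_pred_const def_pred_not def_pred_conj def_pred_disj def_pred_imp def_pred_less def_pred_le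
  def_pred_eq def_pred_ex def_pred_all

text \<open>A table with finitely many entries is a finite sum of case distinctions, whatever
  \<open>g\<close> is. This is how the transition function of an arbitrary machine becomes
  definable; \<open>K\<close> must be independent of the input.\<close>

lemma def_fun_finite:
  assumes "def_fun F"
  shows "def_fun (\<lambda>w \<rho>. if F w \<rho> < K then g (F w \<rho>) else 0)"
proof (induction K)
  case (Suc K)
  have "def_fun (\<lambda>w \<rho>. (if F w \<rho> < K then g (F w \<rho>) else 0) + (if F w \<rho> = K then g K else 0))"
    by (intro def_intros assms Suc)
  then show ?case
    by (rule back_subst[of def_fun]) (auto simp: fun_eq_iff)
qed (simp add: def_fun_const)

lemma def_fun_finite2:
  assumes "def_fun F" "def_fun G"
  shows "def_fun (\<lambda>w \<rho>. if F w \<rho> < K \<and> G w \<rho> < L then g (F w \<rho>) (G w \<rho>) else 0)"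
proof (induction K)
  case (Suc K)
  have "def_fun (\<lambda>w \<rho>. (if F w \<rho> < K \<and> G w \<rho> < L then g (F w \<rho>) (G w \<rho>) else 0) +
      (if F w \<rho> = K then (if G w \<rho> < L then g K (G w \<rho>) else 0) else 0))"
    by (intro def_intros assms Suc def_fun_finite)
  then show ?case
    by (rule back_subst[of def_fun]) (auto simp: fun_eq_iff)
qed (simp add: def_fun_const)

section \<open>Polynomial time from definability\<close>

fun fill :: "(world \<Rightarrow> nat list \<Rightarrow> nat) \<Rightarrow> bool list \<Rightarrow> nat \<Rightarrow> int \<Rightarrow> nat" where
  "fill E x 0 = tape_content []"
| "fill E x (Suc i) = (fill E x i)(int i := min 2 (E (x, fill E x i) [i]))"

lemma table_eq_fill:
  assumes "\<And>w \<rho>. eval w \<rho> e = E w \<rho>"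
  shows "table x e (tape_content []) n = fill E x n"
  by (induction n) (auto simp: assms)

lemma poly_time_decidableI:
  fixes D :: "nat \<Rightarrow> nat"
  assumes "def_fun (\<lambda>w \<rho>. D (length (fst w)))" "def_fun E" "def_pred P"
    and "\<And>x. x \<in> fst A \<Longrightarrow> P (x, fill E x (D (length x))) []"
    and "\<And>x. x \<in> snd A \<Longrightarrow> \<not> P (x, fill E x (D (length x))) []"
  shows "poly_time_decidable A"
proof -
  obtain e0 e1 e2 where e: "\<And>w \<rho>. eval w \<rho> e0 = D (length (fst w))" "\<And>w \<rho>. eval w \<rho> e1 = E w \<rho>"
    "\<And>w \<rho>. eval w \<rho> e2 = of_bool (P w \<rho>)"
    using assms(1-3) unfolding def_pred_def def_fun_def by blast
  from program_machine[of e0 e1 e2] obtain M p where M: "wf_tm M" "\<And>x. init M [x] = init M [x, []]"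
    "\<And>x y. let Z = result e0 e1 x y; c = run M [x, y] (poly p (length x))
     in fst c = (if eval (x, Z) [] e2 = 0 then reject M else accept M) \<and> fst (snd c ! 1) = Z"
    by blast
  have "fst (run M [x] (poly p (length x))) =
      (if P (x, fill E x (D (length x))) [] then accept M else reject M)" for x
    using M(3)[of x "[]"] M(2)[of x]
    by (simp add: e result_def table_eq_fill[OF e(2)] Let_def run_def)
  then show ?thesis
    unfolding poly_time_decidable_def accepts_within_def rejects_within_def
    using M(1) assms(4,5) by (intro exI[of _ M] exI[of _ p]) auto
qed

text \<open>The entries are the symbols 1 and 2 of the output bits and do not consult earlier
  entries. Cells from \<open>D (length x)\<close> on stay blank, so tape 1 holds exactly the output
  word. The verdict is the constant 1, as an output counts only together with acceptance.\<close>

lemma poly_time_computableI: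
  fixes D :: "nat \<Rightarrow> nat"
  assumes "def_fun (\<lambda>w \<rho>. D (length (fst w)))" "def_fun (\<lambda>w \<rho>. E (fst w) (get \<rho> 0))"
    and "\<And>x. length (f x) = D (length x)"
    and "\<And>x i. i < D (length x) \<Longrightarrow> E x i = (if f x ! i then 2 else 1)"
  shows "poly_time_computable f"
proof -
  obtain e0 e1 where e: "\<And>w \<rho>. eval w \<rho> e0 = D (length (fst w))"
    "\<And>w \<rho>. eval w \<rho> e1 = E (fst w) (get \<rho> 0)"
    using assms(1-2) unfolding def_fun_def by blast
  have fill: "n \<le> D (length x) \<Longrightarrow>
      fill (\<lambda>w \<rho>. E (fst w) (get \<rho> 0)) x n = tape_content (take n (f x))" for x n
  proof (induction n)
    case (Suc n)
    then show ?case
      by (auto simp: fun_eq_iff tape_content_def assms nat_less_iff)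
  qed simp
  from program_machine[of e0 e1 "Const 1"] obtain M p where
    M: "wf_tm M" "\<And>x. init M [x] = init M [x, []]"
    "\<And>x y. let Z = result e0 e1 x y; c = run M [x, y] (poly p (length x))
     in fst c = (if eval (x, Z) [] (Const 1) = 0 then reject M else accept M) \<and> fst (snd c ! 1) = Z"
    by blast
  have "outputs_within M x (poly p (length x)) (f x)" for x
    using M(3)[of x "[]"] M(2)[of x] fill[of "D (length x)" x]
    by (simp add: e result_def table_eq_fill[OF e(2)] Let_def run_def outputs_within_def
      accepts_within_def assms(3))
  then show ?thesis
    unfolding poly_time_computable_def using M(1) by blast
qed

text \<open>A table of length 0 leaves the certificate on tape 1, where \<open>P\<close> reads it.
  The machine halts within a bound in \<open>length x\<close> for certificates of any
  length.\<close>

lemma in_NP_I: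
  assumes "def_pred P"
    and "\<And>x. x \<in> fst A \<Longrightarrow> \<exists>y. length y \<le> poly q (length x) \<and> P (x, tape_content y) []"
    and "\<And>x y. x \<in> snd A \<Longrightarrow> \<not> P (x, tape_content y) []"
  shows "in_NP A"
proof -
  obtain e where e: "\<And>w \<rho>. eval w \<rho> e = of_bool (P w \<rho>)"
    using assms(1) unfolding def_pred_def def_fun_def by blast
  from program_machine[of "Const 0" "Const 0" e] obtain M p where M: "wf_tm M"
    "\<And>x y. let Z = result (Const 0) (Const 0) x y; c = run M [x, y] (poly p (length x))
     in fst c = (if eval (x, Z) [] e = 0 then reject M else accept M) \<and> fst (snd c ! 1) = Z"
    by blast
  have r: "fst (run M [x, y] (poly p (length x))) =
      (if P (x, tape_content y) [] then accept M else reject M)" for x y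
    using M(2)[of x y] by (simp add: e result_def Let_def)
  show ?thesis
    unfolding in_NP_def accepts_within_def rejects_within_def
    by (rule exI[of _ M], rule exI[of _ p], rule exI[of _ q])
      (use M(1) assms(2,3) in \<open>auto simp: r, metis\<close>)
qed

section \<open>Reading encoded graphs\<close>

text \<open>An encoded graph with n vertices has n * n + n + 1 symbols. Counting the
  \<open>Suc i\<close> at which this polynomial does not exceed \<open>L\<close> inverts it, so the
  number of vertices is obtained from the length without a search for the end of the unary
  prefix.\<close>

definition order_of :: "nat \<Rightarrow> nat" where
  "order_of L = (\<Sum>i<L. of_bool (Suc i * Suc i + Suc i + 1 \<le> L))"

text \<open>The offset skips the unary prefix and the separator.\<close>

definition adj :: "bool list \<Rightarrow> nat \<Rightarrow> nat \<Rightarrow> bool" where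
  "adj x i j \<longleftrightarrow>
     tape_content x (int (order_of (length x) + 1 + i * order_of (length x) + j)) = 2"

definition deg :: "bool list \<Rightarrow> nat \<Rightarrow> nat" where
  "deg x v = (\<Sum>j<order_of (length x). of_bool (adj x v j))"

lemma order_of_eq: "order_of (n * n + n + 1) = n"
proof -
  have *: "{..<n * n + n + 1} \<inter> {i. Suc i * Suc i + Suc i + 1 \<le> n * n + n + 1} = {..<n}"
  proof (intro set_eqI iffI)
    fix i assume "i \<in> {..<n * n + n + 1} \<inter> {i. Suc i * Suc i + Suc i + 1 \<le> n * n + n + 1}"
    then have le: "Suc i * Suc i + Suc i + 1 \<le> n * n + n + 1" by simp
    have "i < n"
    proof (rule ccontr)
      assume "\<not> i < n"
      then have "n * n \<le> i * i" by (intro mult_le_mono) auto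
      with \<open>\<not> i < n\<close> le show False by simp
    qed
    then show "i \<in> {..<n}" by simp
  next
    fix i assume "i \<in> {..<n}"
    then have "Suc i \<le> n" by simp
    then have "Suc i * Suc i \<le> n * n" by (intro mult_le_mono)
    with \<open>Suc i \<le> n\<close> show "i \<in> {..<n * n + n + 1} \<inter> {i. Suc i * Suc i + Suc i + 1 \<le> n * n + n + 1}"
      by simp
  qed
  show ?thesis
    unfolding order_of_def
    by (subst sum_of_bool_eq) (simp_all only: * finite_lessThan card_lessThan of_nat_id)
qed

lemma tape_content_nat:
  "tape_content w (int i) = (if i < length w then if w ! i then 2 else 1 else 0)"
  by (simp add: tape_content_def)

lemma length_concat_square: "length (concat (map (\<lambda>i. map (f i) [0..<n]) [0..<m])) = m * n"
  by (induction m) auto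

lemma nth_concat_square:
  assumes "i < m" "j < n"
  shows "concat (map (\<lambda>i. map (f i) [0..<n]) [0..<m]) ! (i * n + j) = f i j"
  using assms
proof (induction m)
  case (Suc m)
  show ?case
  proof (cases "i < m")
    case True
    then have "Suc i * n \<le> m * n" by (intro mult_le_mono1) simp
    with Suc.prems have "i * n + j < m * n" by simp
    with Suc True show ?thesis by (simp add: nth_append length_concat_square)
  next
    case False
    with Suc.prems have "i = m" by simp
    with Suc.prems show ?thesis by (simp add: nth_append length_concat_square)
  qed
qed simp

lemma length_encode: "length (encode G) = card (fst G) * card (fst G) + card (fst G) + 1"
  by (simp add: encode_def Let_def length_concat_square)

lemma order_of_encode: "order_of (length (encode G)) = card (fst G)"
  unfolding length_encode by (rule order_of_eq)

lemma adj_encode: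
  assumes "i < card (fst G)" "j < card (fst G)"
  shows "adj (encode G) i j \<longleftrightarrow> {i, j} \<in> snd G"
proof -
  let ?n = "card (fst G)"
  have "Suc i * ?n \<le> ?n * ?n" using assms by (intro mult_le_mono1) simp
  then have l: "i * ?n + j < ?n * ?n" using assms by simp
  have "?n + 1 + i * ?n + j < length (encode G)"
    unfolding length_encode using l by simp
  moreover have "encode G ! (?n + 1 + i * ?n + j) \<longleftrightarrow> {i, j} \<in> snd G"
  proof -
    have "encode G ! (?n + 1 + i * ?n + j) =
        concat (map (\<lambda>i. map (\<lambda>j. {i, j} \<in> snd G) [0..<?n]) [0..<?n]) ! (i * ?n + j)"
      by (simp add: encode_def Let_def nth_append)
    then show ?thesis using nth_concat_square[OF assms] by simp
  qed
  ultimately show ?thesis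
    unfolding adj_def order_of_encode tape_content_nat by simp
qed

text \<open>An edge at \<open>v\<close> is \<open>{v, u}\<close> for exactly one \<open>u\<close>.
  The degree thereby becomes a row sum of the adjacency matrix.\<close>

lemma vertex_degree_eq:
  assumes "simple_graph G"
  shows "vertex_degree G v = card {u \<in> fst G. {v, u} \<in> snd G}"
proof -
  have "{e \<in> snd G. v \<in> e} = (\<lambda>u. {v, u}) ` {u \<in> fst G. {v, u} \<in> snd G}"
  proof (intro set_eqI iffI)
    fix e assume e: "e \<in> {e \<in> snd G. v \<in> e}"
    then have "card e = 2" "e \<subseteq> fst G" using assms by (auto simp: simple_graph_def)
    then obtain a b where "e = {a, b}" "a \<noteq> b" by (auto simp: card_2_iff)
    with e obtain u where "e = {v, u}" by blast
    with e \<open>e \<subseteq> fst G\<close> show "e \<in> (\<lambda>u. {v, u}) ` {u \<in> fst G. {v, u} \<in> snd G}" by blast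
  qed auto
  moreover have "inj_on (\<lambda>u. {v, u}) {u \<in> fst G. {v, u} \<in> snd G}"
    by (auto simp: inj_on_def doubleton_eq_iff)
  ultimately show ?thesis
    unfolding vertex_degree_def by (simp add: card_image)
qed

lemma deg_encode:
  assumes "input_graph G" "v \<in> fst G"
  shows "deg (encode G) v = vertex_degree G v"
proof -
  obtain n where n: "fst G = {..<n}" using assms by (auto simp: input_graph_def)
  have "deg (encode G) v = (\<Sum>j<n. of_bool ({v, j} \<in> snd G))"
    unfolding deg_def order_of_encode
    using adj_encode[of v G] assms(2) n by (intro sum.cong) (auto simp del: sum_of_bool_eq)
  also have "\<dots> = card {u \<in> fst G. {v, u} \<in> snd G}"
    unfolding n by (simp add: Collect_conj_eq lessThan_def)
  finally show ?thesis
    using vertex_degree_eq[of G v] assms by (simp add: input_graph_def)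
qed

lemma def_fun_order_of: "def_fun F \<Longrightarrow> def_fun (\<lambda>w \<rho>. order_of (F w \<rho>))"
  unfolding order_of_def using def_fun_tl[of F] by (intro def_intros)

lemma def_pred_adj:
  "def_fun F \<Longrightarrow> def_fun G \<Longrightarrow> def_pred (\<lambda>w \<rho>. adj (fst w) (F w \<rho>) (G w \<rho>))"
  unfolding adj_def by (intro def_intros def_fun_order_of)

lemma def_fun_deg: "def_fun F \<Longrightarrow> def_fun (\<lambda>w \<rho>. deg (fst w) (F w \<rho>))"
  unfolding deg_def using def_fun_tl[of F]
  by (intro def_intros def_fun_order_of def_pred_adj)

section \<open>Membership in NP\<close>

text \<open>The label of \<open>v\<close> is read off the \<open>v\<close>-th block of \<open>k\<close> certificate symbols, in unary. Any
  certificate yields labels in \<open>{1..k}\<close>.\<close>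

definition cert_label :: "nat \<Rightarrow> (int \<Rightarrow> nat) \<Rightarrow> nat \<Rightarrow> nat" where
  "cert_label k Y v = 1 + (\<Sum>l<k - 1. of_bool (Y (int (v * k + l)) = 2))"

definition verified :: "nat \<Rightarrow> bool list \<Rightarrow> (int \<Rightarrow> nat) \<Rightarrow> bool" where
  "verified k x Y \<longleftrightarrow> (\<forall>u<order_of (length x). \<forall>v<order_of (length x). adj x u v \<longrightarrow>
     cert_label k Y u * deg x u \<noteq> cert_label k Y v * deg x v)"

lemma def_pred_verified: "def_pred (\<lambda>w \<rho>. verified k (fst w) (snd w))"
  unfolding verified_def cert_label_def
  by (intro def_intros def_fun_order_of def_pred_adj def_fun_deg)

lemma labeling_iff:
  assumes "input_graph G" "fst G = {..<n}"
  shows "labeling_by_degree k G f \<longleftrightarrow> (\<forall>v<n. f v \<in> {1..k}) \<and> (\<forall>u<n. \<forall>v<n. adj (encode G) u v \<longrightarrow>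
     f u * deg (encode G) u \<noteq> f v * deg (encode G) v)"
proof -
  have e: "u < n \<and> v < n" if "{u, v} \<in> snd G" for u v
    using that assms by (auto simp: input_graph_def simple_graph_def)
  have d: "deg (encode G) v = vertex_degree G v" if "v < n" for v
    using deg_encode assms that by simp
  have a: "adj (encode G) u v \<longleftrightarrow> {u, v} \<in> snd G" if "u < n" "v < n" for u v
    using adj_encode[of u G v] assms that by simp
  have "proper_coloring G (\<lambda>v. f v * vertex_degree G v) \<longleftrightarrow>
      (\<forall>u<n. \<forall>v<n. adj (encode G) u v \<longrightarrow> f u * deg (encode G) u \<noteq> f v * deg (encode G) v)"
    unfolding proper_coloring_def using e by (metis a d)
  moreover have "f ` fst G \<subseteq> {1..k} \<longleftrightarrow> (\<forall>v<n. f v \<in> {1..k})"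
    unfolding assms(2) by auto
  ultimately show ?thesis unfolding labeling_by_degree_def by simp
qed

lemma verified_iff:
  assumes "input_graph G" "fst G = {..<n}" "1 \<le> k"
  shows "verified k (encode G) Y \<longleftrightarrow> labeling_by_degree k G (cert_label k Y)"
proof -
  have "cert_label k Y v \<in> {1..k}" for v
  proof -
    have "(\<Sum>l<k - 1. of_bool (Y (int (v * k + l)) = 2)) \<le> (\<Sum>l<k - 1. 1 :: nat)"
      by (intro sum_mono) auto
    then show ?thesis using \<open>1 \<le> k\<close> by (simp add: cert_label_def del: sum_of_bool_eq)
  qed
  then show ?thesis
    unfolding verified_def labeling_iff[OF assms(1,2)] order_of_encode using assms(2) by simp
qed

lemma labeling_in_NP:
  assumes "1 \<le> k"
  shows "in_NP (graph_problem P (has_labeling_by_degree k))"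
\<comment> \<open>\<open>k\<close> symbols for each vertex, and the number of vertices is at most
  the input length.\<close>
proof (rule in_NP_I[where q = "[:0, k:]", OF def_pred_verified[of k]])
  fix x assume "x \<in> fst (graph_problem P (has_labeling_by_degree k))"
  then obtain G f where G: "x = encode G" "input_graph G" "labeling_by_degree k G f"
    by (auto simp: graph_problem_def has_labeling_by_degree_def)
  obtain n where n: "fst G = {..<n}" using G by (auto simp: input_graph_def)
  \<comment> \<open>The block of \<open>v\<close> starts with \<open>f v - 1\<close> set bits, since
    \<open>cert_label\<close> adds 1.\<close>
  define y where "y = concat (map (\<lambda>v. map (\<lambda>l. l < f v - 1) [0..<k]) [0..<n])"
  have l: "length y = n * k" by (simp add: y_def length_concat_square)
  have "cert_label k (tape_content y) v = f v" if "v < n" for v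
  proof -
    have f: "1 \<le> f v" "f v \<le> k"
      using G(3) that unfolding labeling_iff[OF G(2) n] by auto
    have "tape_content y (int (v * k + j)) = 2 \<longleftrightarrow> j < f v - 1" if "j < k" for j
    proof -
      have "Suc v * k \<le> n * k" using \<open>v < n\<close> by (intro mult_le_mono1) simp
      then have "v * k + j < length y" using that l by simp
      moreover have "y ! (v * k + j) = (j < f v - 1)"
        unfolding y_def using nth_concat_square[OF \<open>v < n\<close> that] .
      ultimately show ?thesis unfolding tape_content_nat by simp
    qed
    then have "(\<Sum>j<k - 1. of_bool (tape_content y (int (v * k + j)) = 2)) =
        (\<Sum>j<k - 1. of_bool (j < f v - 1) :: nat)"
      by (intro sum.cong) auto
    also have "\<dots> = card ({..<k - 1} \<inter> {j. j < f v - 1})" by simp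
    also have "{..<k - 1} \<inter> {j. j < f v - 1} = {..<f v - 1}" using f by auto
    finally show ?thesis using f by (simp add: cert_label_def)
  qed
  then have "labeling_by_degree k G (cert_label k (tape_content y))"
    using G(3) unfolding labeling_iff[OF G(2) n] by simp
  then have "verified k x (tape_content y)"
    using verified_iff[OF G(2) n assms] G(1) by simp
  moreover have "length y \<le> poly [:0, k:] (length x)"
    using l G(1) n by (simp add: length_encode algebra_simps)
  ultimately show "\<exists>y. length y \<le> poly [:0, k:] (length x) \<and>
      verified k (fst (x, tape_content y)) (snd (x, tape_content y))"
    by auto
next
  fix x y assume "x \<in> snd (graph_problem P (has_labeling_by_degree k))"
  then obtain G where G: "x = encode G" "input_graph G" "\<not> has_labeling_by_degree k G"
    by (auto simp: graph_problem_def)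
  then obtain n where n: "fst G = {..<n}" by (auto simp: input_graph_def)
  show "\<not> verified k (fst (x, tape_content y)) (snd (x, tape_content y))"
    using verified_iff[OF G(2) n assms] G by (auto simp: has_labeling_by_degree_def)
qed

section \<open>Labels 1 and 2\<close>

text \<open>The literal \<open>2 * v + b\<close> stands for giving the label \<open>b + 1\<close> to the vertex \<open>v\<close>.\<close>

definition neg :: "nat \<Rightarrow> nat" where
  "neg a = (if a mod 2 = 0 then a + 1 else a - 1)"

lemma neg_neg [simp]: "neg (neg a) = a"
  unfolding neg_def by presburger

lemma neg_less: "a < 2 * n \<Longrightarrow> neg a < 2 * n"
  unfolding neg_def by presburger

text \<open>A maximal set that is consistent and closed under \<open>R\<close> decides every
  literal: if both \<open>a\<close> and \<open>neg a\<close> were missing, one of them does not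
  imply its negation, and adding all its consequences would give a larger such set. Contraposition
  rules out conflicts among these consequences and with the old members.\<close>

lemma two_sat:
  fixes R :: "nat rel"
  assumes "trans R" "\<And>a. a < 2 * n \<Longrightarrow> (a, a) \<in> R" "R \<subseteq> {..<2 * n} \<times> {..<2 * n}"
    and contra: "\<And>a b. (a, b) \<in> R \<Longrightarrow> (neg b, neg a) \<in> R"
    and cons: "\<And>a. a < 2 * n \<Longrightarrow> (a, neg a) \<in> R \<Longrightarrow> (neg a, a) \<notin> R"
  shows "\<exists>S. (\<forall>a<2 * n. a \<in> S \<longleftrightarrow> neg a \<notin> S) \<and> (\<forall>a b. (a, b) \<in> R \<longrightarrow> a \<in> S \<longrightarrow> b \<in> S)"
proof -
  define good where "good S \<longleftrightarrow> S \<subseteq> {..<2 * n} \<and> (\<forall>a \<in> S. neg a \<notin> S) \<and>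
    (\<forall>a b. (a, b) \<in> R \<longrightarrow> a \<in> S \<longrightarrow> b \<in> S)" for S
  have fin: "finite {S. good S}"
    by (rule finite_subset[of _ "Pow {..<2 * n}"]) (auto simp: good_def)
  moreover have "good {}" by (simp add: good_def)
  ultimately obtain S where S: "good S" and max: "\<And>T. good T \<Longrightarrow> S \<subseteq> T \<Longrightarrow> T = S"
    using finite_has_maximal[of "{S. good S}"] by auto
  have extend: "a \<in> S" if a: "a < 2 * n" "neg a \<notin> S" "(a, neg a) \<notin> R" for a
  proof -
    let ?T = "S \<union> {b. (a, b) \<in> R}"
    have "False" if "b \<in> ?T" "neg b \<in> ?T" for b
    proof -
      have no: False if "b \<in> S" "(a, neg b) \<in> R" for b
        using contra[OF that(2)] that(1) S a(2) unfolding good_def neg_neg by blast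
      have "\<not> (b \<in> S \<and> neg b \<in> S)" using S by (auto simp: good_def)
      moreover have "\<not> (b \<in> S \<and> (a, neg b) \<in> R)" using no by blast
      moreover have "\<not> (neg b \<in> S \<and> (a, b) \<in> R)" using no[of "neg b"] by auto
      moreover have "\<not> ((a, b) \<in> R \<and> (a, neg b) \<in> R)"
        using contra[of a "neg b"] transD[OF assms(1), of a b "neg a"] a(3) by auto
      ultimately show False using that by blast
    qed
    then have "good ?T"
      using S assms(3) transD[OF assms(1)] unfolding good_def by blast
    with max[of ?T] have "?T = S" by blast
    then show "a \<in> S" using assms(2)[OF a(1)] by blast
  qed
  have "a \<in> S \<longleftrightarrow> neg a \<notin> S" if "a < 2 * n" for a
  proof
    show "a \<in> S \<Longrightarrow> neg a \<notin> S" using S by (auto simp: good_def)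
    assume *: "neg a \<notin> S"
    show "a \<in> S"
    proof (rule ccontr)
      assume "a \<notin> S"
      then have "(a, neg a) \<in> R" "(neg a, a) \<in> R"
        using extend[of a] extend[of "neg a"] * that neg_less by auto
      with cons[OF that] show False by blast
    qed
  qed
  then show ?thesis using S by (auto simp: good_def)
qed

section \<open>Labelings by 1 and 2 as a 2-satisfiability problem\<close>

definition lit_color :: "bool list \<Rightarrow> nat \<Rightarrow> nat" where
  "lit_color x a = (a mod 2 + 1) * deg x (a div 2)"

definition lits :: "bool list \<Rightarrow> nat" where
  "lits x = 2 * order_of (length x)"

text \<open>\<open>a\<close> and \<open>neg b\<close> cannot be chosen together, since they give
  equal products to adjacent vertices; choosing \<open>a\<close> therefore forces
  \<open>b\<close>.\<close>

definition implies :: "bool list \<Rightarrow> nat \<Rightarrow> nat \<Rightarrow> bool" where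
  "implies x a b \<longleftrightarrow> a < lits x \<and> b < lits x \<and>
     adj x (a div 2) (neg b div 2) \<and> lit_color x a = lit_color x (neg b)"

definition impl_rel :: "bool list \<Rightarrow> nat rel" where
  "impl_rel x = {(a, b). implies x a b}"

lemma neg_div: "neg a div 2 = a div 2" and neg_mod: "neg a mod 2 = 1 - a mod 2"
  unfolding neg_def by (cases "even a"; auto elim!: evenE oddE)+

text \<open>A labeling chooses one literal per vertex, and the chosen literals are closed under
  implication, so none can be linked to its negation in both directions. Conversely
  \<open>two_sat\<close> makes the choice; contraposition holds because adjacency is
  symmetric.\<close>

lemma labeling_iff_consistent:
  assumes "input_graph G"
  defines "x \<equiv> encode G"
  shows "has_labeling_by_degree 2 G \<longleftrightarrow>
    (\<forall>a<lits x. \<not> ((a, neg a) \<in> (impl_rel x)\<^sup>* \<and> (neg a, a) \<in> (impl_rel x)\<^sup>*))"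
proof -
  obtain n where n: "fst G = {..<n}" using assms by (auto simp: input_graph_def)
  have N: "lits x = 2 * n" "order_of (length x) = n"
    by (simp_all add: lits_def x_def order_of_encode n)
  have sym: "adj x u v = adj x v u" if "u < n" "v < n" for u v
    using that n by (simp add: x_def adj_encode insert_commute)
  show ?thesis
  proof
    assume "has_labeling_by_degree 2 G"
    then obtain f where f: "\<And>v. v < n \<Longrightarrow> f v \<in> {1..2}"
      "\<And>u v. u < n \<Longrightarrow> v < n \<Longrightarrow> adj x u v \<Longrightarrow> f u * deg x u \<noteq> f v * deg x v"
      unfolding has_labeling_by_degree_def labeling_iff[OF assms(1) n] x_def by blast
    define S where "S = {a. a < 2 * n \<and> f (a div 2) = a mod 2 + 1}"
    have neg_S: "a \<in> S \<longleftrightarrow> neg a \<notin> S" if "a < 2 * n" for a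
    proof -
      have "a div 2 < n" using that by simp
      then have "f (a div 2) = 1 \<or> f (a div 2) = 2" using f(1)[of "a div 2"] by force
      then show ?thesis using that neg_less[OF that]
        by (simp add: S_def neg_div neg_mod) presburger
    qed
    have closed1: "b \<in> S" if "(a, b) \<in> impl_rel x" "a \<in> S" for a b
    proof (rule ccontr)
      assume "b \<notin> S"
      have ab: "a < 2 * n" "b < 2 * n" "adj x (a div 2) (neg b div 2)" "lit_color x a = lit_color x (neg b)"
        using that N by (auto simp: impl_rel_def implies_def)
      have "neg b \<in> S" using \<open>b \<notin> S\<close> neg_S ab by blast
      have "a div 2 < n" "neg b div 2 < n" using ab neg_less[OF ab(2)] by simp_all
      with f(2) ab(3) have "f (a div 2) * deg x (a div 2) \<noteq> f (neg b div 2) * deg x (neg b div 2)"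
        by blast
      with \<open>a \<in> S\<close> \<open>neg b \<in> S\<close> ab(4) show False
        by (simp add: S_def lit_color_def)
    qed
    have closed: "b \<in> S" if "(a, b) \<in> (impl_rel x)\<^sup>*" "a \<in> S" for a b
      using that by (induction rule: rtrancl_induct) (auto intro: closed1)
    show "\<forall>a<lits x. \<not> ((a, neg a) \<in> (impl_rel x)\<^sup>* \<and> (neg a, a) \<in> (impl_rel x)\<^sup>*)"
    proof (intro allI impI notI, elim conjE)
      fix a assume a: "a < lits x" "(a, neg a) \<in> (impl_rel x)\<^sup>*" "(neg a, a) \<in> (impl_rel x)\<^sup>*"
      show False
        using closed[OF a(2)] closed[OF a(3)] neg_S[of a] a(1) N(1) by auto
    qed
  next
    assume c: "\<forall>a<lits x. \<not> ((a, neg a) \<in> (impl_rel x)\<^sup>* \<and> (neg a, a) \<in> (impl_rel x)\<^sup>*)"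
    let ?L = "{..<2 * n}"
    define R where "R = (impl_rel x)\<^sup>* \<inter> ?L \<times> ?L"
    have con1: "(neg b, neg a) \<in> impl_rel x" if "(a, b) \<in> impl_rel x" for a b
    proof -
      have ab: "a < 2 * n" "b < 2 * n" "adj x (a div 2) (b div 2)" "lit_color x a = lit_color x (neg b)"
        using that N by (simp_all add: impl_rel_def implies_def neg_div)
      have "adj x (b div 2) (a div 2)" using ab sym[of "a div 2" "b div 2"] by simp
      with ab neg_less show ?thesis
        unfolding impl_rel_def implies_def N neg_neg by (simp add: neg_div)
    qed
    have con: "(neg b, neg a) \<in> (impl_rel x)\<^sup>*" if "(a, b) \<in> (impl_rel x)\<^sup>*" for a b
      using that by (induction rule: rtrancl_induct) (auto intro: con1 converse_rtrancl_into_rtrancl)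
    have "\<exists>S. (\<forall>a<2 * n. a \<in> S \<longleftrightarrow> neg a \<notin> S) \<and> (\<forall>a b. (a, b) \<in> R \<longrightarrow> a \<in> S \<longrightarrow> b \<in> S)"
    proof (rule two_sat)
      show "trans R" unfolding R_def
        by (rule transI) (blast intro: rtrancl_trans)
      show "(neg b, neg a) \<in> R" if "(a, b) \<in> R" for a b
        using that con neg_less[of _ n] by (auto simp: R_def)
    qed (use c N in \<open>auto simp: R_def\<close>)
    then obtain S where S: "\<And>a. a < 2 * n \<Longrightarrow> a \<in> S \<longleftrightarrow> neg a \<notin> S"
      "\<And>a b. (a, b) \<in> R \<Longrightarrow> a \<in> S \<Longrightarrow> b \<in> S" by blast
    define f :: "nat \<Rightarrow> nat" where "f v = (if 2 * v + 1 \<in> S then 2 else 1)" for v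
    have lit: "2 * v + (f v - 1) \<in> S" if "v < n" for v
      using S(1)[of "2 * v"] that by (simp add: f_def neg_def)
    have "f u * deg x u \<noteq> f v * deg x v" if uv: "u < n" "v < n" "adj x u v" for u v
    proof
      assume eq: "f u * deg x u = f v * deg x v"
      let ?a = "2 * u + (f u - 1)" and ?b = "2 * v + (f v - 1)"
      have l: "?a < 2 * n" "?b < 2 * n" using uv by (auto simp: f_def)
      have c: "lit_color x ?a = f u * deg x u" "lit_color x ?b = f v * deg x v"
        by (auto simp: lit_color_def f_def)
      have d: "?a div 2 = u" "?b div 2 = v" by (auto simp: f_def)
      have "(?a, neg ?b) \<in> impl_rel x"
        unfolding impl_rel_def implies_def N
        using l neg_less[OF l(2)] c d eq uv(3) by (simp only: neg_neg) simp
      then have "(?a, neg ?b) \<in> R" using l(1) neg_less[OF l(2)] by (simp add: R_def r_into_rtrancl)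
      then have "neg ?b \<in> S" using S(2) lit[OF uv(1)] by blast
      then show False using lit[OF uv(2)] S(1)[OF l(2)] by blast
    qed
    then have "labeling_by_degree 2 G f"
      unfolding labeling_iff[OF assms(1) n] x_def[symmetric] by (auto simp: f_def)
    then show "has_labeling_by_degree 2 G" by (auto simp: has_labeling_by_degree_def)
  qed
qed

text \<open>Cell \<open>(d * N + a) * N + b\<close> of the table tells whether \<open>b\<close> is reachable from \<open>a\<close> by at most
  \<open>d\<close> implications.\<close>

definition reach :: "bool list \<Rightarrow> nat \<Rightarrow> nat rel" where
  "reach x d = {(a, b). \<exists>e\<le>d. (a, b) \<in> impl_rel x ^^ e}"

definition cell :: "nat \<Rightarrow> nat \<Rightarrow> nat \<Rightarrow> nat \<Rightarrow> nat" where
  "cell N d a b = (d * N + a) * N + b"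

definition reach_cell :: "bool list \<Rightarrow> (int \<Rightarrow> nat) \<Rightarrow> nat \<Rightarrow> nat" where
  "reach_cell x Y c = (let N = lits x; d = c div N div N; a = c div N mod N; b = c mod N in
     if d = 0 then of_bool (a = b)
     else of_bool (\<exists>k<N. Y (int (cell N (d - 1) a k)) = 1 \<and> (k = b \<or> implies x k b)))"

lemma impl_rel_bounded: "impl_rel x \<subseteq> {..<lits x} \<times> {..<lits x}"
  by (auto simp: impl_rel_def implies_def)

lemma relpow_bounded: "(a, b) \<in> impl_rel x ^^ e \<Longrightarrow> a < lits x \<Longrightarrow> b < lits x"
  using impl_rel_bounded by (cases e) auto

lemma reach_Suc:
  assumes "a < lits x"
  shows "(a, b) \<in> reach x (Suc d) \<longleftrightarrow> (\<exists>k<lits x. (a, k) \<in> reach x d \<and> (k = b \<or> implies x k b))"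
proof
  assume "(a, b) \<in> reach x (Suc d)"
  then obtain e where e: "e \<le> Suc d" "(a, b) \<in> impl_rel x ^^ e" by (auto simp: reach_def)
  show "\<exists>k<lits x. (a, k) \<in> reach x d \<and> (k = b \<or> implies x k b)"
  proof (cases "e \<le> d")
    case True
    with e have "(a, b) \<in> reach x d" by (auto simp: reach_def)
    with relpow_bounded[OF e(2) assms] show ?thesis by blast
  next
    case False
    with e have "(a, b) \<in> impl_rel x ^^ Suc d" by (metis le_SucE)
    then obtain k where k: "(a, k) \<in> impl_rel x ^^ d" "(k, b) \<in> impl_rel x" by auto
    then have "(a, k) \<in> reach x d" by (auto simp: reach_def)
    with k relpow_bounded[OF k(1) assms] show ?thesis by (auto simp: impl_rel_def)
  qed
next
  assume "\<exists>k<lits x. (a, k) \<in> reach x d \<and> (k = b \<or> implies x k b)"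
  then obtain k e where k: "e \<le> d" "(a, k) \<in> impl_rel x ^^ e" "k = b \<or> (k, b) \<in> impl_rel x"
    by (auto simp: reach_def impl_rel_def)
  from k(3) show "(a, b) \<in> reach x (Suc d)"
  proof
    assume "k = b"
    with k show ?thesis unfolding reach_def by (auto intro!: exI[of _ e])
  next
    assume "(k, b) \<in> impl_rel x"
    with k(2) have "(a, b) \<in> impl_rel x ^^ Suc e" by auto
    with k(1) show ?thesis unfolding reach_def by (auto intro!: exI[of _ "Suc e"])
  qed
qed

text \<open>The closure of a finite relation is exhausted by its powers up to its cardinality, here
  at most the number of pairs of literals.\<close>

lemma reach_all: "reach x (lits x * lits x) = (impl_rel x)\<^sup>*"
proof -
  have fin: "finite (impl_rel x)" by (rule finite_subset[OF impl_rel_bounded]) auto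
  have "card (impl_rel x) \<le> card ({..<lits x} \<times> {..<lits x})"
    by (rule card_mono[OF _ impl_rel_bounded]) auto
  then have c: "card (impl_rel x) \<le> lits x * lits x" by simp
  show ?thesis
  proof
    show "reach x (lits x * lits x) \<subseteq> (impl_rel x)\<^sup>*"
      by (auto simp: reach_def relpow_imp_rtrancl)
    show "(impl_rel x)\<^sup>* \<subseteq> reach x (lits x * lits x)"
      unfolding rtrancl_finite_eq_relpow[OF fin] reach_def using order_trans[OF _ c] by blast
  qed
qed

lemma cell_decode:
  assumes "a < N" "b < N"
  shows "cell N d a b mod N = b" "cell N d a b div N mod N = a" "cell N d a b div N div N = d"
  using assms by (auto simp: cell_def)

text \<open>Induction in the order of filling: an entry refers only to the preceding layer, whose
  cells have smaller numbers. Without vertices the digits of a cell are meaningless, hence the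
  disjunct \<open>lits x = 0\<close>.\<close>

lemma fill_reach:
  assumes "c < n"
  shows "fill (\<lambda>w \<rho>. reach_cell (fst w) (snd w) (get \<rho> 0)) x n (int c) =
    of_bool ((c div lits x mod lits x, c mod lits x) \<in> reach x (c div lits x div lits x)) \<or> lits x = 0"
  using assms
proof (induction n arbitrary: c)
  case (Suc n)
  let ?F = "\<lambda>w \<rho>. reach_cell (fst w) (snd w) (get \<rho> 0)"
  let ?N = "lits x"
  let ?d = "c div ?N div ?N" and ?a = "c div ?N mod ?N" and ?b = "c mod ?N"
  show ?case
  proof (cases "c = n \<and> ?N \<noteq> 0")
    case True
    have a: "?a < ?N" "?b < ?N" using True by auto
    define Y where "Y = fill ?F x n"
    have "fill ?F x (Suc n) (int c) = min 2 (reach_cell x Y c)"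
      using True by (simp add: Y_def)
    also have "reach_cell x Y c = of_bool ((?a, ?b) \<in> reach x ?d)"
    proof (cases ?d)
      case 0
      then show ?thesis by (simp add: reach_cell_def Let_def reach_def)
    next
      case (Suc d)
      have "Y (int (cell ?N d ?a k)) = 1 \<longleftrightarrow> (?a, k) \<in> reach x d" if "k < ?N" for k
      proof -
        \<comment> \<open>The end of row \<open>?a\<close> in the preceding layer does not exceed
          the beginning of this row in the present layer.\<close>
        have "cell ?N d ?a k < cell ?N ?d ?a ?b"
        proof -
          have "cell ?N d ?a k < cell ?N d ?a 0 + ?N" using that by (simp add: cell_def)
          also have "\<dots> = (d * ?N + ?a + 1) * ?N" by (simp add: cell_def algebra_simps)
          also have "\<dots> \<le> (?d * ?N + ?a) * ?N" using True Suc by (intro mult_le_mono1) auto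
          finally show ?thesis unfolding cell_def[of ?N ?d ?a ?b] by (rule trans_less_add1)
        qed
        also have "cell ?N ?d ?a ?b = n"
          using True by (simp add: cell_def)
        finally show ?thesis
          using Suc.IH[of "cell ?N d ?a k"] True cell_decode[OF a(1) that] by (auto simp: Y_def)
      qed
      then show ?thesis
        unfolding reach_cell_def Let_def Suc reach_Suc[OF a(1)] by auto
    qed
    finally show ?thesis by simp
  next
    case False
    with Suc.prems have "c < n \<or> ?N = 0" by auto
    with Suc.IH[of c] show ?thesis by auto
  qed
qed simp

lemma def_fun_neg: "def_fun F \<Longrightarrow> def_fun (\<lambda>w \<rho>. neg (F w \<rho>))"
  unfolding neg_def by (intro def_intros)

lemma def_fun_lits: "def_fun (\<lambda>w \<rho>. lits (fst w))"
  unfolding lits_def by (intro def_intros def_fun_order_of)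

lemma def_pred_implies:
  "def_fun F \<Longrightarrow> def_fun G \<Longrightarrow> def_pred (\<lambda>w \<rho>. implies (fst w) (F w \<rho>) (G w \<rho>))"
  unfolding implies_def lit_color_def
  by (intro def_intros def_fun_neg def_fun_lits def_pred_adj def_fun_deg)

theorem labeling_by_degree_2_poly_time:
  "poly_time_decidable (graph_problem (\<lambda>G. True) (has_labeling_by_degree 2))"
proof -
  \<comment> \<open>Layers 0 to N * N with N * N cells each, where N, twice the number of vertices,
    counts the literals.\<close>
  let ?D = "\<lambda>L. (2 * order_of L * (2 * order_of L) + 1) * (2 * order_of L) * (2 * order_of L)"
  let ?E = "\<lambda>w \<rho>. reach_cell (fst w) (snd w) (get \<rho> 0)"
  let ?P = "\<lambda>w \<rho>. \<forall>a<lits (fst w).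
     \<not> (snd w (int (cell (lits (fst w)) (lits (fst w) * lits (fst w)) a (neg a))) = 1 \<and>
        snd w (int (cell (lits (fst w)) (lits (fst w) * lits (fst w)) (neg a) a)) = 1)"
  have iff: "?P (x, fill ?E x (?D (length x))) \<rho> \<longleftrightarrow> has_labeling_by_degree 2 G"
    if "input_graph G" "x = encode G" for x \<rho> G
  proof -
    let ?N = "lits x"
    have D: "?D (length x) = (?N * ?N + 1) * ?N * ?N" by (simp add: lits_def)
    have cell: "fill ?E x (?D (length x)) (int (cell ?N (?N * ?N) a b)) = 1 \<longleftrightarrow> (a, b) \<in> (impl_rel x)\<^sup>*"
      if "a < ?N" "b < ?N" for a b
    proof -
      have "cell ?N (?N * ?N) a b < (?N * ?N * ?N + a + 1) * ?N"
        using that by (simp add: cell_def algebra_simps)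
      also have "\<dots> \<le> (?N * ?N * ?N + ?N) * ?N"
        using that by (intro mult_le_mono1) auto
      also have "\<dots> = ?D (length x)" unfolding D by (simp add: algebra_simps)
      finally have "cell ?N (?N * ?N) a b < ?D (length x)" .
      from fill_reach[OF this, of x] show ?thesis
        using that cell_decode[OF that, of "?N * ?N"] by (auto simp: reach_all)
    qed
    show ?thesis
      unfolding labeling_iff_consistent[OF that(1)] that(2)[symmetric] fst_conv snd_conv
      using cell neg_less[of _ "order_of (length x)"] by (simp add: lits_def)
  qed
  show ?thesis
  proof (rule poly_time_decidableI[where D = ?D and E = ?E and P = ?P])
    show "def_fun (\<lambda>w \<rho>. ?D (length (fst w)))"
      by (intro def_intros def_fun_order_of)
    show "def_fun ?E"
      unfolding reach_cell_def Let_def cell_def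
      by (intro def_intros def_fun_lits def_pred_implies)
    show "def_pred ?P"
      unfolding cell_def by (intro def_intros def_fun_lits def_fun_neg)
    show "?P (x, fill ?E x (?D (length x))) []"
      if x: "x \<in> fst (graph_problem (\<lambda>G. True) (has_labeling_by_degree 2))" for x
    proof -
      obtain G where G: "input_graph G" "x = encode G" "has_labeling_by_degree 2 G"
        using x by (auto simp: graph_problem_def)
      show ?thesis using iff[OF G(1,2)] G(3) by blast
    qed
    show "\<not> ?P (x, fill ?E x (?D (length x))) []"
      if x: "x \<in> snd (graph_problem (\<lambda>G. True) (has_labeling_by_degree 2))" for x
    proof -
      obtain G where G: "input_graph G" "x = encode G" "\<not> has_labeling_by_degree 2 G"
        using x by (auto simp: graph_problem_def)
      show ?thesis using iff[OF G(1,2)] G(3) by blast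
    qed
  qed
qed

section \<open>Padding all degrees\<close>

definition rel_graph :: "nat \<Rightarrow> (nat \<Rightarrow> nat \<Rightarrow> bool) \<Rightarrow> nat graph" where
  "rel_graph n E = ({..<n}, {{u, v} |u v. u < n \<and> v < n \<and> u \<noteq> v \<and> E u v})"

lemma fst_rel_graph [simp]: "fst (rel_graph n E) = {..<n}"
  by (simp add: rel_graph_def)

lemma rel_graph_edge:
  assumes "\<And>u v. E u v \<Longrightarrow> E v u"
  shows "{u, v} \<in> snd (rel_graph n E) \<longleftrightarrow> u < n \<and> v < n \<and> u \<noteq> v \<and> E u v"
  using assms by (auto simp: rel_graph_def doubleton_eq_iff)

lemma input_graph_rel_graph: "input_graph (rel_graph n E)"
  by (auto simp: input_graph_def simple_graph_def rel_graph_def)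

text \<open>Vertex \<open>v\<close> of the given graph becomes \<open>v * Suc N\<close>. If \<open>v \<noteq> w\<close>, it gets a pendant neighbour
  \<open>v * Suc N + Suc u\<close> for every non-neighbour \<open>u\<close>, so that its degree is exactly \<open>N\<close>. The vertices
  \<open>v * Suc N + Suc u\<close> for neighbours \<open>u\<close> remain isolated.\<close>

definition pad :: "nat \<Rightarrow> nat \<Rightarrow> (nat \<Rightarrow> nat \<Rightarrow> bool) \<Rightarrow> nat \<Rightarrow> nat \<Rightarrow> bool" where
  "pad N w E z z' \<longleftrightarrow>
     (z mod Suc N = 0 \<and> z' mod Suc N = 0 \<and> E (z div Suc N) (z' div Suc N)) \<or>
     (z div Suc N = z' div Suc N \<and> z div Suc N \<noteq> w \<and>
       (z mod Suc N = 0 \<and> z' mod Suc N \<noteq> 0 \<and> \<not> E (z div Suc N) (z' mod Suc N - 1) \<or>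
        z' mod Suc N = 0 \<and> z mod Suc N \<noteq> 0 \<and> \<not> E (z div Suc N) (z mod Suc N - 1)))"

text \<open>\<open>k\<close> is both the number of labels and the degree of the exempted vertex
  \<open>w\<close>; \<open>N\<close> is both the number of vertices before padding and the degree
  given to all of them except \<open>w\<close>.\<close>

locale padded =
  fixes N w k :: nat and E :: "nat \<Rightarrow> nat \<Rightarrow> bool"
  assumes E_sym: "E u v \<Longrightarrow> E v u" and E_irrefl: "\<not> E u u"
    and w: "w < N" and deg_w: "card {u. u < N \<and> E w u} = k" and k: "1 \<le> k" "k < N"
begin

definition tot :: nat where
  "tot = N * Suc N"

definition vtx :: "nat \<Rightarrow> nat \<Rightarrow> nat" where
  "vtx v s = v * Suc N + s"

abbreviation G :: "nat graph" where
  "G \<equiv> rel_graph (tot) (pad N w E)"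

lemma at_decode:
  assumes "s \<le> N"
  shows "vtx v s div Suc N = v" "vtx v s mod Suc N = s"
  using assms by (simp_all add: vtx_def div_mult_self3 del: mult_Suc_right)

lemma at_less: "v < N \<Longrightarrow> s \<le> N \<Longrightarrow> vtx v s < tot"
proof -
  assume "v < N" "s \<le> N"
  then have "vtx v s < Suc v * Suc N" by (simp add: vtx_def)
  also have "\<dots> \<le> tot" unfolding tot_def using \<open>v < N\<close> by (intro mult_le_mono1) simp
  finally show ?thesis .
qed

lemma at_cases:
  assumes "z < tot"
  obtains v s where "z = vtx v s" "v < N" "s \<le> N"
proof
  show "z = vtx (z div Suc N) (z mod Suc N)" by (simp add: vtx_def del: mult_Suc_right)
  show "z div Suc N < N" using assms by (simp add: tot_def less_mult_imp_div_less del: mult_Suc_right)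
  show "z mod Suc N \<le> N" using mod_less_divisor[of "Suc N" z] by linarith
qed

lemma pad_at:
  assumes "s \<le> N" "s' \<le> N"
  shows "pad N w E (vtx v s) (vtx v' s') \<longleftrightarrow> (s = 0 \<and> s' = 0 \<and> E v v') \<or>
    (v = v' \<and> v \<noteq> w \<and> (s = 0 \<and> s' \<noteq> 0 \<and> \<not> E v (s' - 1) \<or> s' = 0 \<and> s \<noteq> 0 \<and> \<not> E v (s - 1)))"
  unfolding pad_def at_decode[OF assms(1)] at_decode[OF assms(2)] ..

lemma pad_sym: "pad N w E z z' \<Longrightarrow> pad N w E z' z"
  unfolding pad_def using E_sym by metis

lemma pad_irrefl: "\<not> pad N w E z z"
  unfolding pad_def using E_irrefl by auto

lemma edge_G: "{z, z'} \<in> snd G \<longleftrightarrow> z < tot \<and> z' < tot \<and> pad N w E z z'"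
  using rel_graph_edge[of "pad N w E" z z' tot] pad_sym pad_irrefl by blast

lemma degree_G: "z < tot \<Longrightarrow> vertex_degree G z = card {z'. z' < tot \<and> pad N w E z z'}"
  using vertex_degree_eq[of G z] input_graph_rel_graph[of "tot" "pad N w E"]
  by (simp add: input_graph_def edge_G)

lemma inj_at: "s \<le> N \<Longrightarrow> s' \<le> N \<Longrightarrow> vtx v s = vtx v' s' \<longleftrightarrow> v = v' \<and> s = s'"
  using at_decode by metis

text \<open>Each \<open>u < N\<close> contributes exactly one neighbour: its own vertex if it is
  adjacent to \<open>v\<close>, otherwise the pendant vertex numbered by \<open>u\<close>;
  \<open>u = v\<close> belongs to the second case.\<close>

lemma degree_core:
  assumes "v < N" "v \<noteq> w"
  shows "vertex_degree G (vtx v 0) = N"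
proof -
  let ?A = "(\<lambda>u. vtx u 0) ` {u. u < N \<and> E v u}" and ?B = "(\<lambda>u. vtx v (Suc u)) ` {u. u < N \<and> \<not> E v u}"
  have "{z'. z' < tot \<and> pad N w E (vtx v 0) z'} = ?A \<union> ?B"
  proof (intro set_eqI iffI)
    fix z' assume "z' \<in> {z'. z' < tot \<and> pad N w E (vtx v 0) z'}"
    then have z': "z' < tot" "pad N w E (vtx v 0) z'" by auto
    from z'(1) obtain u s where u: "z' = vtx u s" "u < N" "s \<le> N" by (rule at_cases)
    show "z' \<in> ?A \<union> ?B"
      using z'(2) u unfolding u(1) pad_at[OF le0 u(3)]
      by (cases s) auto
  next
    fix z' assume "z' \<in> ?A \<union> ?B"
    then show "z' \<in> {z'. z' < tot \<and> pad N w E (vtx v 0) z'}"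
      using assms by (auto simp: pad_at at_less)
  qed
  moreover have "?A \<inter> ?B = {}" by (auto simp: inj_at)
  moreover have "card ?A = card {u. u < N \<and> E v u}"
    by (intro card_image inj_onI) (auto simp: inj_at)
  moreover have "card ?B = card {u. u < N \<and> \<not> E v u}"
    by (intro card_image inj_onI) (auto simp: inj_at)
  moreover have "card {u. u < N \<and> E v u} + card {u. u < N \<and> \<not> E v u} = N"
  proof -
    have "card ({u. u < N \<and> E v u} \<union> {u. u < N \<and> \<not> E v u}) =
        card {u. u < N \<and> E v u} + card {u. u < N \<and> \<not> E v u}"
      by (intro card_Un_disjoint) auto
    moreover have "{u. u < N \<and> E v u} \<union> {u. u < N \<and> \<not> E v u} = {..<N}" by auto
    ultimately show ?thesis by simp
  qed
  ultimately show ?thesis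
    using assms by (simp add: degree_G at_less card_Un_disjoint)
qed

lemma degree_w: "vertex_degree G (vtx w 0) = k"
proof -
  have "{z'. z' < tot \<and> pad N w E (vtx w 0) z'} = (\<lambda>u. vtx u 0) ` {u. u < N \<and> E w u}"
  proof (intro set_eqI iffI)
    fix z' assume "z' \<in> {z'. z' < tot \<and> pad N w E (vtx w 0) z'}"
    then have z': "z' < tot" "pad N w E (vtx w 0) z'" by auto
    from z'(1) obtain u s where u: "z' = vtx u s" "u < N" "s \<le> N" by (rule at_cases)
    show "z' \<in> (\<lambda>u. vtx u 0) ` {u. u < N \<and> E w u}"
      using z'(2) u unfolding u(1) pad_at[OF le0 u(3)] by auto
  next
    fix z' assume "z' \<in> (\<lambda>u. vtx u 0) ` {u. u < N \<and> E w u}"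
    then show "z' \<in> {z'. z' < tot \<and> pad N w E (vtx w 0) z'}"
      by (auto simp: pad_at at_less)
  qed
  moreover have "card ((\<lambda>u. vtx u 0) ` {u. u < N \<and> E w u}) = card {u. u < N \<and> E w u}"
    by (intro card_image inj_onI) (auto simp: inj_at)
  ultimately show ?thesis using w deg_w by (simp add: degree_G at_less)
qed

lemma degree_pendant:
  assumes "v < N" "v \<noteq> w" "s < N" "\<not> E v s"
  shows "vertex_degree G (vtx v (Suc s)) = 1"
proof -
  have "{z'. z' < tot \<and> pad N w E (vtx v (Suc s)) z'} = {vtx v 0}"
  proof (intro set_eqI iffI)
    fix z' assume "z' \<in> {z'. z' < tot \<and> pad N w E (vtx v (Suc s)) z'}"
    then have z': "z' < tot" "pad N w E (vtx v (Suc s)) z'" by auto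
    from z'(1) obtain u r where u: "z' = vtx u r" "u < N" "r \<le> N" by (rule at_cases)
    show "z' \<in> {vtx v 0}"
      using z'(2) assms unfolding u(1) pad_at[OF Suc_leI[OF assms(3)] u(3)] by auto
  next
    fix z' assume "z' \<in> {vtx v 0}"
    then show "z' \<in> {z'. z' < tot \<and> pad N w E (vtx v (Suc s)) z'}"
      using assms by (auto simp: pad_at at_less)
  qed
  then show ?thesis using assms by (simp add: degree_G at_less)
qed

lemma proper_G:
  "proper_coloring G c \<longleftrightarrow>
    (\<forall>u<N. \<forall>v<N. E u v \<longrightarrow> c (vtx u 0) \<noteq> c (vtx v 0)) \<and>
    (\<forall>v<N. \<forall>s<N. v \<noteq> w \<longrightarrow> \<not> E v s \<longrightarrow> c (vtx v 0) \<noteq> c (vtx v (Suc s)))"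
  (is "?L \<longleftrightarrow> ?R")
proof
  assume L: ?L
  show ?R
  proof (intro conjI allI impI)
    show "c (vtx u 0) \<noteq> c (vtx v 0)" if "u < N" "v < N" "E u v" for u v
      using L that unfolding proper_coloring_def edge_G by (simp add: pad_at at_less)
    show "c (vtx v 0) \<noteq> c (vtx v (Suc s))" if "v < N" "s < N" "v \<noteq> w" "\<not> E v s" for v s
      using L that unfolding proper_coloring_def edge_G by (simp add: pad_at at_less)
  qed
next
  assume R: ?R
  show ?L
    unfolding proper_coloring_def edge_G
  proof (intro allI impI)
    fix z z' assume "z < tot \<and> z' < tot \<and> pad N w E z z'"
    then have z: "z < tot" "z' < tot" "pad N w E z z'" by auto
    obtain v s where v: "z = vtx v s" "v < N" "s \<le> N" using z(1) by (rule at_cases)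
    obtain v' s' where v': "z' = vtx v' s'" "v' < N" "s' \<le> N" using z(2) by (rule at_cases)
    from z(3)[unfolded v(1) v'(1) pad_at[OF v(3) v'(3)]]
    consider "s = 0" "s' = 0" "E v v'"
      | "v = v'" "v \<noteq> w" "s = 0" "s' \<noteq> 0" "\<not> E v (s' - 1)"
      | "v = v'" "v \<noteq> w" "s' = 0" "s \<noteq> 0" "\<not> E v (s - 1)" by blast
    then show "c z \<noteq> c z'"
    proof cases
      case 1
      then show ?thesis using R v v' by auto
    next
      case 2
      then obtain r where "s' = Suc r" by (cases s') auto
      then show ?thesis using R v v' 2 by auto
    next
      case 3
      then obtain r where "s = Suc r" by (cases s) auto
      then have "c (vtx v 0) \<noteq> c (vtx v (Suc r))" using R v v' 3 by auto
      then show ?thesis using v v' 3 \<open>s = Suc r\<close> by simp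
    qed
  qed
qed

text \<open>Between padded vertices the common factor \<open>N\<close> cancels. All other edges are
  free: with label 1 the vertex \<open>w\<close> has product \<open>k\<close> and a pendant vertex
  has product 1, while the products at padded vertices are at least \<open>N\<close>, which exceeds
  \<open>k\<close>.\<close>

lemma has_labeling_iff:
  "has_labeling_by_degree k G \<longleftrightarrow>
    (\<exists>c. (\<forall>v<N. c v < k) \<and> (\<forall>u<N. \<forall>v<N. u \<noteq> w \<longrightarrow> v \<noteq> w \<longrightarrow> E u v \<longrightarrow> c u \<noteq> c v))"
proof
  assume "has_labeling_by_degree k G"
  then obtain f where f: "f ` {..<tot} \<subseteq> {1..k}" "proper_coloring G (\<lambda>v. f v * vertex_degree G v)"
    unfolding has_labeling_by_degree_def labeling_by_degree_def by auto
  have r: "f (vtx v 0) \<in> {1..k}" if "v < N" for v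
    using f(1) at_less[OF that le0] by blast
  define c where "c v = f (vtx v 0) - 1" for v
  have "c u \<noteq> c v" if "u < N" "v < N" "u \<noteq> w" "v \<noteq> w" "E u v" for u v
  proof -
    have "f (vtx u 0) * N \<noteq> f (vtx v 0) * N"
      using f(2)[unfolded proper_G] that degree_core by metis
    then show ?thesis using r[OF that(1)] r[OF that(2)] by (auto simp: c_def)
  qed
  moreover have "c v < k" if "v < N" for v
    using r[OF that] by (auto simp: c_def)
  ultimately show "\<exists>c. (\<forall>v<N. c v < k) \<and>
      (\<forall>u<N. \<forall>v<N. u \<noteq> w \<longrightarrow> v \<noteq> w \<longrightarrow> E u v \<longrightarrow> c u \<noteq> c v)"
    by blast
next
  assume "\<exists>c. (\<forall>v<N. c v < k) \<and> (\<forall>u<N. \<forall>v<N. u \<noteq> w \<longrightarrow> v \<noteq> w \<longrightarrow> E u v \<longrightarrow> c u \<noteq> c v)"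
  then obtain c where c: "\<And>v. v < N \<Longrightarrow> c v < k"
    "\<And>u v. u < N \<Longrightarrow> v < N \<Longrightarrow> u \<noteq> w \<Longrightarrow> v \<noteq> w \<Longrightarrow> E u v \<Longrightarrow> c u \<noteq> c v" by blast
  define f where "f z = (if z mod Suc N = 0 \<and> z div Suc N \<noteq> w then c (z div Suc N) + 1 else 1)" for z
  have f_core: "f (vtx v 0) = c v + 1" if "v \<noteq> w" for v
    using that by (simp add: f_def at_decode)
  have f_w: "f (vtx w 0) = 1" by (simp add: f_def at_decode)
  have f_pend: "f (vtx v (Suc s)) = 1" if "s < N" for v s
    using that at_decode[of "Suc s" v] by (simp add: f_def)
  have big: "k < f (vtx v 0) * vertex_degree G (vtx v 0)" if "v < N" "v \<noteq> w" for v
    using that k by (simp add: f_core degree_core)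
  have "f z \<in> {1..k}" if "z < tot" for z
    using that c(1)[of "z div Suc N"] k(1)
    by (auto simp: f_def tot_def less_mult_imp_div_less Suc_le_eq simp del: mult_Suc_right)
  moreover have "proper_coloring G (\<lambda>v. f v * vertex_degree G v)"
    unfolding proper_G
  proof (intro conjI allI impI)
    fix u v assume uv: "u < N" "v < N" "E u v"
    then have "u \<noteq> v" using E_irrefl by blast
    show "f (vtx u 0) * vertex_degree G (vtx u 0) \<noteq> f (vtx v 0) * vertex_degree G (vtx v 0)"
    proof (cases "u = w \<or> v = w")
      case True
      then show ?thesis
        using big[of u] big[of v] uv \<open>u \<noteq> v\<close> by (auto simp: f_w degree_w)
    next
      case False
      then show ?thesis using c(2) uv k(2) by (simp add: f_core degree_core)
    qed
  next
    fix v s assume vs: "v < N" "s < N" "v \<noteq> w" "\<not> E v s"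
    then show "f (vtx v 0) * vertex_degree G (vtx v 0) \<noteq> f (vtx v (Suc s)) * vertex_degree G (vtx v (Suc s))"
      using big[of v] k(1) by (auto simp: f_pend degree_pendant)
  qed
  ultimately show "has_labeling_by_degree k G"
    unfolding has_labeling_by_degree_def labeling_by_degree_def by (intro exI[of _ f]) auto
qed

lemma chromatic_number_G:
  assumes c: "\<And>v. v < N \<Longrightarrow> c v < k + 1" "\<And>u v. u < N \<Longrightarrow> v < N \<Longrightarrow> E u v \<Longrightarrow> c u \<noteq> (c v :: nat)"
    and K: "K \<subseteq> {..<N}" "card K = k + 1" "\<And>u v. u \<in> K \<Longrightarrow> v \<in> K \<Longrightarrow> u \<noteq> v \<Longrightarrow> E u v"
  shows "chromatic_number G = k + 1"
  unfolding chromatic_number_def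
proof (rule Least_equality)
  \<comment> \<open>A pendant vertex takes 0, or 1 if its neighbour has 0; two colours are available
    because \<open>k\<close> is positive.\<close>
  define d where "d z = (if z mod Suc N = 0 then c (z div Suc N)
    else if c (z div Suc N) = 0 then 1 else 0)" for z
  have "d z < k + 1" if "z < tot" for z
    using that c(1)[of "z div Suc N"] k(1)
    by (auto simp: d_def tot_def less_mult_imp_div_less simp del: mult_Suc_right)
  moreover have "proper_coloring G d"
    unfolding proper_G
  proof (intro conjI allI impI)
    fix v s assume "v < N" "s < N" "v \<noteq> w" "\<not> E v s"
    then show "d (vtx v 0) \<noteq> d (vtx v (Suc s))"
      using at_decode[of "Suc s" v] by (simp add: d_def at_decode)
  qed (use c in \<open>simp add: d_def at_decode\<close>)
  ultimately show "\<exists>c :: nat \<Rightarrow> nat. proper_coloring G c \<and> c ` fst G \<subseteq> {..<k + 1}"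
    by (intro exI[of _ d]) auto
next
  fix j assume "\<exists>c :: nat \<Rightarrow> nat. proper_coloring G c \<and> c ` fst G \<subseteq> {..<j}"
  then obtain d :: "nat \<Rightarrow> nat" where d: "proper_coloring G d" "d ` {..<tot} \<subseteq> {..<j}" by auto
  have "inj_on (\<lambda>v. d (vtx v 0)) K"
  proof (rule inj_onI, rule ccontr)
    fix u v assume uv: "u \<in> K" "v \<in> K" "d (vtx u 0) = d (vtx v 0)" "u \<noteq> v"
    then have "u < N" "v < N" "E u v" using K by auto
    with d(1)[unfolded proper_G] uv(3) show False by blast
  qed
  moreover have "(\<lambda>v. d (vtx v 0)) ` K \<subseteq> {..<j}"
    using d(2) K(1) at_less[OF _ le0] by blast
  ultimately have "card K \<le> card {..<j}" by (intro card_inj_on_le) auto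
  then show "k + 1 \<le> j" using K(2) by simp
qed

end

section \<open>From Horn systems with exclusive pairs to colorings\<close>

definition solution ::
  "nat \<Rightarrow> (nat \<Rightarrow> bool) \<Rightarrow> (nat \<Rightarrow> bool) \<Rightarrow> (nat \<Rightarrow> nat \<Rightarrow> bool) \<Rightarrow> (nat \<Rightarrow> nat \<Rightarrow> nat \<Rightarrow> bool) \<Rightarrow> nat set \<Rightarrow> bool"
  where
  "solution V In No Pr Rl A \<longleftrightarrow>
     (\<forall>a<V. In a \<longrightarrow> a \<in> A) \<and> (\<forall>a<V. No a \<longrightarrow> a \<notin> A) \<and>
     (\<forall>a<V. \<forall>b<V. Pr a b \<longrightarrow> (a \<in> A) \<noteq> (b \<in> A)) \<and>
     (\<forall>a<V. \<forall>b<V. \<forall>c<V. Rl a b c \<longrightarrow> a \<in> A \<longrightarrow> b \<in> A \<longrightarrow> c \<in> A)"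

text \<open>A node is a kind together with three numbers. Kind 0: the fact \<open>a\<close>, coloured like palette vertex 1
  if true and like palette vertex 0 if false. Kind 1: the palette vertex \<open>a\<close>. Kind 2: the apex, joined to
  the whole palette. Kinds 3 to 7: the gadget of the rule \<open>a \<and> b \<longrightarrow> c\<close>; kinds 3, 4, 5 form a triangle which
  forces 5 to be coloured true if \<open>a\<close> and \<open>b\<close> are, and the path 5, 6, 7 passes this on to \<open>c\<close>.\<close>

definition gadget_edge ::
  "nat \<Rightarrow> (nat \<Rightarrow> bool) \<Rightarrow> (nat \<Rightarrow> bool) \<Rightarrow> (nat \<Rightarrow> nat \<Rightarrow> bool) \<Rightarrow> (nat \<Rightarrow> nat \<Rightarrow> nat \<Rightarrow> bool) \<Rightarrow>
   nat \<Rightarrow> nat \<Rightarrow> nat \<Rightarrow> nat \<Rightarrow> nat \<Rightarrow> nat \<Rightarrow> nat \<Rightarrow> nat \<Rightarrow> bool" where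
  "gadget_edge k In No Pr Rl i a b c i' a' b' c' \<longleftrightarrow>
     i = 1 \<and> i' = 1 \<and> a < a' \<and> a' < k \<and> b = 0 \<and> c = 0 \<and> b' = 0 \<and> c' = 0 \<or>
     i = 2 \<and> i' = 1 \<and> a = 0 \<and> a' < k \<and> b = 0 \<and> c = 0 \<and> b' = 0 \<and> c' = 0 \<or>
     i = 0 \<and> i' = 1 \<and> a' < k \<and> b = 0 \<and> c = 0 \<and> b' = 0 \<and> c' = 0 \<and>
       (2 \<le> a' \<or> a' = 0 \<and> In a \<or> a' = 1 \<and> No a) \<or>
     i = 0 \<and> i' = 0 \<and> b = 0 \<and> c = 0 \<and> b' = 0 \<and> c' = 0 \<and> Pr a a' \<or>
     i \<in> {3, 4, 5, 6, 7} \<and> i' = 1 \<and> a' < k \<and> b' = 0 \<and> c' = 0 \<and> Rl a b c \<and>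
       (3 \<le> a' \<or> i = 6 \<and> a' = 0 \<or> i = 7 \<and> a' = 1) \<or>
     i' = 0 \<and> b' = 0 \<and> c' = 0 \<and> Rl a b c \<and> (i = 3 \<and> a' = a \<or> i = 4 \<and> a' = b \<or> i = 7 \<and> a' = c) \<or>
     a' = a \<and> b' = b \<and> c' = c \<and> Rl a b c \<and>
       (i = 3 \<and> i' = 4 \<or> i = 3 \<and> i' = 5 \<or> i = 4 \<and> i' = 5 \<or> i = 5 \<and> i' = 6 \<or> i = 6 \<and> i' = 7)"

definition node_edge ::
  "nat \<Rightarrow> nat \<Rightarrow> (nat \<Rightarrow> bool) \<Rightarrow> (nat \<Rightarrow> bool) \<Rightarrow> (nat \<Rightarrow> nat \<Rightarrow> bool) \<Rightarrow> (nat \<Rightarrow> nat \<Rightarrow> nat \<Rightarrow> bool) \<Rightarrow>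
   nat \<Rightarrow> nat \<Rightarrow> bool" where
  "node_edge k V In No Pr Rl z z' \<longleftrightarrow> gadget_edge k In No Pr Rl
     (z div V div V div V) (z div V div V mod V) (z div V mod V) (z mod V)
     (z' div V div V div V) (z' div V div V mod V) (z' div V mod V) (z' mod V)"

definition node_rel ::
  "nat \<Rightarrow> nat \<Rightarrow> (nat \<Rightarrow> bool) \<Rightarrow> (nat \<Rightarrow> bool) \<Rightarrow> (nat \<Rightarrow> nat \<Rightarrow> bool) \<Rightarrow> (nat \<Rightarrow> nat \<Rightarrow> nat \<Rightarrow> bool) \<Rightarrow>
   nat \<Rightarrow> nat \<Rightarrow> bool" where
  "node_rel k V In No Pr Rl z z' \<longleftrightarrow> node_edge k V In No Pr Rl z z' \<or> node_edge k V In No Pr Rl z' z"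

text \<open>\<open>Fst\<close> is one side of the bipartite graph of pairs, which excludes loops and
  yields the \<open>(k + 1)\<close>-coloring: its facts get colour 0, all others \<open>k\<close>.
  Initial facts are adjacent to palette vertex 0 and must lie on the other side.
  \<open>k < V\<close> lets palette numbers be digits of a node.\<close>

locale horn_system =
  fixes k V :: nat and In No :: "nat \<Rightarrow> bool" and Pr :: "nat \<Rightarrow> nat \<Rightarrow> bool"
    and Rl :: "nat \<Rightarrow> nat \<Rightarrow> nat \<Rightarrow> bool" and Fst :: "nat set"
  assumes kV: "3 \<le> k" "k < V"
    and Fst: "\<And>a b. Pr a b \<Longrightarrow> (a \<in> Fst) \<noteq> (b \<in> Fst)" "\<And>a. In a \<Longrightarrow> a \<notin> Fst"
begin

definition N :: nat where
  "N = 8 * V * V * V"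

definition node :: "nat \<Rightarrow> nat \<Rightarrow> nat \<Rightarrow> nat \<Rightarrow> nat" where
  "node i a b c = ((i * V + a) * V + b) * V + c"

abbreviation apex :: nat where
  "apex \<equiv> 2 * V * V * V"

abbreviation E :: "nat \<Rightarrow> nat \<Rightarrow> bool" where
  "E \<equiv> node_rel k V In No Pr Rl"

abbreviation edge :: "nat \<Rightarrow> nat \<Rightarrow> nat \<Rightarrow> nat \<Rightarrow> nat \<Rightarrow> nat \<Rightarrow> nat \<Rightarrow> nat \<Rightarrow> bool" where
  "edge \<equiv> gadget_edge k In No Pr Rl"

lemma apex: "apex = node 2 0 0 0"
  by (simp add: node_def)

lemma node_decode:
  assumes "a < V" "b < V" "c < V"
  shows "node i a b c mod V = c" "node i a b c div V mod V = b" "node i a b c div V div V mod V = a"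
    "node i a b c div V div V div V = i"
  using assms by (simp_all add: node_def)

lemma node_less:
  assumes "i < 8" "a < V" "b < V" "c < V"
  shows "node i a b c < N"
proof -
  have *: "m * V + d < n * V" if "m < n" "d < V" for m n d
  proof -
    have "m * V + d < Suc m * V" using that by simp
    also have "\<dots> \<le> n * V" using that by (intro mult_le_mono1) simp
    finally show ?thesis .
  qed
  show ?thesis
    unfolding node_def N_def by (intro * assms)
qed

lemma node_cases:
  assumes "z < N"
  obtains i a b c where "z = node i a b c" "i < 8" "a < V" "b < V" "c < V"
proof
  show "z = node (z div V div V div V) (z div V div V mod V) (z div V mod V) (z mod V)"
    by (simp add: node_def)
  show "z div V div V div V < 8"
    using assms unfolding N_def by (intro less_mult_imp_div_less)
qed (use kV in auto)

lemma node_edge_node: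
  assumes "a < V" "b < V" "c < V" "a' < V" "b' < V" "c' < V"
  shows "node_edge k V In No Pr Rl (node i a b c) (node i' a' b' c') = edge i a b c i' a' b' c'"
  unfolding node_edge_def node_decode[OF assms(1-3)] node_decode[OF assms(4-6)] ..

lemma E_node:
  assumes "a < V" "b < V" "c < V" "a' < V" "b' < V" "c' < V"
  shows "E (node i a b c) (node i' a' b' c') \<longleftrightarrow>
    edge i a b c i' a' b' c' \<or> edge i' a' b' c' i a b c"
  unfolding node_rel_def using node_edge_node assms by simp

lemma edge_irrefl: "\<not> edge i a b c i a b c"
  using Fst(1)[of a a] by (auto simp: gadget_edge_def)

lemma inj_node:
  assumes "a < V" "b < V" "c < V" "a' < V" "b' < V" "c' < V"
  shows "node i a b c = node i' a' b' c' \<longleftrightarrow> i = i' \<and> a = a' \<and> b = b' \<and> c = c'"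
  using node_decode[OF assms(1-3), of i] node_decode[OF assms(4-6), of i'] by metis

sublocale padded N apex k E
proof
  show "E v u" if "E u v" for u v using that by (auto simp: node_rel_def)
  show "\<not> E u u" for u using edge_irrefl by (simp add: node_rel_def node_edge_def)
  show "apex < N" unfolding apex using kV by (intro node_less) auto
  have "{u. u < N \<and> E apex u} = (\<lambda>i. node 1 i 0 0) ` {..<k}"
  proof (intro set_eqI iffI)
    fix u assume "u \<in> {u. u < N \<and> E apex u}"
    then have u: "u < N" "E apex u" by auto
    from u(1) obtain i a b c where n: "u = node i a b c" "i < 8" "a < V" "b < V" "c < V"
      by (rule node_cases)
    have "edge 2 0 0 0 i a b c \<or> edge i a b c 2 0 0 0"
      using u(2) n kV unfolding apex by (subst (asm) n(1)) (subst (asm) E_node; simp)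
    then show "u \<in> (\<lambda>i. node 1 i 0 0) ` {..<k}"
      unfolding n(1) by (auto simp: gadget_edge_def)
  next
    fix u assume "u \<in> (\<lambda>i. node 1 i 0 0) ` {..<k}"
    then obtain i where i: "u = node 1 i 0 0" "i < k" by auto
    moreover have "edge 2 0 0 0 1 i 0 0" using i by (simp add: gadget_edge_def)
    ultimately show "u \<in> {u. u < N \<and> E apex u}"
      unfolding apex using kV by (simp add: E_node node_less)
  qed
  moreover have "card ((\<lambda>i. node 1 i 0 0) ` {..<k}) = k"
    using kV by (subst card_image) (auto intro!: inj_onI simp: inj_node)
  ultimately show "card {u. u < N \<and> E apex u} = k" by simp
  show "1 \<le> k" using kV by simp
  show "k < N" using kV node_less[of 0 0 0 k] by (simp add: node_def)
qed

text \<open>With one more colour \<open>k\<close> all constraints on the facts become vacuous.\<close>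

lemma chromatic_number_G: "chromatic_number G = k + 1"
proof (rule padded.chromatic_number_G[OF padded_axioms])
  \<comment> \<open>Kinds 3 to 7 get the fixed colours 1, 2, 0, 1, 2. Of these only 3, 4 and 7 are
    adjacent to facts, and their colours 1, 2, 2 differ from 0 and \<open>k\<close>.\<close>
  define col where "col i a = (if i = 0 then (if a \<in> Fst then 0 else k) else if i = 1 then a
    else if i = 2 then k else if i = 5 then 0 else if i = 3 \<or> i = 6 then 1 else 2)" for i a :: nat
  have col_simps: "col 0 a = (if a \<in> Fst then 0 else k)" "col (Suc 0) a = a" "col 2 a = k" "col 3 a = 1"
    "col 4 a = 2" "col 5 a = 0" "col 6 a = 1" "col 7 a = 2" for a
    by (simp_all add: col_def)
  have col: "col i a \<noteq> col i' a'" if "edge i a b c i' a' b' c'" for i a b c i' a' b' c'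
  proof (cases "i = 0 \<and> i' = 0")
    case True
    then have "Pr a a'" using that by (simp add: gadget_edge_def)
    then show ?thesis using True Fst(1)[of a a'] kV by (auto simp: col_simps)
  next
    case False
    with that kV show ?thesis
      unfolding gadget_edge_def insert_iff empty_iff by (elim disjE conjE; simp add: col_simps Fst(2))
  qed
  have col_le: "col i a \<le> k \<and> col i' a' \<le> k" if "edge i a b c i' a' b' c'" for i a b c i' a' b' c'
    using that kV unfolding gadget_edge_def insert_iff empty_iff
    by (elim disjE conjE; simp add: col_simps)
  \<comment> \<open>The cap concerns nodes of kind 1 with numbers beyond the palette, which have no
    edges; by \<open>col_le\<close> it changes nothing along an edge.\<close>
  define c where "c z = min k (col (z div V div V div V) (z div V div V mod V))" for z
  show "c v < k + 1" for v by (simp add: c_def)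
  show "c u \<noteq> c v" if "u < N" "v < N" "E u v" for u v
  proof -
    have *: "c z \<noteq> c z'" if "node_edge k V In No Pr Rl z z'" for z z'
    proof -
      let ?i = "\<lambda>z. z div V div V div V" and ?a = "\<lambda>z. z div V div V mod V"
      have e: "edge (?i z) (?a z) (z div V mod V) (z mod V) (?i z') (?a z') (z' div V mod V) (z' mod V)"
        using that by (simp add: node_edge_def)
      show ?thesis using col[OF e] col_le[OF e] by (simp add: c_def min_def)
    qed
    show ?thesis using that(3) *[of u v] *[of v u] by (auto simp: node_rel_def)
  qed
  let ?K = "insert (node 2 0 0 0) ((\<lambda>i. node 1 i 0 0) ` {..<k})"
  show "?K \<subseteq> {..<N}" using kV by (auto intro!: node_less)
  have "card ((\<lambda>i. node 1 i 0 0) ` {..<k}) = k"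
    using kV by (subst card_image) (auto intro!: inj_onI simp: inj_node)
  moreover have "node 2 0 0 0 \<notin> (\<lambda>i. node 1 i 0 0) ` {..<k}"
    using kV by (auto simp: inj_node)
  ultimately show "card ?K = k + 1" by simp
  show "E u v" if "u \<in> ?K" "v \<in> ?K" "u \<noteq> v" for u v
    using that kV by (auto simp: E_node gadget_edge_def) (metis linorder_neqE_nat)
qed

text \<open>The palette is a clique of \<open>k\<close> vertices and so uses all \<open>k\<close>
  colours. Colours can therefore be named \<open>p j\<close> after palette vertices, and avoiding
  all \<open>p j\<close> with \<open>j \<ge> l\<close> leaves the first \<open>l\<close>: two for
  facts, three for gadgets. The facts coloured \<open>p 1\<close> form the solution.\<close>

lemma solution_if_colorable:
  assumes c: "\<And>v. v < N \<Longrightarrow> c v < k"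
    "\<And>u v. u < N \<Longrightarrow> v < N \<Longrightarrow> u \<noteq> apex \<Longrightarrow> v \<noteq> apex \<Longrightarrow> E u v \<Longrightarrow> c u \<noteq> c v"
  shows "\<exists>A. solution V In No Pr Rl A"
proof -
  define col where "col i a b d = c (node i a b d)" for i a b d
  have col_less: "col i a b d < k" if "i < 8" "a < V" "b < V" "d < V" for i a b d
    unfolding col_def using c(1) node_less that by blast
  have col: "col i a b d \<noteq> col i' a' b' d'"
    if "edge i a b d i' a' b' d'" "i < 8" "i' < 8" "i \<noteq> 2" "i' \<noteq> 2"
      "a < V" "b < V" "d < V" "a' < V" "b' < V" "d' < V" for i a b d i' a' b' d'
    unfolding col_def
  proof (rule c(2))
    show "node i a b d \<noteq> apex" "node i' a' b' d' \<noteq> apex"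
      unfolding apex using that kV by (auto simp: inj_node)
    show "E (node i a b d) (node i' a' b' d')" using that by (simp add: E_node)
  qed (use that node_less in auto)
  define p where "p i = col 1 i 0 0" for i
  have "inj_on p {..<k}"
  proof (rule linorder_inj_onI)
    show "p i \<noteq> p j" if "i < j" "i \<in> {..<k}" "j \<in> {..<k}" for i j
      unfolding p_def using that kV by (intro col) (auto simp: gadget_edge_def)
  qed auto
  moreover have "p ` {..<k} \<subseteq> {..<k}" using col_less kV by (auto simp: p_def)
  ultimately have surj: "p ` {..<k} = {..<k}" by (simp add: endo_inj_surj)
  have pal: "\<exists>j<l. col i a b d = p j"
    if "l \<le> k" "\<And>j. l \<le> j \<Longrightarrow> j < k \<Longrightarrow> col i a b d \<noteq> p j" "i < 8" "a < V" "b < V" "d < V" for i a b d l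
  proof -
    have "col i a b d \<in> p ` {..<k}" unfolding surj using col_less that by simp
    then obtain j where "j < k" "col i a b d = p j" by auto
    with that(2)[of j] show ?thesis by (metis not_less)
  qed
  have p01: "p 0 \<noteq> p 1" "p 0 \<noteq> p 2" "p 1 \<noteq> p 2"
    using \<open>inj_on p {..<k}\<close> kV by (auto dest: inj_onD)
  define F where "F a = col 0 a 0 0" for a
  have F: "F a = p 0 \<or> F a = p 1" if "a < V" for a
  proof -
    have "\<exists>j<2. F a = p j"
      unfolding F_def
    proof (rule pal)
      show "col 0 a 0 0 \<noteq> p j" if "2 \<le> j" "j < k" for j
        unfolding p_def using that kV \<open>a < V\<close> by (intro col) (auto simp: gadget_edge_def)
    qed (use that kV in auto)
    then show ?thesis by (auto simp: less_2_cases_iff)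
  qed
  define A where "A = {a. F a = p 1}"
  have "solution V In No Pr Rl A"
    unfolding solution_def
  proof (intro conjI allI impI)
    fix a assume "a < V" "In a"
    then have "F a \<noteq> p 0" unfolding F_def p_def using kV by (intro col) (auto simp: gadget_edge_def)
    then show "a \<in> A" using F \<open>a < V\<close> by (auto simp: A_def)
  next
    fix a assume "a < V" "No a"
    then have "F a \<noteq> p 1" unfolding F_def p_def using kV by (intro col) (auto simp: gadget_edge_def)
    then show "a \<notin> A" by (auto simp: A_def)
  next
    fix a b assume ab: "a < V" "b < V" "Pr a b"
    then have "F a \<noteq> F b" unfolding F_def using kV by (intro col) (auto simp: gadget_edge_def)
    then show "(a \<in> A) \<noteq> (b \<in> A)" using F[OF ab(1)] F[OF ab(2)] by (auto simp: A_def)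
  next
    fix a b d assume lt: "a < V" "b < V" "d < V" and rl: "Rl a b d" and A: "a \<in> A" "b \<in> A"
    let ?g = "\<lambda>i. col i a b d"
    have g: "?g i = p 0 \<or> ?g i = p 1 \<or> ?g i = p 2" if "3 \<le> i" "i < 8" for i
    proof -
      have "\<exists>j<3. ?g i = p j"
      proof (rule pal)
        show "col i a b d \<noteq> p j" if "3 \<le> j" "j < k" for j
          unfolding p_def using that kV rl lt \<open>3 \<le> i\<close> \<open>i < 8\<close> by (intro col) (auto simp: gadget_edge_def)
      qed (use that kV lt in auto)
      then show ?thesis by (auto simp: less_Suc_eq numeral_3_eq_3 numeral_2_eq_2)
    qed
    have ne: "?g 3 \<noteq> ?g 4" "?g 3 \<noteq> ?g 5" "?g 4 \<noteq> ?g 5" "?g 5 \<noteq> ?g 6" "?g 6 \<noteq> ?g 7"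
      by (intro col; use lt rl kV in \<open>simp add: gadget_edge_def\<close>)+
    have nf: "?g 3 \<noteq> F a" "?g 4 \<noteq> F b" "?g 7 \<noteq> F d"
      unfolding F_def by (intro col; use lt rl kV in \<open>simp add: gadget_edge_def\<close>)+
    have np: "?g 6 \<noteq> p 0" "?g 7 \<noteq> p 1"
      unfolding p_def by (intro col; use lt rl kV in \<open>simp add: gadget_edge_def\<close>)+
    have Fab: "F a = p 1" "F b = p 1" using A by (auto simp: A_def)
    \<comment> \<open>Vertices 3 and 4 both avoid \<open>p 1\<close> and hence use up
      \<open>p 0\<close> and \<open>p 2\<close>.\<close>
    have 5: "?g 5 = p 1"
      using g[of 3] g[of 4] g[of 5] ne(1-3) nf(1,2) Fab by auto
    then have 6: "?g 6 = p 2" using g[of 6] ne(4) np(1) by auto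
    then have "?g 7 = p 0" using g[of 7] ne(5) np(2) by auto
    then have "F d = p 1" using F[OF lt(3)] nf(3) by auto
    then show "d \<in> A" by (simp add: A_def)
  qed
  then show ?thesis ..
qed

lemma colorable_if_solution:
  assumes A: "solution V In No Pr Rl A"
  shows "\<exists>c. (\<forall>v<N. c v < k) \<and> (\<forall>u<N. \<forall>v<N. u \<noteq> apex \<longrightarrow> v \<noteq> apex \<longrightarrow> E u v \<longrightarrow> c u \<noteq> c v)"
proof -
  \<comment> \<open>If both premises hold, kinds 3 to 7 get 0, 2, 1, 2, 0, and the 0 at kind 7
    agrees with a true conclusion. Otherwise kinds 5, 6, 7 get 0, 1, 2, and the 2 at kind 7 suits
    either value of the conclusion.\<close>
  define col where "col i a b d =
    (if i = 0 then of_bool (a \<in> A) else if i = 1 then a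
     else if i = 3 then (if a \<in> A then if b \<in> A then 0 else 2 else 1)
     else if i = 4 then (if a \<in> A \<and> b \<notin> A then 1 else 2)
     else if i = 5 then of_bool (a \<in> A \<and> b \<in> A)
     else if i = 6 then (if a \<in> A \<and> b \<in> A then 2 else 1)
     else (if a \<in> A \<and> b \<in> A then 0 else 2))" for i a b d :: nat
  have col_simps: "col 0 a b d = of_bool (a \<in> A)" "col (Suc 0) a b d = a"
    "col 3 a b d = (if a \<in> A then if b \<in> A then 0 else 2 else 1)"
    "col 4 a b d = (if a \<in> A \<and> b \<notin> A then 1 else 2)"
    "col 5 a b d = of_bool (a \<in> A \<and> b \<in> A)"
    "col 6 a b d = (if a \<in> A \<and> b \<in> A then 2 else 1)"
    "col 7 a b d = (if a \<in> A \<and> b \<in> A then 0 else 2)" for a b d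
    by (simp_all add: col_def)
  have col: "col i a b d \<noteq> col i' a' b' d'" if e: "edge i a b d i' a' b' d'" "i \<noteq> 2"
    "a < V" "b < V" "d < V" "a' < V" for i a b d i' a' b' d'
  proof -
    have r: "In a \<Longrightarrow> a \<in> A" "No a \<Longrightarrow> a \<notin> A" "Pr a a' \<Longrightarrow> (a \<in> A) \<noteq> (a' \<in> A)"
      "Rl a b d \<Longrightarrow> a \<in> A \<Longrightarrow> b \<in> A \<Longrightarrow> d \<in> A"
      using A e(3-6) unfolding solution_def by blast+
    show ?thesis
    proof (cases "i = 0 \<and> i' = 0")
      case True
      then have "Pr a a'" using e(1) by (simp add: gadget_edge_def)
      then show ?thesis using True r(3) by (auto simp: col_simps)
    next
      case False
      with e(1,2) show ?thesis
        unfolding gadget_edge_def insert_iff empty_iff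
        by (elim disjE conjE; simp add: col_simps r(1,2,4))
    qed
  qed
  have col_less: "col i a b d < k \<and> col i' a' b' d' < k" if e: "edge i a b d i' a' b' d'" "i \<noteq> 2"
    for i a b d i' a' b' d'
    using e kV(1) unfolding gadget_edge_def insert_iff empty_iff
    by (elim disjE conjE; simp add: col_simps)
  define c where "c z = min (k - 1)
    (col (z div V div V div V) (z div V div V mod V) (z div V mod V) (z mod V))" for z
  have c_node: "c (node i a b d) = min (k - 1) (col i a b d)" if "a < V" "b < V" "d < V" for i a b d
    unfolding c_def node_decode[OF that] ..
  have *: "c (node i a b d) \<noteq> c (node i' a' b' d')"
    if e: "edge i a b d i' a' b' d'" "i \<noteq> 2" and lt: "a < V" "b < V" "d < V" "a' < V" "b' < V" "d' < V"
    for i a b d i' a' b' d'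
    using col[OF e lt(1-4)] col_less[OF e] lt by (simp add: c_node min_def) linarith
  have "c u \<noteq> c v" if uv: "u < N" "v < N" "u \<noteq> apex" "v \<noteq> apex" "E u v" for u v
  proof -
    obtain i a b d where u: "u = node i a b d" "i < 8" "a < V" "b < V" "d < V"
      using uv(1) by (rule node_cases)
    obtain i' a' b' d' where v: "v = node i' a' b' d'" "i' < 8" "a' < V" "b' < V" "d' < V"
      using uv(2) by (rule node_cases)
    have ee: "edge i a b d i' a' b' d' \<or> edge i' a' b' d' i a b d"
      using uv(5) u v by (simp add: E_node)
    moreover have "i \<noteq> 2" "i' \<noteq> 2"
      using ee uv(3,4) unfolding u(1) v(1) apex by (auto simp: gadget_edge_def)
    ultimately show ?thesis
      using *[of i a b d i' a' b' d'] *[of i' a' b' d' i a b d] u v by auto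
  qed
  moreover have "c v < k" for v using kV by (simp add: c_def)
  ultimately show ?thesis by blast
qed

theorem has_labeling_iff_solution:
  "has_labeling_by_degree k G \<longleftrightarrow> (\<exists>A. solution V In No Pr Rl A)"
proof
  assume "has_labeling_by_degree k G"
  then obtain c where "\<And>v. v < N \<Longrightarrow> c v < k"
    "\<And>u v. u < N \<Longrightarrow> v < N \<Longrightarrow> u \<noteq> apex \<Longrightarrow> v \<noteq> apex \<Longrightarrow> E u v \<Longrightarrow> c u \<noteq> c v"
    unfolding has_labeling_iff by auto
  then show "\<exists>A. solution V In No Pr Rl A" by (rule solution_if_colorable)
next
  assume "\<exists>A. solution V In No Pr Rl A"
  then show "has_labeling_by_degree k G"
    unfolding has_labeling_iff using colorable_if_solution by auto
qed

end

section \<open>Computations as Horn systems\<close>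

declare list_encode.simps [simp del] list_encode_eq [simp]

text \<open>Halting states receive idle transitions, so that uniform rules describe all steps up to
  the time bound.\<close>

definition total_delta :: "tm \<Rightarrow> nat \<Rightarrow> nat list \<Rightarrow> nat \<times> (nat \<times> move) list" where
  "total_delta M q ss =
     (if q \<in> {accept M, reject M} then (q, map (\<lambda>a. (a, Stay)) ss) else delta M q ss)"

lemma step_total_delta:
  "step M c = (let r = total_delta M (fst c) (map scan (snd c)) in (fst r, map2 act (snd r) (snd c)))"
proof -
  have "map2 act (map (\<lambda>a. (a, Stay)) (map scan ts)) ts = ts" for ts
    by (rule nth_equalityI) (auto simp: act_def)
  then show ?thesis by (auto simp: step_def total_delta_def Let_def prod_eq_iff)
qed

locale np_run =
  fixes M :: tm and x y :: "bool list"
  assumes wf: "wf_tm M"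
begin

definition q :: "nat \<Rightarrow> nat" where
  "q t = fst (run M [x, y] t)"

definition tp :: "nat \<Rightarrow> nat \<Rightarrow> tape" where
  "tp t j = snd (run M [x, y] t) ! j"

definition ss :: "nat \<Rightarrow> nat list" where
  "ss t = map scan (snd (run M [x, y] t))"

definition rr :: "nat \<Rightarrow> nat \<times> (nat \<times> move) list" where
  "rr t = total_delta M (q t) (ss t)"

lemma two_tapes: "2 \<le> tapes M"
  using wf by (simp add: wf_tm_def)

lemma total_delta_wf:
  assumes "p < states M" "length s = tapes M" "set s \<subseteq> {..<symbols M}"
  shows "fst (total_delta M p s) < states M" "length (snd (total_delta M p s)) = tapes M"
    "fst ` set (snd (total_delta M p s)) \<subseteq> {..<symbols M}"
  using wf assms unfolding wf_tm_def total_delta_def by (auto simp: image_image)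

lemma run_Suc: "run M [x, y] (Suc t) = step M (run M [x, y] t)"
  by (simp add: run_def)

text \<open>A head moves by at most one cell per step; the resulting bound confines \<open>T\<close>
  steps to the tape positions from -T to T.\<close>

lemma run_inv:
  "length (snd (run M [x, y] t)) = tapes M \<and> q t < states M \<and>
    (\<forall>j<tapes M. (\<forall>i. fst (tp t j) i < symbols M) \<and> \<bar>snd (tp t j)\<bar> \<le> int t)"
proof (induction t)
  case 0
  have "3 \<le> symbols M" "start M < states M" using wf by (auto simp: wf_tm_def)
  then show ?case by (auto simp: q_def tp_def run_def init_def tape_content_def)
next
  case (Suc t)
  let ?c = "run M [x, y] t"
  have "scan (snd ?c ! j) < symbols M" if "j < tapes M" for j
    using Suc that by (simp add: tp_def)
  then have s: "length (map scan (snd ?c)) = tapes M" "set (map scan (snd ?c)) \<subseteq> {..<symbols M}"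
    using Suc by (auto simp: in_set_conv_nth simp del: set_map)
  let ?r = "total_delta M (fst ?c) (map scan (snd ?c))"
  have q: "fst ?c < states M" using Suc by (simp add: q_def)
  note r = total_delta_wf[OF q s]
  have "snd ?r ! j \<in> set (snd ?r)" if "j < tapes M" for j
    using that r(2) by simp
  then have w: "fst (snd ?r ! j) < symbols M" if "j < tapes M" for j
    using r(3) that by (meson image_subset_iff lessThan_iff)
  have tp: "tp (Suc t) j = act (snd ?r ! j) (tp t j)" if "j < tapes M" for j
    using that r(2) s(1) by (simp add: tp_def run_Suc step_total_delta Let_def)
  have off: "\<bar>offset d\<bar> \<le> 1" for d by (cases d) auto
  have "(\<forall>i. fst (tp (Suc t) j) i < symbols M) \<and> \<bar>snd (tp (Suc t) j)\<bar> \<le> int (Suc t)"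
    if "j < tapes M" for j
    using Suc w[OF that] off[of "snd (snd ?r ! j)"] that by (auto simp: tp act_def)
  then show ?case
    using r(1,2) s(1) by (simp add: q_def run_Suc step_total_delta Let_def)
qed

lemma length_ss [simp]: "length (ss t) = tapes M"
  using run_inv[of t] by (simp add: ss_def)

lemma nth_ss: "j < tapes M \<Longrightarrow> ss t ! j = scan (tp t j)"
  using run_inv[of t] by (simp add: ss_def tp_def)

lemma set_ss: "set (ss t) \<subseteq> {..<symbols M}"
  using run_inv[of t] nth_ss by (auto simp: in_set_conv_nth)

lemma q_Suc: "q (Suc t) = fst (rr t)"
  by (simp add: q_def rr_def ss_def run_Suc step_total_delta Let_def)

lemma rr_wf: "length (snd (rr t)) = tapes M" "j < tapes M \<Longrightarrow> fst (snd (rr t) ! j) < symbols M"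
proof -
  have q: "q t < states M" using run_inv by blast
  show l: "length (snd (rr t)) = tapes M"
    using total_delta_wf(2)[OF q length_ss set_ss] by (simp add: rr_def)
  show "fst (snd (rr t) ! j) < symbols M" if "j < tapes M"
  proof -
    have "snd (rr t) ! j \<in> set (snd (rr t))" using l that by simp
    moreover have "fst ` set (snd (rr t)) \<subseteq> {..<symbols M}"
      using total_delta_wf(3)[OF q length_ss set_ss[of t]] by (simp add: rr_def)
    ultimately show ?thesis by auto
  qed
qed

lemma tp_Suc:
  assumes "j < tapes M"
  shows "tp (Suc t) j = act (snd (rr t) ! j) (tp t j)"
  using assms rr_wf(1)[of t] run_inv[of t]
  by (simp add: tp_def rr_def q_def ss_def run_Suc step_total_delta Let_def)

lemma q_0: "q 0 = start M"
  by (simp add: q_def run_def init_def)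

lemma tp_0:
  assumes "j < tapes M"
  shows "tp 0 j = (tape_content (if j = 0 then x else if j = 1 then y else []), 0)"
  using assms by (auto simp: tp_def run_def init_def nth_Cons' less_Suc_eq)

end

section \<open>Facts and rules describing a run\<close>

definition tab1 :: "nat \<Rightarrow> (nat \<Rightarrow> nat) \<Rightarrow> nat \<Rightarrow> nat" where
  "tab1 K g m = (if m < K then g m else 0)"

text \<open>The cut-off at \<open>K\<close>, here and in \<open>tab1\<close>, turns an arbitrary
  function into a finite table and thus makes it definable; along a genuine run the arguments lie
  below \<open>K\<close>.\<close>

definition tab2 :: "nat \<Rightarrow> (nat \<Rightarrow> nat \<Rightarrow> nat) \<Rightarrow> nat \<Rightarrow> nat \<Rightarrow> nat" where
  "tab2 K g m n = (if m < K \<and> n < K then g m n else 0)"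

text \<open>Numbers stand for the list consisting of the state and the scanned symbols of the first few tapes.\<close>

definition ext :: "nat \<Rightarrow> nat \<Rightarrow> nat" where
  "ext u a = list_encode (list_decode u @ [a])"

definition trans_of :: "tm \<Rightarrow> nat \<Rightarrow> nat \<times> (nat \<times> move) list" where
  "trans_of M u = total_delta M (hd (list_decode u)) (tl (list_decode u))"

definition next_of :: "tm \<Rightarrow> nat \<Rightarrow> nat" where
  "next_of M u = list_encode [fst (trans_of M u)]"

definition write_of :: "tm \<Rightarrow> nat \<Rightarrow> nat \<Rightarrow> nat" where
  "write_of M u j = fst (snd (trans_of M u) ! j)"

text \<open>The offset is shifted by 1 to be a natural number; the rule for head positions
  compensates by \<open>Suc i3\<close>.\<close>

definition move_of :: "tm \<Rightarrow> nat \<Rightarrow> nat \<Rightarrow> nat" where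
  "move_of M u j = nat (offset (snd (snd (trans_of M u) ! j)) + 1)"

text \<open>A fact consists of a kind \<open>h\<close>, a time \<open>t\<close>, a tape \<open>j\<close>, a cell \<open>i\<close> and a value \<open>a\<close>; cell \<open>T + i\<close> is tape
  position \<open>i\<close>. Kind 0: \<open>a\<close> encodes the state and the first \<open>j\<close> scanned symbols. Kind 1: head \<open>j\<close> is at
  \<open>i\<close>. Kind 2: cell \<open>i\<close> of tape \<open>j\<close> contains \<open>a\<close>. Kind 3: head \<open>j\<close> scans \<open>a\<close>. Kind 4 describes the
  certificate: cell \<open>i\<close> is (\<open>j = 0\<close>) or is not (\<open>j = 1\<close>) beyond its end, the bit in cell \<open>i\<close> is set
  (\<open>j = 2\<close>) or not (\<open>j = 3\<close>).\<close>

definition init_fact :: "tm \<Rightarrow> nat \<Rightarrow> nat \<Rightarrow> bool list \<Rightarrow> nat \<Rightarrow> nat \<Rightarrow> nat \<Rightarrow> nat \<Rightarrow> nat \<Rightarrow> bool" where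
  "init_fact M T Q x h t j i a \<longleftrightarrow>
     h = 0 \<and> t = 0 \<and> j = 0 \<and> i = 0 \<and> a = list_encode [start M] \<or>
     h = 1 \<and> t = 0 \<and> j < tapes M \<and> i = T \<and> a = 0 \<or>
     h = 2 \<and> t = 0 \<and> j = 0 \<and> a = (if i < T then 0 else tape_content x (int (i - T))) \<or>
     h = 2 \<and> t = 0 \<and> j = 1 \<and> (i < T \<or> T + Q \<le> i) \<and> a = 0 \<or>
     h = 2 \<and> t = 0 \<and> 2 \<le> j \<and> j < tapes M \<and> a = 0"

definition reject_fact :: "tm \<Rightarrow> nat \<Rightarrow> nat \<Rightarrow> nat \<Rightarrow> nat \<Rightarrow> nat \<Rightarrow> nat \<Rightarrow> bool" where
  "reject_fact M T h t j i a \<longleftrightarrow> h = 0 \<and> t = T \<and> j = 0 \<and> i = 0 \<and> a = list_encode [reject M]"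

definition pair_fact :: "nat \<Rightarrow> nat \<Rightarrow> nat \<Rightarrow> nat \<Rightarrow> nat \<Rightarrow> nat \<Rightarrow> nat \<Rightarrow> nat \<Rightarrow> nat \<Rightarrow> nat \<Rightarrow> bool" where
  "pair_fact h t j i a h' t' j' i' a' \<longleftrightarrow>
     h = 4 \<and> h' = 4 \<and> t = 0 \<and> t' = 0 \<and> a = 0 \<and> a' = 0 \<and> i = i' \<and> (j = 0 \<and> j' = 1 \<or> j = 2 \<and> j' = 3)"

text \<open>In order: reading under the head, appending a scanned symbol, next state, head move,
  written symbol, inertia of the other cells, certificate cells, propagation of the end mark. A rule
  with a single genuine premise is applied with the same fact twice.\<close>

definition rule_fact ::
  "tm \<Rightarrow> nat \<Rightarrow> nat \<Rightarrow> nat \<Rightarrow> nat \<Rightarrow> nat \<Rightarrow> nat \<Rightarrow> nat \<Rightarrow> nat \<Rightarrow> nat \<Rightarrow> nat \<Rightarrow> nat \<Rightarrow> nat \<Rightarrow> nat \<Rightarrow> nat \<Rightarrow> nat \<Rightarrow> nat \<Rightarrow> nat \<Rightarrow> bool"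
  where
  "rule_fact M K T h1 t1 j1 i1 a1 h2 t2 j2 i2 a2 h3 t3 j3 i3 a3 \<longleftrightarrow>
     h1 = 1 \<and> h2 = 2 \<and> h3 = 3 \<and> t1 = t2 \<and> t3 = t2 \<and> j1 = j2 \<and> j3 = j2 \<and> i1 = i2 \<and> i3 = 0 \<and> a3 = a2 \<or>
     h1 = 0 \<and> h2 = 3 \<and> h3 = 0 \<and> t1 = t2 \<and> t3 = t2 \<and> j1 = j2 \<and> j3 = Suc j2 \<and> i3 = 0 \<and>
       a3 = tab2 K ext a1 a2 \<or>
     h1 = 0 \<and> h2 = 0 \<and> h3 = 0 \<and> t3 = Suc t1 \<and> j1 = tapes M \<and> j3 = 0 \<and> i3 = 0 \<and>
       a3 = tab1 K (next_of M) a1 \<or>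
     h1 = 0 \<and> h2 = 1 \<and> h3 = 1 \<and> t1 = t2 \<and> t3 = Suc t2 \<and> j1 = tapes M \<and> j3 = j2 \<and>
       Suc i3 = i2 + tab2 K (move_of M) a1 j2 \<and> a3 = 0 \<or>
     h1 = 0 \<and> h2 = 1 \<and> h3 = 2 \<and> t1 = t2 \<and> t3 = Suc t2 \<and> j1 = tapes M \<and> j3 = j2 \<and> i3 = i2 \<and>
       a3 = tab2 K (write_of M) a1 j2 \<or>
     h1 = 1 \<and> h2 = 2 \<and> h3 = 2 \<and> t1 = t2 \<and> t3 = Suc t2 \<and> j1 = j2 \<and> j3 = j2 \<and> i1 \<noteq> i2 \<and> i3 = i2 \<and> a3 = a2 \<or>
     h1 = 4 \<and> h2 = 4 \<and> h3 = 2 \<and> i1 = i2 \<and> i3 = i2 \<and> T \<le> i2 \<and> t3 = 0 \<and> j3 = 1 \<and>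
       (j1 = 0 \<and> a3 = 0 \<or> j1 = 1 \<and> j2 = 2 \<and> a3 = 2 \<or> j1 = 1 \<and> j2 = 3 \<and> a3 = 1) \<or>
     h1 = 4 \<and> h2 = 4 \<and> h3 = 4 \<and> j1 = 0 \<and> i3 = Suc i1 \<and> t3 = 0 \<and> j3 = 0 \<and> a3 = 0"

definition with_digits :: "nat \<Rightarrow> (nat \<Rightarrow> nat \<Rightarrow> nat \<Rightarrow> nat \<Rightarrow> nat \<Rightarrow> 'a) \<Rightarrow> nat \<Rightarrow> 'a" where
  "with_digits B P f =
     P (f div B div B div B div B) (f div B div B div B mod B) (f div B div B mod B) (f div B mod B) (f mod B)"

definition fact_code :: "nat \<Rightarrow> nat \<Rightarrow> nat \<Rightarrow> nat \<Rightarrow> nat \<Rightarrow> nat \<Rightarrow> nat" where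
  "fact_code B h t j i a = (((h * B + t) * B + j) * B + i) * B + a"

lemma with_digits_fact_code:
  assumes "t < B" "j < B" "i < B" "a < B"
  shows "with_digits B P (fact_code B h t j i a) = P h t j i a"
  using assms by (simp add: with_digits_def fact_code_def)

lemma fact_code_less:
  assumes "h < B" "t < B" "j < B" "i < B" "a < B"
  shows "fact_code B h t j i a < B * B * B * B * B"
proof -
  have *: "m * B + d < n * B" if "m < n" "d < B" for m n d
  proof -
    have "m * B + d < Suc m * B" using that by simp
    also have "\<dots> \<le> n * B" using that by (intro mult_le_mono1) simp
    finally show ?thesis .
  qed
  show ?thesis unfolding fact_code_def by (intro * assms)
qed

definition In_fact :: "tm \<Rightarrow> nat \<Rightarrow> nat \<Rightarrow> bool list \<Rightarrow> nat \<Rightarrow> nat \<Rightarrow> bool" where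
  "In_fact M T Q x B = with_digits B (init_fact M T Q x)"

definition No_fact :: "tm \<Rightarrow> nat \<Rightarrow> nat \<Rightarrow> nat \<Rightarrow> bool" where
  "No_fact M T B = with_digits B (reject_fact M T)"

definition Pr_fact :: "nat \<Rightarrow> nat \<Rightarrow> nat \<Rightarrow> bool" where
  "Pr_fact B f g = with_digits B (with_digits B pair_fact f) g"

definition Rl_fact :: "tm \<Rightarrow> nat \<Rightarrow> nat \<Rightarrow> nat \<Rightarrow> nat \<Rightarrow> nat \<Rightarrow> nat \<Rightarrow> bool" where
  "Rl_fact M K T B f g e = with_digits B (with_digits B (with_digits B (rule_fact M K T) f) g) e"

text \<open>The bound depends on the machine alone. It covers symbols, tape numbers and the codes of
  a state with up to \<open>tapes M\<close> scanned symbols; the 5 is for the kinds of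
  facts.\<close>

definition code_bound :: "tm \<Rightarrow> nat \<Rightarrow> bool" where
  "code_bound M K \<longleftrightarrow> symbols M \<le> K \<and> tapes M < K \<and> 5 \<le> K \<and>
     (\<forall>u. length u \<le> Suc (tapes M) \<longrightarrow> set u \<subseteq> {..<max (states M) (symbols M)} \<longrightarrow> list_encode u < K)"

lemma code_bound_exists: "\<exists>K. code_bound M K \<and> k < K"
proof -
  let ?S = "{u. set u \<subseteq> {..<max (states M) (symbols M)} \<and> length u \<le> Suc (tapes M)}"
  have fin: "finite (list_encode ` ?S)"
    by (intro finite_imageI finite_lists_length_le) simp
  let ?K = "Suc (Max (insert 0 (list_encode ` ?S))) + symbols M + Suc (tapes M) + 5 + k"
  have "list_encode u < ?K" if "u \<in> ?S" for u
  proof -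
    have "list_encode u \<le> Max (insert 0 (list_encode ` ?S))"
      using fin that by (intro Max_ge) blast+
    then show ?thesis by linarith
  qed
  then show ?thesis unfolding code_bound_def by (intro exI[of _ ?K]) auto
qed

section \<open>Soundness: the true facts of an accepting run form a solution\<close>

context np_run
begin

text \<open>Coordinates that a kind ignores are left free. The properties for \<open>j = 0\<close>
  and \<open>j = 1\<close>, and likewise for \<open>j = 2\<close> and \<open>j = 3\<close>, are
  complementary at every cell, also outside the certificate, as the pairs demand.\<close>

definition holds :: "nat \<Rightarrow> nat \<Rightarrow> nat \<Rightarrow> nat \<Rightarrow> nat \<Rightarrow> nat \<Rightarrow> bool" where
  "holds T h t j i a \<longleftrightarrow>
     h = 0 \<and> j \<le> tapes M \<and> a = list_encode (q t # take j (ss t)) \<or>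
     h = 1 \<and> j < tapes M \<and> int i - int T = snd (tp t j) \<or>
     h = 2 \<and> j < tapes M \<and> a = fst (tp t j) (int i - int T) \<or>
     h = 3 \<and> j < tapes M \<and> a = ss t ! j \<or>
     h = 4 \<and> (j = 0 \<and> T + length y \<le> i \<or> j = 1 \<and> i < T + length y \<or>
       j = 2 \<and> T \<le> i \<and> i < T + length y \<and> y ! (i - T) \<or>
       j = 3 \<and> \<not> (T \<le> i \<and> i < T + length y \<and> y ! (i - T)))"

lemma trans_of_control: "trans_of M (list_encode (q t # ss t)) = rr t"
  by (simp add: trans_of_def rr_def)

lemma control_less:
  assumes "code_bound M K"
  shows "list_encode (q t # take j (ss t)) < K"
proof -
  have "set (q t # take j (ss t)) \<subseteq> {..<max (states M) (symbols M)}"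
    using run_inv[of t] set_ss[of t] set_take_subset[of j "ss t"] by fastforce
  moreover have "length (q t # take j (ss t)) \<le> Suc (tapes M)" by simp
  ultimately show ?thesis using assms unfolding code_bound_def by blast
qed

lemma ss_less: "code_bound M K \<Longrightarrow> j < tapes M \<Longrightarrow> ss t ! j < K"
proof -
  assume "code_bound M K" "j < tapes M"
  then have "ss t ! j < symbols M" "symbols M \<le> K"
    using nth_ss[of j t] run_inv[of t] by (auto simp: code_bound_def)
  then show ?thesis by simp
qed

lemma ext_control:
  assumes "code_bound M K" "j < tapes M"
  shows "tab2 K ext (list_encode (q t # take j (ss t))) (ss t ! j) =
    list_encode (q t # take (Suc j) (ss t))"
  using control_less[OF assms(1)] ss_less[OF assms] assms(2)
  by (simp add: tab2_def ext_def take_Suc_conv_app_nth)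

lemma next_control:
  assumes "code_bound M K"
  shows "tab1 K (next_of M) (list_encode (q t # ss t)) = list_encode [q (Suc t)]"
  using control_less[OF assms, of t "tapes M"]
  by (simp add: tab1_def next_of_def trans_of_control q_Suc)

lemma move_control:
  assumes "code_bound M K" "j < tapes M"
  shows "tab2 K (move_of M) (list_encode (q t # ss t)) j = nat (offset (snd (snd (rr t) ! j)) + 1)"
  using control_less[OF assms(1), of t "tapes M"] assms
  by (simp add: tab2_def move_of_def trans_of_control code_bound_def)

lemma write_control:
  assumes "code_bound M K" "j < tapes M"
  shows "tab2 K (write_of M) (list_encode (q t # ss t)) j = fst (snd (rr t) ! j)"
  using control_less[OF assms(1), of t "tapes M"] assms
  by (simp add: tab2_def write_of_def trans_of_control code_bound_def)

lemma offset_ge [simp]: "0 \<le> offset d + 1"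
  by (cases d) auto

lemma offset_move: "int (nat (offset d + 1)) = offset d + 1"
  by simp

lemma holds_rule:
  assumes "code_bound M K" "rule_fact M K T h1 t1 j1 i1 a1 h2 t2 j2 i2 a2 h3 t3 j3 i3 a3"
    "holds T h1 t1 j1 i1 a1" "holds T h2 t2 j2 i2 a2"
  shows "holds T h3 t3 j3 i3 a3"
  using assms(2)[unfolded rule_fact_def]
proof (elim disjE)
  assume *: "h1 = 1 \<and> h2 = 2 \<and> h3 = 3 \<and> t1 = t2 \<and> t3 = t2 \<and> j1 = j2 \<and> j3 = j2 \<and> i1 = i2 \<and> i3 = 0 \<and> a3 = a2"
  then show ?thesis using assms(3,4) by (simp add: holds_def nth_ss)
next
  assume "h1 = 0 \<and> h2 = 3 \<and> h3 = 0 \<and> t1 = t2 \<and> t3 = t2 \<and> j1 = j2 \<and> j3 = Suc j2 \<and> i3 = 0 \<and>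
       a3 = tab2 K ext a1 a2"
  then show ?thesis using assms(3,4) ext_control[OF assms(1)] by (simp add: holds_def)
next
  assume "h1 = 0 \<and> h2 = 0 \<and> h3 = 0 \<and> t3 = Suc t1 \<and> j1 = tapes M \<and> j3 = 0 \<and> i3 = 0 \<and>
       a3 = tab1 K (next_of M) a1"
  then show ?thesis using assms(3) next_control[OF assms(1)] by (simp add: holds_def)
next
  assume *: "h1 = 0 \<and> h2 = 1 \<and> h3 = 1 \<and> t1 = t2 \<and> t3 = Suc t2 \<and> j1 = tapes M \<and> j3 = j2 \<and>
       Suc i3 = i2 + tab2 K (move_of M) a1 j2 \<and> a3 = 0"
  then have j: "j2 < tapes M" and p: "int i2 - int T = snd (tp t2 j2)"
    and a: "a1 = list_encode (q t2 # ss t2)"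
    using assms(3,4) by (auto simp: holds_def)
  have "int (Suc i3) = int i2 + (offset (snd (snd (rr t2) ! j2)) + 1)"
    using * by (simp add: a move_control[OF assms(1) j] offset_move)
  then show ?thesis using * j p by (simp add: holds_def tp_Suc act_def)
next
  assume *: "h1 = 0 \<and> h2 = 1 \<and> h3 = 2 \<and> t1 = t2 \<and> t3 = Suc t2 \<and> j1 = tapes M \<and> j3 = j2 \<and> i3 = i2 \<and>
       a3 = tab2 K (write_of M) a1 j2"
  then have j: "j2 < tapes M" and p: "int i2 - int T = snd (tp t2 j2)"
    and a: "a1 = list_encode (q t2 # ss t2)"
    using assms(3,4) by (auto simp: holds_def)
  show ?thesis using * j p by (simp add: holds_def tp_Suc act_def a write_control[OF assms(1) j])
next
  assume *: "h1 = 1 \<and> h2 = 2 \<and> h3 = 2 \<and> t1 = t2 \<and> t3 = Suc t2 \<and> j1 = j2 \<and> j3 = j2 \<and> i1 \<noteq> i2 \<and> i3 = i2 \<and> a3 = a2"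
  then have "int i2 - int T \<noteq> snd (tp t2 j2)" using assms(3) by (auto simp: holds_def)
  then show ?thesis using * assms(4) by (simp add: holds_def tp_Suc act_def)
next
  assume *: "h1 = 4 \<and> h2 = 4 \<and> h3 = 2 \<and> i1 = i2 \<and> i3 = i2 \<and> T \<le> i2 \<and> t3 = 0 \<and> j3 = 1 \<and>
       (j1 = 0 \<and> a3 = 0 \<or> j1 = 1 \<and> j2 = 2 \<and> a3 = 2 \<or> j1 = 1 \<and> j2 = 3 \<and> a3 = 1)"
  have c: "fst (tp 0 1) (int i2 - int T) =
      (if i2 < T + length y then if y ! (i2 - T) then 2 else 1 else 0)"
    using * two_tapes tape_content_nat[of y "i2 - T"] by (auto simp: tp_0 of_nat_diff)
  then show ?thesis using * assms(3,4) two_tapes by (auto simp: holds_def)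
next
  assume "h1 = 4 \<and> h2 = 4 \<and> h3 = 4 \<and> j1 = 0 \<and> i3 = Suc i1 \<and> t3 = 0 \<and> j3 = 0 \<and> a3 = 0"
  then show ?thesis using assms(3) by (simp add: holds_def)
qed

lemma holds_init:
  assumes "length y \<le> Q" "init_fact M T Q x h t j i a"
  shows "holds T h t j i a"
  using assms(2)[unfolded init_fact_def]
proof (elim disjE)
  assume "h = 0 \<and> t = 0 \<and> j = 0 \<and> i = 0 \<and> a = list_encode [start M]"
  then show ?thesis by (simp add: holds_def q_0)
next
  assume "h = 1 \<and> t = 0 \<and> j < tapes M \<and> i = T \<and> a = 0"
  then show ?thesis by (simp add: holds_def tp_0)
next
  assume "h = 2 \<and> t = 0 \<and> j = 0 \<and> a = (if i < T then 0 else tape_content x (int (i - T)))"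
  then show ?thesis using two_tapes by (auto simp: holds_def tp_0 of_nat_diff tape_content_def)
next
  assume "h = 2 \<and> t = 0 \<and> j = 1 \<and> (i < T \<or> T + Q \<le> i) \<and> a = 0"
  then show ?thesis using two_tapes assms(1) by (auto simp: holds_def tp_0 tape_content_def)
next
  assume "h = 2 \<and> t = 0 \<and> 2 \<le> j \<and> j < tapes M \<and> a = 0"
  then show ?thesis by (simp add: holds_def tp_0 tape_content_def)
qed

lemma solution_if_accepts:
  assumes K: "code_bound M K" and y: "length y \<le> Q" and acc: "accepts_within M [x, y] T"
  shows "solution V (In_fact M T Q x B) (No_fact M T B) (Pr_fact B) (Rl_fact M K T B)
    {f. with_digits B (holds T) f}"
proof -
  have "q T = accept M" using acc by (simp add: accepts_within_def q_def)
  moreover have "accept M \<noteq> reject M" using wf by (simp add: wf_tm_def)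
  ultimately have nr: "\<not> holds T h t j i a" if "reject_fact M T h t j i a" for h t j i a
    using that by (auto simp: reject_fact_def holds_def)
  have np: "holds T h t j i a \<noteq> holds T h' t' j' i' a'"
    if "pair_fact h t j i a h' t' j' i' a'" for h t j i a h' t' j' i' a'
    using that by (auto simp: pair_fact_def holds_def)
  show ?thesis
    unfolding solution_def In_fact_def No_fact_def Pr_fact_def Rl_fact_def with_digits_def mem_Collect_eq
    by (intro conjI allI impI; (erule holds_init[OF y] | erule nr | erule np | erule (2) holds_rule[OF K]))
qed

end

text \<open>The rules force \<open>A\<close> to contain all relevant true facts of the run on the
  certificate read off from its facts of kind 4. Only facts with digits below \<open>B\<close> are
  constrained, so \<open>B\<close> has to exceed the cells up to \<open>2 * T\<close>, the
  certificate cells below \<open>T + Q\<close> and the codes below \<open>K\<close>.\<close>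

lemma accepts_if_solution:
  assumes wf: "wf_tm M" and K: "code_bound M K" and B: "2 * T + Q + K \<le> B"
    and sol: "solution (B * B * B * B * B) (In_fact M T Q x B) (No_fact M T B) (Pr_fact B) (Rl_fact M K T B) A"
    and dec: "\<And>y. length y \<le> Q \<Longrightarrow> accepts_within M [x, y] T \<or> rejects_within M [x, y] T"
  shows "\<exists>y. length y \<le> Q \<and> accepts_within M [x, y] T"
proof -
  define F where "F h t j i a \<longleftrightarrow> fact_code B h t j i a \<in> A" for h t j i a
  define ok where "ok h t j i a \<longleftrightarrow> h < B \<and> t < B \<and> j < B \<and> i < B \<and> a < B" for h t j i a
  have V: "fact_code B h t j i a < B * B * B * B * B" if "ok h t j i a" for h t j i a
    using that fact_code_less by (simp add: ok_def)
  have ini: "F h t j i a" if "init_fact M T Q x h t j i a" "ok h t j i a" for h t j i a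
  proof -
    have "In_fact M T Q x B (fact_code B h t j i a)" using that by (simp add: In_fact_def with_digits_fact_code ok_def)
    then show ?thesis using sol V[OF that(2)] unfolding solution_def F_def by blast
  qed
  have rej: "\<not> F h t j i a" if "reject_fact M T h t j i a" "ok h t j i a" for h t j i a
  proof -
    have "No_fact M T B (fact_code B h t j i a)" using that by (simp add: No_fact_def with_digits_fact_code ok_def)
    then show ?thesis using sol V[OF that(2)] unfolding solution_def F_def by blast
  qed
  have pair: "F h t j i a \<noteq> F h' t' j' i' a'"
    if "pair_fact h t j i a h' t' j' i' a'" "ok h t j i a" "ok h' t' j' i' a'" for h t j i a h' t' j' i' a'
  proof -
    have "Pr_fact B (fact_code B h t j i a) (fact_code B h' t' j' i' a')"
      using that by (simp add: Pr_fact_def with_digits_fact_code ok_def)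
    then show ?thesis using sol V[OF that(2)] V[OF that(3)] unfolding solution_def F_def by blast
  qed
  have rule: "F h3 t3 j3 i3 a3"
    if "F h1 t1 j1 i1 a1" "F h2 t2 j2 i2 a2" "ok h1 t1 j1 i1 a1" "ok h2 t2 j2 i2 a2" "ok h3 t3 j3 i3 a3"
      "rule_fact M K T h1 t1 j1 i1 a1 h2 t2 j2 i2 a2 h3 t3 j3 i3 a3"
    for h1 t1 j1 i1 a1 h2 t2 j2 i2 a2 h3 t3 j3 i3 a3
  proof -
    have "Rl_fact M K T B (fact_code B h1 t1 j1 i1 a1) (fact_code B h2 t2 j2 i2 a2) (fact_code B h3 t3 j3 i3 a3)"
      using that by (simp add: Rl_fact_def with_digits_fact_code ok_def)
    then show ?thesis
      using sol V[OF that(3)] V[OF that(4)] V[OF that(5)] that(1,2) unfolding solution_def F_def by blast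
  qed
  have K5: "5 \<le> K" "tapes M < K" "symbols M \<le> K" using K by (auto simp: code_bound_def)
  have m2: "2 \<le> tapes M" using wf by (simp add: wf_tm_def)

  \<comment> \<open>The certificate ends at the first end mark, or at \<open>Q\<close> if there is
    none.\<close>
  define L where "L = (LEAST l. l = Q \<or> F 4 0 0 (T + l) 0)"
  have L: "L = Q \<or> F 4 0 0 (T + L) 0"
    unfolding L_def by (rule LeastI[of _ Q]) simp
  have LQ: "L \<le> Q" unfolding L_def by (rule Least_le) simp
  have less_L: "\<not> F 4 0 0 (T + l) 0" if "l < L" for l
    using not_less_Least[OF that[unfolded L_def]] by simp
  define y where "y = map (\<lambda>l. F 4 0 2 (T + l) 0) [0..<L]"
  have ly: "length y = L" by (simp add: y_def)
  interpret np_run M x y using wf by unfold_locales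

  \<comment> \<open>Propagation fills the remaining cells with end marks; without it the guessed
    content could resume after a gap.\<close>
  have ends: "F 4 0 0 (T + l) 0" if "L \<le> l" "l < Q" for l
    using that
  proof (induction l rule: dec_induct)
    case base
    then show ?case using L by auto
  next
    case (step l)
    then have "F 4 0 0 (T + l) 0" by simp
    then show ?case
      by (rule rule[OF _ \<open>F 4 0 0 (T + l) 0\<close>]) (use step B K5 in \<open>auto simp: ok_def rule_fact_def\<close>)
  qed
  have cert: "F 2 0 1 i (tape_content y (int i - int T))" if i: "i \<le> 2 * T" for i
  proof (cases "i < T \<or> T + Q \<le> i")
    case True
    then have "tape_content y (int i - int T) = 0" using LQ ly by (auto simp: tape_content_def)
    then show ?thesis using True i B K5 by (auto intro!: ini simp: init_fact_def ok_def)
  next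
    case False
    define l where "l = i - T"
    have l: "i = T + l" "l < Q" "T + l < B" using False i B K5 by (auto simp: l_def)
    have c: "tape_content y (int i - int T) = (if l < L then if F 4 0 2 (T + l) 0 then 2 else 1 else 0)"
    proof -
      have "y ! l = F 4 0 2 (T + l) 0" if "l < L" using that by (simp add: y_def)
      then show ?thesis using l tape_content_nat[of y l] by (simp add: ly)
    qed
    have o: "ok 4 0 0 (T + l) 0" "ok 4 0 1 (T + l) 0" "ok 4 0 2 (T + l) 0" "ok 4 0 3 (T + l) 0"
      "ok 2 0 1 (T + l) 0" "ok 2 0 1 (T + l) 1" "ok 2 0 1 (T + l) 2"
      using l B K5 by (auto simp: ok_def)
    show ?thesis
    proof (cases "l < L")
      case True
      have "F 4 0 0 (T + l) 0 \<noteq> F 4 0 1 (T + l) 0"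
        by (rule pair) (use o in \<open>auto simp: pair_fact_def\<close>)
      then have 1: "F 4 0 1 (T + l) 0" using less_L[OF True] by simp
      have 2: "F 4 0 2 (T + l) 0 \<noteq> F 4 0 3 (T + l) 0"
        by (rule pair) (use o in \<open>auto simp: pair_fact_def\<close>)
      show ?thesis
      proof (cases "F 4 0 2 (T + l) 0")
        case set: True
        have "F 2 0 1 (T + l) 2"
          by (rule rule[OF 1 set]) (use o in \<open>auto simp: rule_fact_def\<close>)
        then show ?thesis using c l(1) True set by simp
      next
        case unset: False
        then have "F 4 0 3 (T + l) 0" using 2 by simp
        then have "F 2 0 1 (T + l) 1"
          by (rule rule[OF 1]) (use o in \<open>auto simp: rule_fact_def\<close>)
        then show ?thesis using c l(1) True unset by simp
      qed
    next
      case False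
      then have "F 4 0 0 (T + l) 0" using ends l by simp
      then have "F 2 0 1 (T + l) 0"
        by (rule rule[OF _ \<open>F 4 0 0 (T + l) 0\<close>]) (use o in \<open>auto simp: rule_fact_def\<close>)
      then show ?thesis using c l(1) False by simp
    qed
  qed

  \<comment> \<open>The cell under head \<open>j\<close>; up to time \<open>T\<close> the sum is
    nonnegative, so \<open>nat\<close> does not truncate.\<close>
  define hp where "hp t j = nat (int T + snd (tp t j))" for t j
  have hp: "int (hp t j) - int T = snd (tp t j)" "hp t j \<le> 2 * T" if "t \<le> T" "j < tapes M" for t j
    using run_inv[of t] that by (auto simp: hp_def)
  have sym: "fst (tp t j) i < K" if "j < tapes M" for t j i
    using run_inv[of t] that K5 by (meson less_le_trans)
  have le1: "list_encode [q t] < K" for t using control_less[OF K, of t 0] by simp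
  \<comment> \<open>Cells beyond \<open>2 * T\<close> are out of reach of all heads and are left out
    of the invariant.\<close>
  have "F 0 t 0 0 (list_encode [q t]) \<and> (\<forall>j<tapes M. F 1 t j (hp t j) 0) \<and>
      (\<forall>j<tapes M. \<forall>i\<le>2 * T. F 2 t j i (fst (tp t j) (int i - int T)))" if "t \<le> T" for t
    using that
  proof (induction t)
    case 0
    have "F 0 0 0 0 (list_encode [q 0])"
      using le1[of 0] B K5 by (auto intro!: ini simp: init_fact_def ok_def q_0)
    moreover have "F 1 0 j (hp 0 j) 0" if "j < tapes M" for j
      using that B K5 by (auto intro!: ini simp: init_fact_def ok_def hp_def tp_0)
    moreover have "F 2 0 j i (fst (tp 0 j) (int i - int T))" if j: "j < tapes M" and i: "i \<le> 2 * T" for j i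
    proof -
      consider "j = 0" | "j = 1" | "2 \<le> j" by linarith
      then show ?thesis
      proof cases
        case 1
        have "tape_content x (int i - int T) = (if i < T then 0 else tape_content x (int (i - T)))"
          by (auto simp: of_nat_diff tape_content_def)
        then have "init_fact M T Q x 2 0 0 i (tape_content x (int i - int T))"
          unfolding init_fact_def by blast
        moreover have "ok 2 0 0 i (tape_content x (int i - int T))"
          using i B K5 tape_content_le[of x "int i - int T"] by (auto simp: ok_def)
        ultimately have "F 2 0 0 i (tape_content x (int i - int T))" by (rule ini)
        then show ?thesis using 1 j by (simp add: tp_0)
      next
        case 2
        then show ?thesis using cert[OF i] j by (simp add: tp_0)
      next
        case 3
        then show ?thesis
          using i j B K5 by (auto intro!: ini simp: init_fact_def ok_def tp_0 tape_content_def)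
      qed
    qed
    ultimately show ?case by blast
  next
    case (Suc t)
    then have t: "t \<le> T" "t < B" "Suc t < B" and IH: "F 0 t 0 0 (list_encode [q t])"
      "\<And>j. j < tapes M \<Longrightarrow> F 1 t j (hp t j) 0"
      "\<And>j i. j < tapes M \<Longrightarrow> i \<le> 2 * T \<Longrightarrow> F 2 t j i (fst (tp t j) (int i - int T))"
      using B K5 by auto
    have scan: "F 3 t j 0 (ss t ! j)" if j: "j < tapes M" for j
    proof (rule rule[OF IH(2)[OF j] IH(3)[OF j hp(2)[OF t(1) j]]])
      have "fst (tp t j) (int (hp t j) - int T) = ss t ! j" using hp(1)[OF t(1) j] nth_ss[OF j] by simp
      then show "rule_fact M K T 1 t j (hp t j) 0 2 t j (hp t j) (fst (tp t j) (int (hp t j) - int T)) 3 t j 0 (ss t ! j)"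
        by (simp add: rule_fact_def)
    qed (use j t B K5 hp(2)[OF t(1) j] sym[OF j, of t "int (hp t j) - int T"] ss_less[OF K j, of t] in
        \<open>auto simp: ok_def\<close>)
    have okc: "ok 0 t' j 0 (list_encode (q t # take j (ss t)))" if "t' < B" "j \<le> tapes M" for j t'
      using that control_less[OF K, of t j] B K5 by (auto simp: ok_def)
    have "F 0 t j 0 (list_encode (q t # take j (ss t)))" if "j \<le> tapes M" for j
      using that
    proof (induction j)
      case 0
      then show ?case using IH(1) by simp
    next
      case (Suc j)
      then have j: "j < tapes M" and "F 0 t j 0 (list_encode (q t # take j (ss t)))" by auto
      from this(2) scan[OF j] show ?case
        by (rule rule)
          (use j t okc[of t j] okc[of t "Suc j"] ss_less[OF K j, of t] B K5 ext_control[OF K j, of t] in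
            \<open>auto simp: ok_def rule_fact_def\<close>)
    qed
    from this[of "tapes M"] have ctl: "F 0 t (tapes M) 0 (list_encode (q t # ss t))" by simp
    have okm: "ok 0 t (tapes M) 0 (list_encode (q t # ss t))"
      using okc[of t "tapes M"] t by simp
    have okp: "ok 1 t j (hp t j) 0" if "j < tapes M" for j
      using that t hp(2)[OF t(1) that] B K5 by (auto simp: ok_def)
    have "F 0 (Suc t) 0 0 (list_encode [q (Suc t)])"
      by (rule rule[OF ctl ctl okm okm])
        (use next_control[OF K, of t] le1[of "Suc t"] t B K5 in \<open>auto simp: ok_def rule_fact_def\<close>)
    moreover have "F 1 (Suc t) j (hp (Suc t) j) 0" if j: "j < tapes M" for j
    proof (rule rule[OF ctl IH(2)[OF j] okm okp[OF j]])
      have "int (Suc (hp (Suc t) j)) = int (hp t j) + (offset (snd (snd (rr t) ! j)) + 1)"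
        using hp(1)[OF t(1) j] hp(1)[OF Suc.prems j] j by (simp add: tp_Suc act_def)
      then have "Suc (hp (Suc t) j) = hp t j + tab2 K (move_of M) (list_encode (q t # ss t)) j"
        unfolding move_control[OF K j] using offset_move[of "snd (snd (rr t) ! j)"] by linarith
      then show "rule_fact M K T 0 t (tapes M) 0 (list_encode (q t # ss t)) 1 t j (hp t j) 0 1 (Suc t) j (hp (Suc t) j) 0"
        by (simp add: rule_fact_def)
    qed (use j t B K5 hp(2)[OF Suc.prems j] in \<open>auto simp: ok_def\<close>)
    moreover have "F 2 (Suc t) j i (fst (tp (Suc t) j) (int i - int T))"
      if j: "j < tapes M" and i: "i \<le> 2 * T" for j i
    proof (cases "i = hp t j")
      case True
      have c: "fst (tp (Suc t) j) (int i - int T) = fst (snd (rr t) ! j)"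
        using hp(1)[OF t(1) j] j unfolding True by (simp add: tp_Suc act_def)
      show ?thesis
        by (rule rule[OF ctl IH(2)[OF j] okm okp[OF j]])
          (use c True i j t B K5 sym[OF j, of "Suc t" "int i - int T"] write_control[OF K j, of t] in
            \<open>auto simp: ok_def rule_fact_def\<close>)
    next
      case False
      then have "int i - int T \<noteq> snd (tp t j)" using hp(1)[OF t(1) j] by auto
      then have c: "fst (tp (Suc t) j) (int i - int T) = fst (tp t j) (int i - int T)"
        using j by (simp add: tp_Suc act_def)
      show ?thesis
        unfolding c
        by (rule rule[OF IH(2)[OF j] IH(3)[OF j i] okp[OF j]])
          (use False i j t B K5 sym[OF j, of t "int i - int T"] in \<open>auto simp: ok_def rule_fact_def\<close>)
    qed
    ultimately show ?case by blast
  qed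
  from this[of T] have "F 0 T 0 0 (list_encode [q T])" by simp
  moreover have "ok 0 T 0 0 (list_encode [q T])" using le1[of T] B K5 by (auto simp: ok_def)
  ultimately have "q T \<noteq> reject M" using rej[of 0 T 0 0 "list_encode [q T]"] by (auto simp: reject_fact_def)
  then have "\<not> rejects_within M [x, y] T" by (simp add: rejects_within_def q_def)
  \<comment> \<open>Not rejecting means accepting, because the machine decides every certificate of
    length at most \<open>Q\<close>.\<close>
  then show ?thesis using dec[of y] ly LQ by auto
qed

section \<open>NP-hardness\<close>

lemma def_fun_tab1: "def_fun F \<Longrightarrow> def_fun (\<lambda>w \<rho>. tab1 K g (F w \<rho>))"
  unfolding tab1_def by (rule def_fun_finite)

lemma def_fun_tab2: "def_fun F \<Longrightarrow> def_fun G \<Longrightarrow> def_fun (\<lambda>w \<rho>. tab2 K g (F w \<rho>) (G w \<rho>))"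
  unfolding tab2_def by (rule def_fun_finite2)

lemma def_pred_init_fact:
  assumes "def_fun T" "def_fun Q" "def_fun h" "def_fun t" "def_fun j" "def_fun i" "def_fun a"
  shows "def_pred (\<lambda>w \<rho>. init_fact M (T w \<rho>) (Q w \<rho>) (fst w) (h w \<rho>) (t w \<rho>) (j w \<rho>) (i w \<rho>) (a w \<rho>))"
  unfolding init_fact_def by (intro def_intros assms)

lemma def_pred_reject_fact:
  assumes "def_fun T" "def_fun h" "def_fun t" "def_fun j" "def_fun i" "def_fun a"
  shows "def_pred (\<lambda>w \<rho>. reject_fact M (T w \<rho>) (h w \<rho>) (t w \<rho>) (j w \<rho>) (i w \<rho>) (a w \<rho>))"
  unfolding reject_fact_def by (intro def_intros assms)

lemma def_pred_pair_fact:
  assumes "def_fun h" "def_fun t" "def_fun j" "def_fun i" "def_fun a"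
    "def_fun h'" "def_fun t'" "def_fun j'" "def_fun i'" "def_fun a'"
  shows "def_pred (\<lambda>w \<rho>. pair_fact (h w \<rho>) (t w \<rho>) (j w \<rho>) (i w \<rho>) (a w \<rho>)
    (h' w \<rho>) (t' w \<rho>) (j' w \<rho>) (i' w \<rho>) (a' w \<rho>))"
  unfolding pair_fact_def by (intro def_intros assms)

lemma def_pred_rule_fact:
  assumes "def_fun T" "def_fun h1" "def_fun t1" "def_fun j1" "def_fun i1" "def_fun a1"
    "def_fun h2" "def_fun t2" "def_fun j2" "def_fun i2" "def_fun a2"
    "def_fun h3" "def_fun t3" "def_fun j3" "def_fun i3" "def_fun a3"
  shows "def_pred (\<lambda>w \<rho>. rule_fact M K (T w \<rho>) (h1 w \<rho>) (t1 w \<rho>) (j1 w \<rho>) (i1 w \<rho>) (a1 w \<rho>)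
    (h2 w \<rho>) (t2 w \<rho>) (j2 w \<rho>) (i2 w \<rho>) (a2 w \<rho>) (h3 w \<rho>) (t3 w \<rho>) (j3 w \<rho>) (i3 w \<rho>) (a3 w \<rho>))"
  unfolding rule_fact_def by (intro def_intros def_fun_tab1 def_fun_tab2 assms)

lemma def_pred_facts:
  assumes "def_fun T" "def_fun Q" "def_fun B" "def_fun F"
  shows "def_pred (\<lambda>w \<rho>. In_fact M (T w \<rho>) (Q w \<rho>) (fst w) (B w \<rho>) (F w \<rho>))"
    "def_pred (\<lambda>w \<rho>. No_fact M (T w \<rho>) (B w \<rho>) (F w \<rho>))"
    "def_fun G \<Longrightarrow> def_pred (\<lambda>w \<rho>. Pr_fact (B w \<rho>) (F w \<rho>) (G w \<rho>))"
    "def_fun G \<Longrightarrow> def_fun H \<Longrightarrow> def_pred (\<lambda>w \<rho>. Rl_fact M K (T w \<rho>) (B w \<rho>) (F w \<rho>) (G w \<rho>) (H w \<rho>))"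
  unfolding In_fact_def No_fact_def Pr_fact_def Rl_fact_def with_digits_def
  by (intro def_pred_init_fact def_pred_reject_fact def_pred_pair_fact def_pred_rule_fact
      def_fun_div def_fun_mod assms; assumption)+

text \<open>The four relations are parameters, so their definability is assumed in the form of
  closure under substitution of definable arguments.\<close>

lemma def_pred_node_rel:
  assumes V: "def_fun V"
    and In: "\<And>F. def_fun F \<Longrightarrow> def_pred (\<lambda>w \<rho>. In w \<rho> (F w \<rho>))"
    and No: "\<And>F. def_fun F \<Longrightarrow> def_pred (\<lambda>w \<rho>. No w \<rho> (F w \<rho>))"
    and Pr: "\<And>F G. def_fun F \<Longrightarrow> def_fun G \<Longrightarrow> def_pred (\<lambda>w \<rho>. Pr w \<rho> (F w \<rho>) (G w \<rho>))"
    and Rl: "\<And>F G H. def_fun F \<Longrightarrow> def_fun G \<Longrightarrow> def_fun H \<Longrightarrow>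
      def_pred (\<lambda>w \<rho>. Rl w \<rho> (F w \<rho>) (G w \<rho>) (H w \<rho>))"
    and "def_fun F" "def_fun G"
  shows "def_pred (\<lambda>w \<rho>. node_rel k (V w \<rho>) (In w \<rho>) (No w \<rho>) (Pr w \<rho>) (Rl w \<rho>) (F w \<rho>) (G w \<rho>))"
proof -
  have gadget: "def_pred (\<lambda>w \<rho>. gadget_edge k (In w \<rho>) (No w \<rho>) (Pr w \<rho>) (Rl w \<rho>)
      (i w \<rho>) (a w \<rho>) (b w \<rho>) (c w \<rho>) (i' w \<rho>) (a' w \<rho>) (b' w \<rho>) (c' w \<rho>))"
    if "def_fun i" "def_fun a" "def_fun b" "def_fun c" "def_fun i'" "def_fun a'" "def_fun b'" "def_fun c'"
    for i a b c i' a' b' c'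
    unfolding gadget_edge_def insert_iff empty_iff by (intro In No Pr Rl def_intros that)
  have "def_pred (\<lambda>w \<rho>. node_edge k (V w \<rho>) (In w \<rho>) (No w \<rho>) (Pr w \<rho>) (Rl w \<rho>) (F w \<rho>) (G w \<rho>))"
    if "def_fun F" "def_fun G" for F G
    unfolding node_edge_def by (intro gadget def_fun_div def_fun_mod that V)
  then show ?thesis
    unfolding node_rel_def using assms(6,7) by (intro def_pred_disj)
qed

lemma def_pred_pad:
  assumes "def_fun N" "def_fun v"
    and E: "\<And>F G. def_fun F \<Longrightarrow> def_fun G \<Longrightarrow> def_pred (\<lambda>w \<rho>. E w \<rho> (F w \<rho>) (G w \<rho>))"
    and "def_fun F" "def_fun G"
  shows "def_pred (\<lambda>w \<rho>. pad (N w \<rho>) (v w \<rho>) (E w \<rho>) (F w \<rho>) (G w \<rho>))"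
  unfolding pad_def by (intro E def_intros assms)

text \<open>Positions below \<open>n\<close> form the unary prefix, \<open>n\<close> is the
  separator, and beyond it quotient and remainder by \<open>n\<close> are row and column. The
  diagonal is excluded because \<open>rel_graph\<close> drops loops.\<close>

lemma nth_encode_rel_graph:
  assumes "\<And>u v. E u v \<Longrightarrow> E v u" "c < n * n + n + 1"
  shows "encode (rel_graph n E) ! c \<longleftrightarrow> c < n \<or> n < c \<and>
    (c - (n + 1)) div n \<noteq> (c - (n + 1)) mod n \<and> E ((c - (n + 1)) div n) ((c - (n + 1)) mod n)"
proof -
  let ?d = "c - (n + 1)"
  let ?C = "concat (map (\<lambda>i. map (\<lambda>j. {i, j} \<in> snd (rel_graph n E)) [0..<n]) [0..<n])"
  have e: "encode (rel_graph n E) = replicate n True @ [False] @ ?C"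
    by (simp add: encode_def)
  consider "c < n" | "c = n" | "n < c" by linarith
  then show ?thesis
  proof cases
    case 3
    then have "?d < n * n" using assms(2) by linarith
    then have *: "?d div n < n" "?d mod n < n"
      by (simp_all add: less_mult_imp_div_less mod_less_divisor) (use \<open>?d < n * n\<close> in \<open>cases n; simp\<close>)+
    have "encode (rel_graph n E) ! c = ?C ! (?d div n * n + ?d mod n)"
      unfolding e using 3 by (simp add: nth_append)
    also have "\<dots> = ({?d div n, ?d mod n} \<in> snd (rel_graph n E))"
      by (rule nth_concat_square[OF *])
    finally show ?thesis
      using 3 * rel_graph_edge[OF assms(1)] by simp
  qed (simp_all add: e nth_append)
qed

theorem labeling_NP_hard:
  assumes k: "3 \<le> k"
  shows "NP_hard (graph_problem (\<lambda>G. chromatic_number G = k + 1) (has_labeling_by_degree k))"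
  unfolding NP_hard_def
proof (intro allI impI)
  fix L assume "in_NP (L, - L)"
  then obtain M and p q :: "nat poly" where wf: "wf_tm M"
    and NP: "\<forall>x \<in> L \<union> - L. \<forall>y. length y \<le> poly q (length x) \<longrightarrow>
      accepts_within M [x, y] (poly p (length x)) \<or> rejects_within M [x, y] (poly p (length x))"
      "\<forall>x \<in> L. \<exists>y. length y \<le> poly q (length x) \<and> accepts_within M [x, y] (poly p (length x))"
      "\<forall>x \<in> - L. \<forall>y. length y \<le> poly q (length x) \<longrightarrow> rejects_within M [x, y] (poly p (length x))"
    unfolding in_NP_def fst_conv snd_conv by blast
  have dec: "accepts_within M [x, y] (poly p (length x)) \<or> rejects_within M [x, y] (poly p (length x))"
    if "length y \<le> poly q (length x)" for x y
    using NP(1) that by blast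
  have yes: "\<exists>y. length y \<le> poly q (length x) \<and> accepts_within M [x, y] (poly p (length x))"
    if "x \<in> L" for x
    using NP(2) that by blast
  have no: "rejects_within M [x, y] (poly p (length x))"
    if "x \<notin> L" "length y \<le> poly q (length x)" for x y
    using NP(3) that by blast
  obtain K where K: "code_bound M K" "k < K" using code_bound_exists by blast
  \<comment> \<open>\<open>B\<close> exceeds every digit of a relevant fact, \<open>V\<close> is the
    number of facts, \<open>N\<close> the number of nodes and \<open>n\<close> the number of
    vertices after padding.\<close>
  define B where "B l = 2 * poly p l + poly q l + K" for l
  define V where "V l = B l * B l * B l * B l * B l" for l
  define N where "N l = 8 * V l * V l * V l" for l
  define n where "n l = N l * Suc (N l)" for l
  let ?In = "\<lambda>x. In_fact M (poly p (length x)) (poly q (length x)) x (B (length x))"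
  let ?No = "\<lambda>x. No_fact M (poly p (length x)) (B (length x))"
  let ?Pr = "\<lambda>x. Pr_fact (B (length x))"
  let ?Rl = "\<lambda>x. Rl_fact M K (poly p (length x)) (B (length x))"
  define E where "E x = pad (N (length x)) (2 * V (length x) * V (length x) * V (length x))
    (node_rel k (V (length x)) (?In x) (?No x) (?Pr x) (?Rl x))" for x
  define f where "f x = encode (rel_graph (n (length x)) (E x))" for x

  have graph: "chromatic_number (rel_graph (n (length x)) (E x)) = k + 1"
    "has_labeling_by_degree k (rel_graph (n (length x)) (E x)) \<longleftrightarrow> x \<in> L"
    "\<And>u v. E x u v \<Longrightarrow> E x v u" for x
  proof -
    let ?l = "length x"
    \<comment> \<open>One side of each pair: the end marks and the set bits. Initial facts have
      kinds 0 to 2 and stay outside.\<close>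
    let ?Fst = "{f. with_digits (B ?l) (\<lambda>h t j i a. h = 4 \<and> (j = 0 \<or> j = 2)) f}"
    have KB: "K \<le> B ?l" by (simp add: B_def)
    have "B ?l * 1 \<le> V ?l"
      unfolding V_def mult.assoc by (intro mult_le_mono2) (use K KB in \<open>simp add: Suc_le_eq\<close>)
    then have "k < V ?l" using K KB by linarith
    then interpret h: horn_system k "V ?l" "?In x" "?No x" "?Pr x" "?Rl x" ?Fst
      using k by unfold_locales
        (auto simp: In_fact_def Pr_fact_def with_digits_def init_fact_def pair_fact_def)
    have G: "h.G = rel_graph (n ?l) (E x)"
      unfolding h.tot_def unfolding h.N_def n_def N_def E_def ..
    show "chromatic_number (rel_graph (n ?l) (E x)) = k + 1"
      using h.chromatic_number_G unfolding G .
    have "has_labeling_by_degree k (rel_graph (n ?l) (E x)) \<longleftrightarrow>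
        (\<exists>A. solution (V ?l) (?In x) (?No x) (?Pr x) (?Rl x) A)"
      using h.has_labeling_iff_solution unfolding G .
    also have "\<dots> \<longleftrightarrow> (\<exists>y. length y \<le> poly q ?l \<and> accepts_within M [x, y] (poly p ?l))"
    proof
      assume "\<exists>A. solution (V ?l) (?In x) (?No x) (?Pr x) (?Rl x) A"
      then obtain A where A: "solution (V ?l) (?In x) (?No x) (?Pr x) (?Rl x) A" ..
      have "2 * poly p ?l + poly q ?l + K \<le> B ?l" by (simp add: B_def)
      from accepts_if_solution[OF wf K(1) this A[unfolded V_def] dec]
      show "\<exists>y. length y \<le> poly q ?l \<and> accepts_within M [x, y] (poly p ?l)" by blast
    next
      assume "\<exists>y. length y \<le> poly q ?l \<and> accepts_within M [x, y] (poly p ?l)"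
      then obtain y where y: "length y \<le> poly q ?l" "accepts_within M [x, y] (poly p ?l)" by blast
      interpret r: np_run M x y using wf by unfold_locales
      show "\<exists>A. solution (V ?l) (?In x) (?No x) (?Pr x) (?Rl x) A"
        using r.solution_if_accepts[OF K(1) y] by blast
    qed
    also have "\<dots> \<longleftrightarrow> x \<in> L"
    proof -
      have "\<not> (accepts_within M [x, y] t \<and> rejects_within M [x, y] t)" for y t
        using wf by (auto simp: accepts_within_def rejects_within_def wf_tm_def)
      then show ?thesis using yes no by blast
    qed
    finally show "has_labeling_by_degree k (rel_graph (n ?l) (E x)) \<longleftrightarrow> x \<in> L" .
    show "\<And>u v. E x u v \<Longrightarrow> E x v u"
      using h.pad_sym unfolding E_def N_def h.N_def .
  qed

  have def_B: "def_fun (\<lambda>w \<rho>. B (length (fst w)))"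
    unfolding B_def by (intro def_intros)
  have def_V: "def_fun (\<lambda>w \<rho>. V (length (fst w)))"
    unfolding V_def by (intro def_intros def_B)
  have def_N: "def_fun (\<lambda>w \<rho>. N (length (fst w)))"
    unfolding N_def by (intro def_intros def_V)
  have def_n: "def_fun (\<lambda>w \<rho>. n (length (fst w)))"
    unfolding n_def by (intro def_intros def_N)
  have def_p: "def_fun (\<lambda>w \<rho>. poly p (length (fst w)))" for p :: "nat poly"
    by (intro def_intros)
  have def_E: "def_pred (\<lambda>w \<rho>. E (fst w) (F w \<rho>) (G w \<rho>))" if "def_fun F" "def_fun G" for F G
    unfolding E_def
    by (intro def_pred_pad def_pred_node_rel def_pred_facts def_intros def_B def_V def_N def_p that; assumption?)

  have "poly_time_computable f"
  proof (rule poly_time_computableI[where D = "\<lambda>l. n l * n l + n l + 1" and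
      E = "\<lambda>x c. if c < n (length x) \<or> n (length x) < c \<and>
        (c - (n (length x) + 1)) div n (length x) \<noteq> (c - (n (length x) + 1)) mod n (length x) \<and>
        E x ((c - (n (length x) + 1)) div n (length x)) ((c - (n (length x) + 1)) mod n (length x))
        then 2 else 1"])
    show "def_fun (\<lambda>w \<rho>. n (length (fst w)) * n (length (fst w)) + n (length (fst w)) + 1)"
      by (intro def_intros def_n)
    show "def_fun (\<lambda>w \<rho>. if get \<rho> 0 < n (length (fst w)) \<or> n (length (fst w)) < get \<rho> 0 \<and>
        (get \<rho> 0 - (n (length (fst w)) + 1)) div n (length (fst w)) \<noteq>
          (get \<rho> 0 - (n (length (fst w)) + 1)) mod n (length (fst w)) \<and>
        E (fst w) ((get \<rho> 0 - (n (length (fst w)) + 1)) div n (length (fst w)))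
          ((get \<rho> 0 - (n (length (fst w)) + 1)) mod n (length (fst w)))
        then 2 else 1)"
      by (intro def_E def_intros def_n)
    show "length (f x) = n (length x) * n (length x) + n (length x) + 1" for x
      by (simp add: f_def length_encode)
    show "(if i < n (length x) \<or> n (length x) < i \<and>
        (i - (n (length x) + 1)) div n (length x) \<noteq> (i - (n (length x) + 1)) mod n (length x) \<and>
        E x ((i - (n (length x) + 1)) div n (length x)) ((i - (n (length x) + 1)) mod n (length x))
        then 2 else 1) = (if f x ! i then 2 else 1 :: nat)"
      if "i < n (length x) * n (length x) + n (length x) + 1" for x i
    proof -
      have "E x u v \<Longrightarrow> E x v u" for u v by (rule graph(3))
      from nth_encode_rel_graph[of "E x" i "n (length x)", OF this that] show ?thesis
        unfolding f_def by simp
    qed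
  qed
  moreover have "f ` L \<subseteq> fst (graph_problem (\<lambda>G. chromatic_number G = k + 1) (has_labeling_by_degree k))"
    unfolding graph_problem_def f_def using graph(1,2) input_graph_rel_graph by auto
  moreover have "f ` (- L) \<subseteq> snd (graph_problem (\<lambda>G. chromatic_number G = k + 1) (has_labeling_by_degree k))"
    unfolding graph_problem_def f_def using graph(1,2) input_graph_rel_graph by auto
  ultimately show "poly_time_reduces (L, - L)
      (graph_problem (\<lambda>G. chromatic_number G = k + 1) (has_labeling_by_degree k))"
    unfolding poly_time_reduces_def by auto
qed

theorem theorem7:
  shows "poly_time_decidable (graph_problem (\<lambda>G. True) (has_labeling_by_degree 2)) \<and>
    (\<forall>k \<ge> 3. NP_complete
      (graph_problem (\<lambda>G. chromatic_number G = k + 1) (has_labeling_by_degree k)))"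
  using labeling_by_degree_2_poly_time labeling_in_NP labeling_NP_hard by (simp add: NP_complete_def)

end
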